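(* Let $G$ be a finite group acting on $V$, let $\gimel\subset V$ be a $G$-invariant subgroup and let $v\in V$. Let $A\in\mathcal S(\gimel)$ be an element which sends $\mathfrak O^{G}|_{(G\ltimes\gimel)\cdot v/G}$ to itself. Then the action of $A$ on $\mathfrak O^{G}|_{(G\ltimes\gimel)\cdot v/G}$ induces an action of $A$ on $\mathfrak E^{G}|_{(G\ltimes\gimel)\cdot v/G}$; that is, $A$ maps the kernel of the natural surjection $\mathfrak O^{G}|_{(G\ltimes\gimel)\cdot v/G}\to\mathfrak E^{G}|_{(G\ltimes\gimel)\cdot v/G}$ into itself.
   Context: Fix one of two categories, complex-analytic or algebraic. $V$ is a complex Lie group (resp. a complex linear algebraic group) with identity $e$, and the finite group $G$ acts on $V$ by holomorphic (resp. algebraic) group automorphisms, written $g\cdot v=gvg^{-1}$ in $G\ltimes V$. $\mathcal O$ is the structure sheaf of $V$ (holomorphic, resp. polynomial functions), $\mathcal M$ is the sheaf of meromorphic (resp. rational) functions, and $\mathcal O_x,\mathcal M_x$ are the algebras of germs at $x$. For $\xi\in V$, $\phi_\xi$ is left translation $x\mapsto \xi x$; it acts on germs by $\phi_\xi(f)(x)=f(\xi^{-1}x)$, so $\phi_\xi:\mathcal M_x\to\mathcal M_{\xi x}$. Also $(g\cdot f)(x)=f(g^{-1}\cdot x)$, so $g:\mathcal M_x\to\mathcal M_{g\cdot x}$. $\mathcal S(\gimel)$ is the skew-group ring of finite sums $\sum_i f_i\phi_{\xi_i}$ with $f_i$ a global meromorphic (resp. rational) function on $V$ and $\xi_i\in\gimel$,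 with product $f\phi_\xi\circ f'\phi_{\xi'}=f\,\phi_\xi(f')\,\phi_{\xi\xi'}$. It acts on $\mathfrak M=\bigoplus_{x\in V}\mathcal M_x$ by $f\phi_\xi:\mathcal M_x\to\mathcal M_{\xi x}$, $F\mapsto f\,\phi_\xi(F)$. For a $G$-orbit $\bar x\subset V$ put $\mathcal O^G_{\bar x}=\big(\bigoplus_{x'\in\bar x}\mathcal O_{x'}\big)^G$, and for a $G$-invariant $W\subset V$ put $\mathfrak O^G|_{W/G}=\bigoplus_{\bar x\in W/G}\mathcal O^G_{\bar x}\subset\mathfrak M$. $(G\ltimes\gimel)\cdot v=\{g\cdot(\xi v): g\in G,\xi\in\gimel\}$. For $\xi\in V$ let $G_\xi$ be its stabilizer in $G$ and let $\mathcal O^G_\xi=\mathcal O_\xi^{G_\xi}$ be the algebra of germs at $\xi$ of $G$-invariant functions; one has $\phi_\xi(\mathcal O_e^{G_\xi})=\mathcal O^G_\xi$. Let $\mathcal J_e\subset\mathcal O_e$ be the ideal generated by the $G$-invariant germs at $e$ that vanish at $e$. Put $\mathbb E_\xi=\mathcal O^G_\xi/\phi_\xi(\mathcal O_e^{G_\xi}\cap\mathcal J_e)$. The group $G$ acts on the collection of all $\mathbb E_\xi$ ($g:\mathbb E_\xi\to\mathbb E_{g\cdot\xi}$). For an orbit $\bar\xi$ put $\mathbb E^G_{\bar\xi}=\big(\bigoplus_{\xi'\in\bar\xi}\mathbb E_{\xi'}\big)^G$, which is the quotient of $\mathcal O^G_{\bar\xi}$ by $\big[\bigoplus_{\xi'\in\bar\xi}\phi_{\xi'}(\mathcal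 O_e^{G_{\xi'}}\cap\mathcal J_e)\big]^G$. Finally $\mathfrak E^G|_{W/G}=\bigoplus_{\bar\xi\in W/G}\mathbb E^G_{\bar\xi}$, a quotient of $\mathfrak O^G|_{W/G}$. *)

theory Defs
  imports
    Complex_Main
    "HOL-Algebra.Bij"
    "HOL-Algebra.Group_Action"
    "HOL-Algebra.Product_Groups"
    "HOL-Algebra.QuotRing"
    "HOL-Analysis.Function_Topology"
    "HOL-Analysis.Product_Topology"
    "HOL-Analysis.T1_Spaces"
    "HOL-Analysis.L2_Norm"
    "Jordan_Normal_Form.Determinant"
begin

section \<open>Groups carrying a sheaf of functions\<close>

text \<open>
  Both the complex-analytic and the algebraic category are treated as categories of spaces
  with functions: a topology together with, for every open set U, the set of sections of the
  structure sheaf over U, which are complex-valued functions. A section over U is represented by a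
  total function of which only the values on U matter.
\<close>

record 'a space_group = "'a monoid" +
  topo :: "'a topology"
  reg :: "'a set \<Rightarrow> ('a \<Rightarrow> complex) set"

definition function_sheaf :: "'a topology \<Rightarrow> ('a set \<Rightarrow> ('a \<Rightarrow> complex) set) \<Rightarrow> bool" where
  "function_sheaf X S \<longleftrightarrow>
     (\<forall>U W f. openin X U \<and> openin X W \<and> W \<subseteq> U \<and> f \<in> S U \<longrightarrow> f \<in> S W) \<and>
     (\<forall>U f h. openin X U \<and> f \<in> S U \<and> (\<forall>x\<in>U. h x = f x) \<longrightarrow> h \<in> S U) \<and>
     (\<forall>U f. openin X U \<and> (\<forall>x\<in>U. \<exists>W. openin X W \<and> x \<in> W \<and> W \<subseteq> U \<and> f \<in> S W) \<longrightarrow> f \<in> S U)"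

definition space_morphism ::
  "'a topology \<Rightarrow> ('a set \<Rightarrow> ('a \<Rightarrow> complex) set) \<Rightarrow>
   'b topology \<Rightarrow> ('b set \<Rightarrow> ('b \<Rightarrow> complex) set) \<Rightarrow> ('a \<Rightarrow> 'b) \<Rightarrow> bool" where
  "space_morphism X S Y S' h \<longleftrightarrow>
     continuous_map X Y h \<and>
     (\<forall>U f. openin Y U \<and> f \<in> S' U \<longrightarrow> f \<circ> h \<in> S {x \<in> topspace X. h x \<in> U})"


subsection \<open>Complex Lie groups\<close>

text \<open>
  Points of complex n-space are the extensional functions on \<open>{..<n}\<close>, so that the dimension n
  is a natural number, and zero is allowed.
\<close>

definition Cn :: "nat \<Rightarrow> (nat \<Rightarrow> complex) topology" where
  "Cn n = product_topology (\<lambda>_. euclidean) {..<n}"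

text \<open>Holomorphic: complex (Frechet) differentiable at every point of the open set D.\<close>

definition holomorphic_Cn :: "nat \<Rightarrow> (nat \<Rightarrow> complex) set \<Rightarrow> ((nat \<Rightarrow> complex) \<Rightarrow> complex) \<Rightarrow> bool" where
  "holomorphic_Cn n D f \<longleftrightarrow>
     openin (Cn n) D \<and>
     (\<forall>z\<in>D. \<exists>c :: nat \<Rightarrow> complex.
        ((\<lambda>w. (f w - f z - (\<Sum>i<n. c i * (w i - z i))) /
               complex_of_real (L2_set (\<lambda>i. cmod (w i - z i)) {..<n})) \<longlongrightarrow> 0) (atin (Cn n) z))"

definition holomorphic_chart ::
  "nat \<Rightarrow> 'a topology \<Rightarrow> ('a set \<Rightarrow> ('a \<Rightarrow> complex) set) \<Rightarrow> 'a set \<Rightarrow> ('a \<Rightarrow> nat \<Rightarrow> complex) \<Rightarrow> bool" where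
  "holomorphic_chart n X S U c \<longleftrightarrow>
     openin X U \<and> openin (Cn n) (c ` U) \<and>
     homeomorphic_map (subtopology X U) (subtopology (Cn n) (c ` U)) c \<and>
     (\<forall>W f. openin X W \<and> W \<subseteq> U \<longrightarrow>
        (f \<in> S W \<longleftrightarrow> holomorphic_Cn n (c ` W) (f \<circ> inv_into U c)))"

text \<open>Second countability is not required.\<close>

definition complex_manifold ::
  "nat \<Rightarrow> 'a topology \<Rightarrow> ('a set \<Rightarrow> ('a \<Rightarrow> complex) set) \<Rightarrow> bool" where
  "complex_manifold n X S \<longleftrightarrow>
     Hausdorff_space X \<and> function_sheaf X S \<and>
     (\<forall>x\<in>topspace X. \<exists>U c. x \<in> U \<and> holomorphic_chart n X S U c)"

text \<open>
  Holomorphic functions on open subsets of the product of an n-dimensional manifold with itself: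
  those which are holomorphic in 2n variables in all products of two charts.
\<close>

definition product_holomorphic ::
  "nat \<Rightarrow> 'a topology \<Rightarrow> ('a set \<Rightarrow> ('a \<Rightarrow> complex) set) \<Rightarrow> ('a \<times> 'a) set \<Rightarrow> ('a \<times> 'a \<Rightarrow> complex) set" where
  "product_holomorphic n X S W =
     {f. \<forall>U c U' c'. holomorphic_chart n X S U c \<and> holomorphic_chart n X S U' c' \<longrightarrow>
        (let l = (\<lambda>z. \<lambda>i\<in>{..<n}. z i); r = (\<lambda>z. \<lambda>i\<in>{..<n}. z (n + i));
             p = (\<lambda>z. (inv_into U c (l z), inv_into U' c' (r z)))
         in holomorphic_Cn (n + n)
              {z \<in> topspace (Cn (n + n)). l z \<in> c ` U \<and> r z \<in> c' ` U' \<and> p z \<in> W} (f \<circ> p))}"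

definition complex_lie_group :: "'a space_group \<Rightarrow> bool" where
  "complex_lie_group V \<longleftrightarrow>
     group V \<and> topspace (topo V) = carrier V \<and>
     (\<exists>n. complex_manifold n (topo V) (reg V) \<and>
        space_morphism (prod_topology (topo V) (topo V)) (product_holomorphic n (topo V) (reg V))
          (topo V) (reg V) (\<lambda>(x, y). x \<otimes>\<^bsub>V\<^esub> y) \<and>
        space_morphism (topo V) (reg V) (topo V) (reg V) (\<lambda>x. inv\<^bsub>V\<^esub> x))"


subsection \<open>Complex linear algebraic groups\<close>

inductive_set generated_algebra :: "('b \<Rightarrow> complex) set \<Rightarrow> ('b \<Rightarrow> complex) set"
  for E :: "('b \<Rightarrow> complex) set" where
  const: "(\<lambda>_. c) \<in> generated_algebra E"
| gen: "f \<in> E \<Longrightarrow> f \<in> generated_algebra E"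
| add: "f \<in> generated_algebra E \<Longrightarrow> h \<in> generated_algebra E \<Longrightarrow> (\<lambda>x. f x + h x) \<in> generated_algebra E"
| mult: "f \<in> generated_algebra E \<Longrightarrow> h \<in> generated_algebra E \<Longrightarrow> (\<lambda>x. f x * h x) \<in> generated_algebra E"

definition GL :: "nat \<Rightarrow> complex mat monoid" where
  "GL n = units_of (ring_mat TYPE(complex) n ())"

definition GL_polynomials :: "nat \<Rightarrow> (complex mat \<Rightarrow> complex) set" where
  "GL_polynomials n =
     generated_algebra ({\<lambda>M. M $$ (i, j) | i j. i < n \<and> j < n} \<union> {\<lambda>M. 1 / Determinant.det M})"

text \<open>
  \<open>V\<close> is a Zariski closed subgroup of some \<open>GL n\<close>, up to an injective homomorphism \<open>\<rho>\<close> along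
  which the Zariski topology and the sheaf of regular functions are transported.
\<close>

definition linear_algebraic_group :: "'a space_group \<Rightarrow> bool" where
  "linear_algebraic_group V \<longleftrightarrow>
     group V \<and>
     (\<exists>n \<rho>. \<rho> \<in> hom V (GL n) \<and> inj_on \<rho> (carrier V) \<and>
        (\<exists>P \<subseteq> GL_polynomials n. \<rho> ` carrier V = {M \<in> carrier (GL n). \<forall>p\<in>P. p M = 0}) \<and>
        (\<forall>U. openin (topo V) U \<longleftrightarrow>
           (\<exists>P \<subseteq> GL_polynomials n. U = {x \<in> carrier V. \<exists>p\<in>P. p (\<rho> x) \<noteq> 0})) \<and>
        (\<forall>U. reg V U =
           {f. \<forall>x\<in>U. \<exists>W p q. openin (topo V) W \<and> x \<in> W \<and> W \<subseteq> U \<and>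
              p \<in> GL_polynomials n \<and> q \<in> GL_polynomials n \<and>
              (\<forall>y\<in>W. q (\<rho> y) \<noteq> 0 \<and> f y = p (\<rho> y) / q (\<rho> y))}))"


subsection \<open>Actions by automorphisms\<close>

definition acts_by_automorphisms :: "'a space_group \<Rightarrow> 'g monoid \<Rightarrow> ('g \<Rightarrow> 'a \<Rightarrow> 'a) \<Rightarrow> bool" where
  "acts_by_automorphisms V G act \<longleftrightarrow>
     act \<in> hom G (AutoGroup V) \<and>
     (\<forall>g\<in>carrier G. space_morphism (topo V) (reg V) (topo V) (reg V) (act g))"


section \<open>Germs\<close>

definition germ :: "'a space_group \<Rightarrow> 'a \<Rightarrow> ('a \<Rightarrow> complex) \<Rightarrow> ('a \<Rightarrow> complex) set" where
  "germ V x f = {h. \<exists>U. openin (topo V) U \<and> x \<in> U \<and> (\<forall>y\<in>U. h y = f y)}"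

definition stalk :: "'a space_group \<Rightarrow> 'a \<Rightarrow> ('a \<Rightarrow> complex) set ring" where
  "stalk V x =
     \<lparr>carrier = {germ V x f | f. \<exists>U. openin (topo V) U \<and> x \<in> U \<and> f \<in> reg V U},
      monoid.mult = (\<lambda>a b. \<Union>f\<in>a. \<Union>h\<in>b. germ V x (\<lambda>y. f y * h y)),
      one = germ V x (\<lambda>_. 1),
      zero = germ V x (\<lambda>_. 0),
      add = (\<lambda>a b. \<Union>f\<in>a. \<Union>h\<in>b. germ V x (\<lambda>y. f y + h y))\<rparr>"


subsection \<open>Total rings of fractions\<close>

definition nonzerodivisors :: "('r, 'm) ring_scheme \<Rightarrow> 'r set" where
  "nonzerodivisors R = {s \<in> carrier R. \<forall>a\<in>carrier R. a \<otimes>\<^bsub>R\<^esub> s = \<zero>\<^bsub>R\<^esub> \<longrightarrow> a = \<zero>\<^bsub>R\<^esub>}"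

definition fraction :: "('r, 'm) ring_scheme \<Rightarrow> 'r \<Rightarrow> 'r \<Rightarrow> ('r \<times> 'r) set" where
  "fraction R a s = {(b, t). b \<in> carrier R \<and> t \<in> nonzerodivisors R \<and> a \<otimes>\<^bsub>R\<^esub> t = b \<otimes>\<^bsub>R\<^esub> s}"

definition fraction_ring :: "('r, 'm) ring_scheme \<Rightarrow> ('r \<times> 'r) set ring" where
  "fraction_ring R =
     \<lparr>carrier = {fraction R a s | a s. a \<in> carrier R \<and> s \<in> nonzerodivisors R},
      monoid.mult = (\<lambda>X Y. \<Union>(a, s)\<in>X. \<Union>(b, t)\<in>Y. fraction R (a \<otimes>\<^bsub>R\<^esub> b) (s \<otimes>\<^bsub>R\<^esub> t)),
      one = fraction R \<one>\<^bsub>R\<^esub> \<one>\<^bsub>R\<^esub>,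
      zero = fraction R \<zero>\<^bsub>R\<^esub> \<one>\<^bsub>R\<^esub>,
      add = (\<lambda>X Y. \<Union>(a, s)\<in>X. \<Union>(b, t)\<in>Y.
               fraction R (a \<otimes>\<^bsub>R\<^esub> t \<oplus>\<^bsub>R\<^esub> b \<otimes>\<^bsub>R\<^esub> s) (s \<otimes>\<^bsub>R\<^esub> t))\<rparr>"


subsection \<open>Germs of meromorphic (rational) functions\<close>

type_synonym 'a mgerm = "(('a \<Rightarrow> complex) set \<times> ('a \<Rightarrow> complex) set) set"

definition mero :: "'a space_group \<Rightarrow> 'a \<Rightarrow> 'a mgerm ring" where
  "mero V x = fraction_ring (stalk V x)"

text \<open>
  \<open>hol V x\<close> is the ring of germs of sections of the structure sheaf, regarded as a subring of
  \<open>mero V x\<close>.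
\<close>

definition hol_germ :: "'a space_group \<Rightarrow> 'a \<Rightarrow> ('a \<Rightarrow> complex) \<Rightarrow> 'a mgerm" where
  "hol_germ V x f = fraction (stalk V x) (germ V x f) \<one>\<^bsub>stalk V x\<^esub>"

definition hol :: "'a space_group \<Rightarrow> 'a \<Rightarrow> 'a mgerm ring" where
  "hol V x =
     (mero V x)\<lparr>carrier := {hol_germ V x f | f. \<exists>U. openin (topo V) U \<and> x \<in> U \<and> f \<in> reg V U}\<rparr>"

definition vanishing_germs :: "'a space_group \<Rightarrow> 'a \<Rightarrow> 'a mgerm set" where
  "vanishing_germs V x =
     {hol_germ V x f | f. (\<exists>U. openin (topo V) U \<and> x \<in> U \<and> f \<in> reg V U) \<and> f x = 0}"

text \<open>
  Sections of the sheaf of total rings of fractions: the germs are locally those of one quotient of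
  two sections of the structure sheaf.
\<close>

definition global_mero :: "'a space_group \<Rightarrow> ('a \<Rightarrow> 'a mgerm) set" where
  "global_mero V =
     {m \<in> (\<Pi>\<^sub>E x\<in>carrier V. carrier (mero V x)).
        \<forall>x\<in>carrier V. \<exists>U p q. openin (topo V) U \<and> x \<in> U \<and> p \<in> reg V U \<and> q \<in> reg V U \<and>
          (\<forall>y\<in>U. germ V y q \<in> nonzerodivisors (stalk V y) \<and>
             m y = fraction (stalk V y) (germ V y p) (germ V y q))}"

text \<open>
  If \<open>t\<close> is an automorphism of the space \<open>V\<close> with inverse \<open>s\<close>, then \<open>push V s (t x)\<close> maps a germ
  at \<open>x\<close> represented by \<open>f\<close> to the germ at \<open>t x\<close> represented by \<open>f \<circ> s\<close>.
\<close>

definition push :: "'a space_group \<Rightarrow> ('a \<Rightarrow> 'a) \<Rightarrow> 'a \<Rightarrow> ('a \<Rightarrow> complex) set \<Rightarrow> ('a \<Rightarrow> complex) set" where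
  "push V s y a = (\<Union>f\<in>a. germ V y (f \<circ> s))"

definition mero_push :: "'a space_group \<Rightarrow> ('a \<Rightarrow> 'a) \<Rightarrow> 'a \<Rightarrow> 'a mgerm \<Rightarrow> 'a mgerm" where
  "mero_push V s y m = (\<Union>(a, b)\<in>m. fraction (stalk V y) (push V s y a) (push V s y b))"

definition translate :: "'a space_group \<Rightarrow> 'a \<Rightarrow> 'a \<Rightarrow> 'a mgerm \<Rightarrow> 'a mgerm" where
  "translate V \<xi> x = mero_push V (\<lambda>y. inv\<^bsub>V\<^esub> \<xi> \<otimes>\<^bsub>V\<^esub> y) (\<xi> \<otimes>\<^bsub>V\<^esub> x)"

definition gact :: "'a space_group \<Rightarrow> 'g monoid \<Rightarrow> ('g \<Rightarrow> 'a \<Rightarrow> 'a) \<Rightarrow> 'g \<Rightarrow> 'a \<Rightarrow> 'a mgerm \<Rightarrow> 'a mgerm" where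
  "gact V G act g x = mero_push V (act (inv\<^bsub>G\<^esub> g)) (act g x)"


section \<open>The skew group ring and its action\<close>

text \<open>Translation of a family of germs, in particular of a global meromorphic function.\<close>

definition translate_family :: "'a space_group \<Rightarrow> 'a \<Rightarrow> ('a \<Rightarrow> 'a mgerm) \<Rightarrow> 'a \<Rightarrow> 'a mgerm" where
  "translate_family V \<xi> F =
     (\<lambda>y\<in>carrier V. translate V \<xi> (inv\<^bsub>V\<^esub> \<xi> \<otimes>\<^bsub>V\<^esub> y) (F (inv\<^bsub>V\<^esub> \<xi> \<otimes>\<^bsub>V\<^esub> y)))"

definition skew_support :: "'a space_group \<Rightarrow> 'a set \<Rightarrow> ('a \<Rightarrow> 'a \<Rightarrow> 'a mgerm) \<Rightarrow> 'a set" where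
  "skew_support V L A = {\<xi> \<in> L. \<exists>x\<in>carrier V. A \<xi> x \<noteq> \<zero>\<^bsub>mero V x\<^esub>}"

text \<open>
  The element \<open>\<Sum>\<^sub>i f\<^sub>i \<phi>\<^bsub>\<xi>\<^sub>i\<^esub>\<close> is represented by the finitely supported function
  taking \<open>\<xi>\<^sub>i\<close> to \<open>f\<^sub>i\<close>.
\<close>

definition skew_group_ring :: "'a space_group \<Rightarrow> 'a set \<Rightarrow> ('a \<Rightarrow> 'a \<Rightarrow> 'a mgerm) ring" where
  "skew_group_ring V L =
     \<lparr>carrier = {A \<in> L \<rightarrow>\<^sub>E global_mero V. finite (skew_support V L A)},
      monoid.mult = (\<lambda>A B. \<lambda>\<zeta>\<in>L. \<lambda>x\<in>carrier V. \<Oplus>\<^bsub>mero V x\<^esub>\<xi>\<in>skew_support V L A.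
                A \<xi> x \<otimes>\<^bsub>mero V x\<^esub> translate_family V \<xi> (B (inv\<^bsub>V\<^esub> \<xi> \<otimes>\<^bsub>V\<^esub> \<zeta>)) x),
      one = (\<lambda>\<zeta>\<in>L. \<lambda>x\<in>carrier V. if \<zeta> = \<one>\<^bsub>V\<^esub> then \<one>\<^bsub>mero V x\<^esub> else \<zero>\<^bsub>mero V x\<^esub>),
      zero = (\<lambda>\<zeta>\<in>L. \<lambda>x\<in>carrier V. \<zero>\<^bsub>mero V x\<^esub>),
      add = (\<lambda>A B. \<lambda>\<zeta>\<in>L. \<lambda>x\<in>carrier V. A \<zeta> x \<oplus>\<^bsub>mero V x\<^esub> B \<zeta> x)\<rparr>"

definition skew_act ::
  "'a space_group \<Rightarrow> 'a set \<Rightarrow> ('a \<Rightarrow> 'a \<Rightarrow> 'a mgerm) \<Rightarrow> ('a \<Rightarrow> 'a mgerm) \<Rightarrow> 'a \<Rightarrow> 'a mgerm" where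
  "skew_act V L A F =
     (\<lambda>y\<in>carrier V. \<Oplus>\<^bsub>mero V y\<^esub>\<xi>\<in>skew_support V L A.
        A \<xi> y \<otimes>\<^bsub>mero V y\<^esub> translate_family V \<xi> F y)"


section \<open>Invariant parts of direct sums over points\<close>

definition point_sum :: "'a space_group \<Rightarrow> ('a \<Rightarrow> ('b, 'm) ring_scheme) \<Rightarrow> ('a \<Rightarrow> 'b) monoid" where
  "point_sum V R = sum_group (carrier V) (\<lambda>x. add_monoid (R x))"

text \<open>
  Let \<open>\<sigma> g x\<close> map \<open>R x\<close> to \<open>R (act g x)\<close>. For an orbit \<open>T\<close>, the set \<open>orbit_invariants V G act R \<sigma> T\<close>
  consists of the invariants in the direct sum of the \<open>R x\<close> with \<open>x \<in> T\<close>.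
\<close>

definition orbit_invariants ::
  "'a space_group \<Rightarrow> 'g monoid \<Rightarrow> ('g \<Rightarrow> 'a \<Rightarrow> 'a) \<Rightarrow> ('a \<Rightarrow> ('b, 'm) ring_scheme) \<Rightarrow>
   ('g \<Rightarrow> 'a \<Rightarrow> 'b \<Rightarrow> 'b) \<Rightarrow> 'a set \<Rightarrow> ('a \<Rightarrow> 'b) set" where
  "orbit_invariants V G act R \<sigma> T =
     {F \<in> carrier (point_sum V R).
        (\<forall>x\<in>carrier V - T. F x = \<zero>\<^bsub>R x\<^esub>) \<and>
        (\<forall>g\<in>carrier G. \<forall>x\<in>T. F (act g x) = \<sigma> g x (F x))}"

definition invariant_sum ::
  "'a space_group \<Rightarrow> 'g monoid \<Rightarrow> ('g \<Rightarrow> 'a \<Rightarrow> 'a) \<Rightarrow> ('a \<Rightarrow> ('b, 'm) ring_scheme) \<Rightarrow>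
   ('g \<Rightarrow> 'a \<Rightarrow> 'b \<Rightarrow> 'b) \<Rightarrow> 'a set \<Rightarrow> ('a \<Rightarrow> 'b) monoid" where
  "invariant_sum V G act R \<sigma> W =
     (point_sum V R)\<lparr>carrier :=
        {F \<in> carrier (point_sum V R).
           (\<forall>x\<in>carrier V - W. F x = \<zero>\<^bsub>R x\<^esub>) \<and>
           (\<forall>T\<in>orbits G W act.
              (\<lambda>x\<in>carrier V. if x \<in> T then F x else \<zero>\<^bsub>R x\<^esub>) \<in> orbit_invariants V G act R \<sigma> T)}\<rparr>"

definition O_sum :: "'a space_group \<Rightarrow> 'g monoid \<Rightarrow> ('g \<Rightarrow> 'a \<Rightarrow> 'a) \<Rightarrow> 'a set \<Rightarrow> ('a \<Rightarrow> 'a mgerm) monoid" where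
  "O_sum V G act W = invariant_sum V G act (hol V) (gact V G act) W"


section \<open>The quotients\<close>

text \<open>Germs at \<open>x\<close> invariant under a set \<open>H\<close> of elements of \<open>G\<close> fixing \<open>x\<close>.\<close>

definition inv_hol ::
  "'a space_group \<Rightarrow> 'g monoid \<Rightarrow> ('g \<Rightarrow> 'a \<Rightarrow> 'a) \<Rightarrow> 'g set \<Rightarrow> 'a \<Rightarrow> 'a mgerm ring" where
  "inv_hol V G act H x =
     (hol V x)\<lparr>carrier := {a \<in> carrier (hol V x). \<forall>g\<in>H. gact V G act g x a = a}\<rparr>"

definition J_e :: "'a space_group \<Rightarrow> 'g monoid \<Rightarrow> ('g \<Rightarrow> 'a \<Rightarrow> 'a) \<Rightarrow> 'a mgerm set" where
  "J_e V G act =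
     Idl\<^bsub>hol V \<one>\<^bsub>V\<^esub>\<^esub> (carrier (inv_hol V G act (carrier G) \<one>\<^bsub>V\<^esub>) \<inter> vanishing_germs V \<one>\<^bsub>V\<^esub>)"

definition E_ideal :: "'a space_group \<Rightarrow> 'g monoid \<Rightarrow> ('g \<Rightarrow> 'a \<Rightarrow> 'a) \<Rightarrow> 'a \<Rightarrow> 'a mgerm set" where
  "E_ideal V G act \<xi> =
     translate V \<xi> \<one>\<^bsub>V\<^esub> ` (carrier (inv_hol V G act (stabilizer G act \<xi>) \<one>\<^bsub>V\<^esub>) \<inter> J_e V G act)"

definition E_ring :: "'a space_group \<Rightarrow> 'g monoid \<Rightarrow> ('g \<Rightarrow> 'a \<Rightarrow> 'a) \<Rightarrow> 'a \<Rightarrow> 'a mgerm set ring" where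
  "E_ring V G act \<xi> = inv_hol V G act (stabilizer G act \<xi>) \<xi> Quot E_ideal V G act \<xi>"

text \<open>\<open>G\<close> acts on residue classes elementwise.\<close>

definition E_sum :: "'a space_group \<Rightarrow> 'g monoid \<Rightarrow> ('g \<Rightarrow> 'a \<Rightarrow> 'a) \<Rightarrow> 'a set \<Rightarrow> ('a \<Rightarrow> 'a mgerm set) monoid" where
  "E_sum V G act W = invariant_sum V G act (E_ring V G act) (\<lambda>g x c. gact V G act g x ` c) W"

definition O_to_E ::
  "'a space_group \<Rightarrow> 'g monoid \<Rightarrow> ('g \<Rightarrow> 'a \<Rightarrow> 'a) \<Rightarrow> ('a \<Rightarrow> 'a mgerm) \<Rightarrow> 'a \<Rightarrow> 'a mgerm set" where
  "O_to_E V G act F =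
     (\<lambda>x\<in>carrier V. E_ideal V G act x +>\<^bsub>inv_hol V G act (stabilizer G act x) x\<^esub> F x)"


definition semidirect_orbit ::
  "'a space_group \<Rightarrow> 'g monoid \<Rightarrow> ('g \<Rightarrow> 'a \<Rightarrow> 'a) \<Rightarrow> 'a set \<Rightarrow> 'a \<Rightarrow> 'a set" where
  "semidirect_orbit V G act L v = {act g (\<xi> \<otimes>\<^bsub>V\<^esub> v) | g \<xi>. g \<in> carrier G \<and> \<xi> \<in> L}"

end

theory Submission
  imports Defs "HOL-Algebra.Subrings"
begin

text \<open>
  The theorem holds because the kernel is generated by families of germs that commute with every
  operator \<open>A\<close>. Let \<open>p\<close> be one of the \<open>G\<close>-invariant germs at the identity \<open>e\<close> that generate the ideal
  \<open>J\<close>, and let \<open>P\<close> be the family with \<open>P\<^sub>x = \<phi>\<^sub>x(p)\<close> for all points \<open>x\<close>. Since \<open>\<phi>\<^sub>\<xi>(P\<^sub>x) = P\<^bsub>\<xi>x\<^esub>\<close>, multiplication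
  by \<open>P\<close> commutes with translations, and hence \<open>A(PF) = P A(F)\<close> for every \<open>A\<close> in the skew group ring
  (lemma \<open>op_constant_mult\<close>). Since \<open>g \<cdot> \<phi>\<^sub>x(p) = \<phi>\<^bsub>g\<cdot>x\<^esub>(g \<cdot> p)\<close> and \<open>p\<close> is invariant, \<open>P\<close> is also
  \<open>G\<close>-invariant, so that multiplication by \<open>P\<close> preserves the invariant families. It even maps them
  into the kernel: translated back to \<open>e\<close>, the germ \<open>(PF)\<^sub>x\<close> is a multiple of \<open>p\<close> (lemma
  \<open>constant_mult_kernel\<close>). If \<open>A\<close> preserves the invariant families, \<open>A(PF) = P A(F)\<close> is therefore in
  the kernel again.

  It remains to see that the products \<open>PF\<close> with \<open>F\<close> invariant span the kernel, and this is where
  finiteness of \<open>G\<close> enters. An element \<open>F\<close> of the kernel is the sum over its finite support of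
  families concentrated at one point \<open>x\<close>, with germ \<open>\<phi>\<^sub>x(a)\<close> there for some \<open>a\<close> in \<open>J\<close>, and \<open>a\<close> is a
  sum of products \<open>r p\<close>. The family concentrated at \<open>x\<close> with germ \<open>\<phi>\<^sub>x(r p)\<close> is \<open>P\<close> times the family
  concentrated at \<open>x\<close> with germ \<open>\<phi>\<^sub>x(r)\<close>. The average over \<open>G\<close> fixes \<open>F\<close>, makes every finite family
  invariant, and commutes with multiplication by \<open>P\<close>; so \<open>F\<close> becomes a sum of products of some
  \<open>P\<close> with an invariant family (lemmas \<open>sent_to_kernel_generator_multiple\<close>,
  \<open>sent_to_kernel_point_family\<close> and theorem \<open>op_kernel\<close>).

  The operator on the quotient comes from the operator above as soon as invariant families map
  onto the quotient. This is again averaging: choose representatives of the cosets at the finitely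
  many points of the support, and average them (lemma \<open>quot_surj\<close>).

  What these arguments need of the complex-analytic and of the algebraic category is that germs of
  functions form commutative rings with constants, and that left translations and the elements of
  \<open>G\<close> transport germs functorially. The first is the locale \<open>space_with_functions\<close>; for the second,
  left translations have to be morphisms of spaces with functions. In a Lie group they are,
  because a holomorphic function in \<open>2n\<close> variables remains holomorphic if the first \<open>n\<close> of them are
  kept constant; in a linear algebraic group, because polynomials in the entries of a matrix and in
  the inverse of its determinant remain such polynomials when the matrix is multiplied by a fixed
  one.
\<close>

section \<open>Total rings of fractions\<close>

lemma UN_pair_eq_constant:
  assumes "X \<noteq> {}" "\<And>c u. (c, u) \<in> X \<Longrightarrow> f c u = K"
  shows "(\<Union>(c, u)\<in>X. f c u) = K"
proof -
  have "(\<Union>(c, u)\<in>X. f c u) = (\<Union>p\<in>X. K)"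
    by (rule SUP_cong) (use assms(2) in auto)
  then show ?thesis using assms(1) by simp
qed

context cring
begin

abbreviation "Frac \<equiv> fraction_ring R"

lemma nonzerodivisors_closed: "s \<in> nonzerodivisors R \<Longrightarrow> s \<in> carrier R"
  by (simp add: nonzerodivisors_def)

lemma one_nonzerodivisor: "\<one> \<in> nonzerodivisors R"
  by (simp add: nonzerodivisors_def)

lemma mult_nonzerodivisor:
  assumes "s \<in> nonzerodivisors R" "t \<in> nonzerodivisors R"
  shows "s \<otimes> t \<in> nonzerodivisors R"
proof -
  have st: "s \<in> carrier R" "t \<in> carrier R"
    using assms by (simp_all add: nonzerodivisors_closed)
  have "a = \<zero>" if a: "a \<in> carrier R" and eq: "a \<otimes> (s \<otimes> t) = \<zero>" for a
  proof -
    have "(a \<otimes> s) \<otimes> t = \<zero>" using eq a st by (simp add: m_assoc)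
    then have "a \<otimes> s = \<zero>" using assms(2) a st by (simp add: nonzerodivisors_def)
    then show ?thesis using assms(1) a by (simp add: nonzerodivisors_def)
  qed
  then show ?thesis using st by (simp add: nonzerodivisors_def)
qed

lemma nonzerodivisor_cancel:
  assumes "a \<in> carrier R" "b \<in> carrier R" "s \<in> nonzerodivisors R" "a \<otimes> s = b \<otimes> s"
  shows "a = b"
proof -
  have s: "s \<in> carrier R" using assms(3) by (rule nonzerodivisors_closed)
  have "(a \<ominus> b) \<otimes> s = \<zero>"
    using assms(1,2,4) s by (simp add: minus_eq l_distr l_minus r_neg)
  then have "a \<ominus> b = \<zero>"
    using assms(1-3) by (simp add: nonzerodivisors_def)
  then show ?thesis using assms(1,2) by (metis minus_equality r_neg add.inv_closed minus_eq minus_minus a_comm)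
qed

text \<open>
  Pairs that are equal in the sense of cross multiplication are the elements of one common set,
  because the nonzerodivisors \<open>s\<close> and \<open>t\<close> can be cancelled. All computations with fractions go
  through representatives by means of this criterion.
\<close>

lemma fraction_eq_iff:
  assumes ab: "a \<in> carrier R" "b \<in> carrier R"
    and st: "s \<in> nonzerodivisors R" "t \<in> nonzerodivisors R"
  shows "fraction R a s = fraction R b t \<longleftrightarrow> a \<otimes> t = b \<otimes> s"
proof
  assume "fraction R a s = fraction R b t"
  moreover have "(b, t) \<in> fraction R b t" using ab st by (simp add: fraction_def)
  ultimately have "(b, t) \<in> fraction R a s" by (simp only:)
  then show "a \<otimes> t = b \<otimes> s" by (simp add: fraction_def)
next
  assume eq: "a \<otimes> t = b \<otimes> s"
  note [simp] = ab st[THEN nonzerodivisors_closed]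
  have *: "a \<otimes> u = c \<otimes> s \<longleftrightarrow> b \<otimes> u = c \<otimes> t"
    if c: "c \<in> carrier R" and u: "u \<in> nonzerodivisors R" for c u
  proof -
    note [simp] = c nonzerodivisors_closed[OF u]
    \<comment> \<open>multiply by \<open>t\<close>, exchange \<open>a t\<close> for \<open>b s\<close>, and cancel \<open>s\<close>\<close>
    have "a \<otimes> u = c \<otimes> s \<longleftrightarrow> (a \<otimes> u) \<otimes> t = (c \<otimes> s) \<otimes> t"
      by (metis nonzerodivisor_cancel st(2) c ab(1) m_closed nonzerodivisors_closed u st(1))
    also have "(a \<otimes> u) \<otimes> t = (b \<otimes> u) \<otimes> s"
      using eq by (metis \<open>u \<in> carrier R\<close> \<open>s \<in> carrier R\<close> \<open>t \<in> carrier R\<close> ab m_assoc m_comm)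
    also have "(c \<otimes> s) \<otimes> t = (c \<otimes> t) \<otimes> s" by (simp add: m_ac)
    also have "(b \<otimes> u) \<otimes> s = (c \<otimes> t) \<otimes> s \<longleftrightarrow> b \<otimes> u = c \<otimes> t"
      by (metis nonzerodivisor_cancel st(1) c ab(2) m_closed nonzerodivisors_closed u st(2))
    finally show ?thesis .
  qed
  show "fraction R a s = fraction R b t"
    unfolding fraction_def using * by blast
qed

lemma fraction_memD:
  assumes "(b, t) \<in> fraction R a s"
  shows "b \<in> carrier R" "t \<in> nonzerodivisors R" "a \<otimes> t = b \<otimes> s"
  using assms by (auto simp: fraction_def)

lemma fraction_self:
  "a \<in> carrier R \<Longrightarrow> s \<in> nonzerodivisors R \<Longrightarrow> (a, s) \<in> fraction R a s"
  by (simp add: fraction_def)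

lemma fraction_nonempty:
  "a \<in> carrier R \<Longrightarrow> s \<in> nonzerodivisors R \<Longrightarrow> fraction R a s \<noteq> {}"
  using fraction_self by blast

lemma fraction_closed:
  "a \<in> carrier R \<Longrightarrow> s \<in> nonzerodivisors R \<Longrightarrow> fraction R a s \<in> carrier Frac"
  by (auto simp: fraction_ring_def)

lemma fraction_ringE:
  assumes "x \<in> carrier Frac"
  obtains a s where "a \<in> carrier R" "s \<in> nonzerodivisors R" "x = fraction R a s"
  using assms by (auto simp: fraction_ring_def)

lemma fraction_mult:
  assumes "a \<in> carrier R" "b \<in> carrier R" "s \<in> nonzerodivisors R" "t \<in> nonzerodivisors R"
  shows "fraction R a s \<otimes>\<^bsub>Frac\<^esub> fraction R b t = fraction R (a \<otimes> b) (s \<otimes> t)"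
proof -
  have *: "fraction R (c \<otimes> d) (u \<otimes> w) = fraction R (a \<otimes> b) (s \<otimes> t)"
    if "(c, u) \<in> fraction R a s" "(d, w) \<in> fraction R b t" for c u d w
  proof -
    note cu = fraction_memD[OF that(1)] and dw = fraction_memD[OF that(2)]
    note [simp] = assms(1,2) assms(3,4)[THEN nonzerodivisors_closed] cu(1) dw(1)
      cu(2)[THEN nonzerodivisors_closed] dw(2)[THEN nonzerodivisors_closed]
    have "(c \<otimes> d) \<otimes> (s \<otimes> t) = (c \<otimes> s) \<otimes> (d \<otimes> t)" by (simp add: m_ac)
    also have "\<dots> = (a \<otimes> u) \<otimes> (b \<otimes> w)" using cu(3) dw(3) by simp
    also have "\<dots> = (a \<otimes> b) \<otimes> (u \<otimes> w)" by (simp add: m_ac)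
    finally show ?thesis
      by (subst fraction_eq_iff) (auto intro: mult_nonzerodivisor assms cu dw)
  qed
  show ?thesis
    unfolding fraction_ring_def monoid.simps
    apply (rule UN_pair_eq_constant[OF fraction_nonempty[OF assms(1,3)]])
    apply (rule UN_pair_eq_constant[OF fraction_nonempty[OF assms(2,4)]])
    apply (rule *)
    apply assumption+
    done
qed

lemma fraction_add:
  assumes "a \<in> carrier R" "b \<in> carrier R" "s \<in> nonzerodivisors R" "t \<in> nonzerodivisors R"
  shows "fraction R a s \<oplus>\<^bsub>Frac\<^esub> fraction R b t
    = fraction R (a \<otimes> t \<oplus> b \<otimes> s) (s \<otimes> t)"
proof -
  have *: "fraction R (c \<otimes> w \<oplus> d \<otimes> u) (u \<otimes> w) = fraction R (a \<otimes> t \<oplus> b \<otimes> s) (s \<otimes> t)"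
    if "(c, u) \<in> fraction R a s" "(d, w) \<in> fraction R b t" for c u d w
  proof -
    note cu = fraction_memD[OF that(1)] and dw = fraction_memD[OF that(2)]
    note [simp] = assms(1,2) assms(3,4)[THEN nonzerodivisors_closed] cu(1) dw(1)
      cu(2)[THEN nonzerodivisors_closed] dw(2)[THEN nonzerodivisors_closed]
    have "(c \<otimes> w \<oplus> d \<otimes> u) \<otimes> (s \<otimes> t) = (c \<otimes> s) \<otimes> (w \<otimes> t) \<oplus> (d \<otimes> t) \<otimes> (u \<otimes> s)"
      by (simp add: l_distr r_distr m_ac)
    also have "\<dots> = (a \<otimes> u) \<otimes> (w \<otimes> t) \<oplus> (b \<otimes> w) \<otimes> (u \<otimes> s)" using cu(3) dw(3) by simp
    also have "\<dots> = (a \<otimes> t \<oplus> b \<otimes> s) \<otimes> (u \<otimes> w)" by (simp add: l_distr r_distr m_ac)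
    finally show ?thesis
      by (subst fraction_eq_iff) (auto intro: mult_nonzerodivisor assms cu dw)
  qed
  show ?thesis
    unfolding fraction_ring_def ring.simps
    apply (rule UN_pair_eq_constant[OF fraction_nonempty[OF assms(1,3)]])
    apply (rule UN_pair_eq_constant[OF fraction_nonempty[OF assms(2,4)]])
    apply (rule *)
    apply assumption+
    done
qed

lemma fraction_one: "\<one>\<^bsub>Frac\<^esub> = fraction R \<one> \<one>"
  unfolding fraction_ring_def by (rule monoid.simps)

lemma fraction_zero: "\<zero>\<^bsub>Frac\<^esub> = fraction R \<zero> \<one>"
  unfolding fraction_ring_def by (rule ring.simps)

text \<open>
  All ring axioms are identities between at most three fractions. With representatives they turn
  into polynomial identities in the given ring.
\<close>

theorem cring_fraction_ring: "cring Frac"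
proof -
  note frac = fraction_add fraction_mult fraction_one fraction_zero
  note [simp] = mult_nonzerodivisor one_nonzerodivisor
  have two: "x \<oplus>\<^bsub>Frac\<^esub> y \<in> carrier Frac"
    "x \<oplus>\<^bsub>Frac\<^esub> y = y \<oplus>\<^bsub>Frac\<^esub> x"
    "x \<otimes>\<^bsub>Frac\<^esub> y \<in> carrier Frac"
    "x \<otimes>\<^bsub>Frac\<^esub> y = y \<otimes>\<^bsub>Frac\<^esub> x"
    if xy: "x \<in> carrier Frac" "y \<in> carrier Frac" for x y
  proof -
    obtain a s where a: "a \<in> carrier R" "s \<in> nonzerodivisors R" and x: "x = fraction R a s"
      using xy(1) by (rule fraction_ringE)
    obtain b t where b: "b \<in> carrier R" "t \<in> nonzerodivisors R" and y: "y = fraction R b t"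
      using xy(2) by (rule fraction_ringE)
    note [simp] = a b a(2)[THEN nonzerodivisors_closed] b(2)[THEN nonzerodivisors_closed]
    show "x \<oplus>\<^bsub>Frac\<^esub> y \<in> carrier Frac"
      "x \<otimes>\<^bsub>Frac\<^esub> y \<in> carrier Frac"
      unfolding x y by (simp_all add: frac fraction_closed)
    show "x \<oplus>\<^bsub>Frac\<^esub> y = y \<oplus>\<^bsub>Frac\<^esub> x"
      "x \<otimes>\<^bsub>Frac\<^esub> y = y \<otimes>\<^bsub>Frac\<^esub> x"
      unfolding x y by (simp_all add: frac m_comm a_comm)
  qed
  have three: "x \<oplus>\<^bsub>Frac\<^esub> y \<oplus>\<^bsub>Frac\<^esub> z
      = x \<oplus>\<^bsub>Frac\<^esub> (y \<oplus>\<^bsub>Frac\<^esub> z)"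
    "x \<otimes>\<^bsub>Frac\<^esub> y \<otimes>\<^bsub>Frac\<^esub> z
      = x \<otimes>\<^bsub>Frac\<^esub> (y \<otimes>\<^bsub>Frac\<^esub> z)"
    "(x \<oplus>\<^bsub>Frac\<^esub> y) \<otimes>\<^bsub>Frac\<^esub> z
      = x \<otimes>\<^bsub>Frac\<^esub> z \<oplus>\<^bsub>Frac\<^esub> y \<otimes>\<^bsub>Frac\<^esub> z"
    if xyz: "x \<in> carrier Frac" "y \<in> carrier Frac"
      "z \<in> carrier Frac" for x y z
  proof -
    obtain a s where a: "a \<in> carrier R" "s \<in> nonzerodivisors R" and x: "x = fraction R a s"
      using xyz(1) by (rule fraction_ringE)
    obtain b t where b: "b \<in> carrier R" "t \<in> nonzerodivisors R" and y: "y = fraction R b t"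
      using xyz(2) by (rule fraction_ringE)
    obtain c u where c: "c \<in> carrier R" "u \<in> nonzerodivisors R" and z: "z = fraction R c u"
      using xyz(3) by (rule fraction_ringE)
    note [simp] = a b c a(2)[THEN nonzerodivisors_closed] b(2)[THEN nonzerodivisors_closed]
      c(2)[THEN nonzerodivisors_closed]
    show "x \<oplus>\<^bsub>Frac\<^esub> y \<oplus>\<^bsub>Frac\<^esub> z
        = x \<oplus>\<^bsub>Frac\<^esub> (y \<oplus>\<^bsub>Frac\<^esub> z)"
      unfolding x y z by (simp add: frac) (simp add: l_distr r_distr a_ac m_ac)
    show "x \<otimes>\<^bsub>Frac\<^esub> y \<otimes>\<^bsub>Frac\<^esub> z
        = x \<otimes>\<^bsub>Frac\<^esub> (y \<otimes>\<^bsub>Frac\<^esub> z)"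
      unfolding x y z by (simp add: frac) (simp add: m_ac)
    show "(x \<oplus>\<^bsub>Frac\<^esub> y) \<otimes>\<^bsub>Frac\<^esub> z
        = x \<otimes>\<^bsub>Frac\<^esub> z \<oplus>\<^bsub>Frac\<^esub> y \<otimes>\<^bsub>Frac\<^esub> z"
      unfolding x y z by (simp add: frac fraction_eq_iff) (simp add: l_distr r_distr m_ac)
  qed
  have unit: "\<zero>\<^bsub>Frac\<^esub> \<in> carrier Frac"
    "\<one>\<^bsub>Frac\<^esub> \<in> carrier Frac"
    by (simp_all add: frac fraction_closed)
  have one: "\<zero>\<^bsub>Frac\<^esub> \<oplus>\<^bsub>Frac\<^esub> x = x"
    "\<one>\<^bsub>Frac\<^esub> \<otimes>\<^bsub>Frac\<^esub> x = x"
    "\<exists>y\<in>carrier Frac. y \<oplus>\<^bsub>Frac\<^esub> x = \<zero>\<^bsub>Frac\<^esub>"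
    if x_in: "x \<in> carrier Frac" for x
  proof -
    obtain a s where a: "a \<in> carrier R" "s \<in> nonzerodivisors R" and x: "x = fraction R a s"
      using x_in by (rule fraction_ringE)
    note [simp] = a a(2)[THEN nonzerodivisors_closed]
    show "\<zero>\<^bsub>Frac\<^esub> \<oplus>\<^bsub>Frac\<^esub> x = x"
      "\<one>\<^bsub>Frac\<^esub> \<otimes>\<^bsub>Frac\<^esub> x = x"
      unfolding x by (simp_all add: frac)
    have "fraction R (\<ominus> a) s \<oplus>\<^bsub>Frac\<^esub> x = \<zero>\<^bsub>Frac\<^esub>"
      unfolding x by (simp add: frac fraction_eq_iff) (simp add: l_minus l_neg)
    then show "\<exists>y\<in>carrier Frac. y \<oplus>\<^bsub>Frac\<^esub> x = \<zero>\<^bsub>Frac\<^esub>"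
      by (rule bexI) (simp add: fraction_closed)
  qed
  show ?thesis
  proof (rule cringI)
    show "abelian_group Frac"
      by (rule abelian_groupI) (fact two three unit one)+
    show "comm_monoid Frac"
      by (rule comm_monoidI) (fact two three unit one)+
  qed (fact three)
qed

lemma fraction_over_one_hom: "(\<lambda>a. fraction R a \<one>) \<in> Ring.ring_hom R Frac"
  by (rule Ring.ring_hom_memI)
    (simp_all add: fraction_closed one_nonzerodivisor fraction_mult fraction_add fraction_one)

end

text \<open>
  The map of total rings of fractions induced by \<open>h\<close>. It is meaningful when \<open>h\<close> is an isomorphism
  from a ring \<open>R\<close> onto \<open>S\<close>: an arbitrary homomorphism need not preserve nonzerodivisors. The source
  ring does not occur because the elements of its ring of fractions are themselves sets of pairs.
\<close>

definition fraction_map ::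
  "('s, 'n) ring_scheme \<Rightarrow> ('r \<Rightarrow> 's) \<Rightarrow> ('r \<times> 'r) set \<Rightarrow> ('s \<times> 's) set" where
  "fraction_map S h m = (\<Union>(a, b)\<in>m. fraction S (h a) (h b))"

lemma fraction_map_fraction:
  assumes R: "cring R" and S: "cring S"
    and h: "h \<in> Ring.ring_hom R S" "bij_betw h (carrier R) (carrier S)"
  shows "\<And>s. s \<in> nonzerodivisors R \<Longrightarrow> h s \<in> nonzerodivisors S"
    and "\<And>a s. a \<in> carrier R \<Longrightarrow> s \<in> nonzerodivisors R \<Longrightarrow>
      fraction_map S h (fraction R a s) = fraction S (h a) (h s)"
proof -
  interpret R: cring R by (rule R)
  interpret S: cring S by (rule S)
  have h0: "h \<zero>\<^bsub>R\<^esub> = \<zero>\<^bsub>S\<^esub>"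
    using h(1) R.ring_axioms S.ring_axioms by (rule Ring.ring_hom_zero)
  have img: "h ` carrier R = carrier S" and inj: "inj_on h (carrier R)"
    using h(2) by (auto simp: bij_betw_def)
  show nz: "h s \<in> nonzerodivisors S" if s: "s \<in> nonzerodivisors R" for s
  proof -
    have sc: "s \<in> carrier R" using s by (rule R.nonzerodivisors_closed)
    have "b = \<zero>\<^bsub>S\<^esub>" if b: "b \<in> carrier S" "b \<otimes>\<^bsub>S\<^esub> h s = \<zero>\<^bsub>S\<^esub>" for b
    proof -
      obtain a where a: "a \<in> carrier R" "b = h a" using b(1) img by blast
      have "h (a \<otimes>\<^bsub>R\<^esub> s) = h \<zero>\<^bsub>R\<^esub>"
        using b(2) a sc h0 Ring.ring_hom_mult[OF h(1)] by simp
      then have "a \<otimes>\<^bsub>R\<^esub> s = \<zero>\<^bsub>R\<^esub>"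
        by (rule inj_onD[OF inj]) (simp_all add: a sc)
      then have "a = \<zero>\<^bsub>R\<^esub>"
        using s a(1) by (simp add: nonzerodivisors_def)
      then show ?thesis using a(2) h0 by simp
    qed
    then show ?thesis
      using Ring.ring_hom_closed[OF h(1) sc] by (simp add: nonzerodivisors_def)
  qed
  show "fraction_map S h (fraction R a s) = fraction S (h a) (h s)"
    if a: "a \<in> carrier R" and s: "s \<in> nonzerodivisors R" for a s
  proof -
    have "fraction S (h b) (h t) = fraction S (h a) (h s)" if bt: "(b, t) \<in> fraction R a s" for b t
    proof -
      note b = R.fraction_memD[OF bt]
      note c = R.nonzerodivisors_closed[OF s] R.nonzerodivisors_closed[OF b(2)]
      have "h b \<otimes>\<^bsub>S\<^esub> h s = h a \<otimes>\<^bsub>S\<^esub> h t"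
        using b(3) Ring.ring_hom_mult[OF h(1)] a b(1) c by metis
      then show ?thesis
        by (subst S.fraction_eq_iff) (auto intro: nz s b Ring.ring_hom_closed[OF h(1)] a)
    qed
    then show ?thesis
      unfolding fraction_map_def by (rule UN_pair_eq_constant[OF R.fraction_nonempty[OF a s]])
  qed
qed

lemma fraction_map_hom:
  assumes R: "cring R" and S: "cring S"
    and h: "h \<in> Ring.ring_hom R S" "bij_betw h (carrier R) (carrier S)"
  shows "fraction_map S h \<in> Ring.ring_hom (fraction_ring R) (fraction_ring S)"
proof -
  interpret R: cring R by (rule R)
  interpret S: cring S by (rule S)
  note F = fraction_map_fraction[OF assms]
  note nz = R.mult_nonzerodivisor R.one_nonzerodivisor R.nonzerodivisors_closed
  note hh = Ring.ring_hom_closed[OF h(1)] Ring.ring_hom_mult[OF h(1)] Ring.ring_hom_add[OF h(1)] Ring.ring_hom_one[OF h(1)]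
  show ?thesis
  proof (rule Ring.ring_hom_memI)
    fix x y assume "x \<in> carrier (fraction_ring R)" "y \<in> carrier (fraction_ring R)"
    then obtain a s b t where x: "a \<in> carrier R" "s \<in> nonzerodivisors R" "x = fraction R a s"
      and y: "b \<in> carrier R" "t \<in> nonzerodivisors R" "y = fraction R b t"
      by (metis R.fraction_ringE)
    show "fraction_map S h x \<in> carrier (fraction_ring S)"
      using x by (simp add: F S.fraction_closed hh)
    show "fraction_map S h (x \<otimes>\<^bsub>fraction_ring R\<^esub> y)
        = fraction_map S h x \<otimes>\<^bsub>fraction_ring S\<^esub> fraction_map S h y"
      using x y by (simp add: F R.fraction_mult S.fraction_mult hh nz)
    show "fraction_map S h (x \<oplus>\<^bsub>fraction_ring R\<^esub> y)
        = fraction_map S h x \<oplus>\<^bsub>fraction_ring S\<^esub> fraction_map S h y"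
      using x y by (simp add: F R.fraction_add S.fraction_add hh nz)
  next
    show "fraction_map S h \<one>\<^bsub>fraction_ring R\<^esub> = \<one>\<^bsub>fraction_ring S\<^esub>"
      by (simp add: F R.fraction_one S.fraction_one hh nz)
  qed
qed

section \<open>Germs on a space with functions\<close>

text \<open>
  Holomorphic functions on a Lie group and regular functions on an algebraic group are treated
  together: the algebra of germs rests on these closure properties.
\<close>

locale space_with_functions =
  fixes V :: "'a space_group"
  assumes topspace_eq: "topspace (topo V) = carrier V"
    and reg_restrict: "\<And>U W f. openin (topo V) U \<Longrightarrow> openin (topo V) W \<Longrightarrow> W \<subseteq> U \<Longrightarrow>
      f \<in> reg V U \<Longrightarrow> f \<in> reg V W"
    and reg_const: "\<And>U c. openin (topo V) U \<Longrightarrow> (\<lambda>_. c) \<in> reg V U"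
    and reg_add: "\<And>U f h. openin (topo V) U \<Longrightarrow> f \<in> reg V U \<Longrightarrow> h \<in> reg V U \<Longrightarrow>
      (\<lambda>x. f x + h x) \<in> reg V U"
    and reg_mult: "\<And>U f h. openin (topo V) U \<Longrightarrow> f \<in> reg V U \<Longrightarrow> h \<in> reg V U \<Longrightarrow>
      (\<lambda>x. f x * h x) \<in> reg V U"
begin

lemma openin_carrier: "openin (topo V) (carrier V)"
  using openin_topspace[of "topo V"] by (simp add: topspace_eq)

lemma openin_subset_carrier: "openin (topo V) U \<Longrightarrow> U \<subseteq> carrier V"
  using openin_subset[of "topo V" U] by (simp add: topspace_eq)

lemma germ_self: "x \<in> carrier V \<Longrightarrow> f \<in> germ V x f"
  unfolding germ_def using openin_carrier by blast

lemma germ_eqI: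
  assumes "openin (topo V) U" "x \<in> U" "\<And>y. y \<in> U \<Longrightarrow> f y = h y"
  shows "germ V x f = germ V x h"
proof -
  have "germ V x f' \<subseteq> germ V x h'" if eq: "\<And>y. y \<in> U \<Longrightarrow> f' y = h' y" for f' h'
  proof
    fix k assume "k \<in> germ V x f'"
    then obtain W where W: "openin (topo V) W" "x \<in> W" "\<forall>y\<in>W. k y = f' y"
      by (auto simp: germ_def)
    have "openin (topo V) (U \<inter> W)" "x \<in> U \<inter> W" "\<forall>y\<in>U \<inter> W. k y = h' y"
      using assms W eq by (auto intro: openin_Int)
    then show "k \<in> germ V x h'" unfolding germ_def by blast
  qed
  from this[of f h] this[of h f] show ?thesis using assms(3) by (metis subset_antisym)
qed

lemma germ_memD:
  assumes "h \<in> germ V x f"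
  obtains U where "openin (topo V) U" "x \<in> U" "\<forall>y\<in>U. h y = f y"
  using assms by (auto simp: germ_def)

lemma stalkI: "openin (topo V) U \<Longrightarrow> x \<in> U \<Longrightarrow> f \<in> reg V U \<Longrightarrow> germ V x f \<in> carrier (stalk V x)"
  by (auto simp: stalk_def)

lemma stalkE:
  assumes "a \<in> carrier (stalk V x)"
  obtains f U where "openin (topo V) U" "x \<in> U" "f \<in> reg V U" "a = germ V x f"
  using assms by (auto simp: stalk_def)

text \<open>
  Two germs have representatives over a common neighbourhood; this is what makes sums and products
  of germs well-defined sections.
\<close>

lemma stalk_pairE:
  assumes a: "a \<in> carrier (stalk V x)" and b: "b \<in> carrier (stalk V x)"
  obtains f h U where "openin (topo V) U" "x \<in> U" "f \<in> reg V U" "h \<in> reg V U"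
    "a = germ V x f" "b = germ V x h"
proof -
  obtain f U where f: "openin (topo V) U" "x \<in> U" "f \<in> reg V U" "a = germ V x f"
    using a by (rule stalkE)
  obtain h W where h: "openin (topo V) W" "x \<in> W" "h \<in> reg V W" "b = germ V x h"
    using b by (rule stalkE)
  have "openin (topo V) (U \<inter> W)" using f h by (simp add: openin_Int)
  moreover have "f \<in> reg V (U \<inter> W)" "h \<in> reg V (U \<inter> W)"
    using reg_restrict[OF f(1) calculation] reg_restrict[OF h(1) calculation] f h by auto
  ultimately show thesis using that[of "U \<inter> W" f h] f h by simp
qed

lemma UN_germ_eq_constant:
  assumes x: "x \<in> carrier V"
    and F: "\<And>U f' h'. openin (topo V) U \<Longrightarrow> x \<in> U \<Longrightarrow> (\<And>y. y \<in> U \<Longrightarrow> f' y = f y \<and> h' y = h y) \<Longrightarrow>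
      F f' h' = K"
  shows "(\<Union>f'\<in>germ V x f. \<Union>h'\<in>germ V x h. F f' h') = K"
proof -
  have "F f' h' = K" if f': "f' \<in> germ V x f" and h': "h' \<in> germ V x h" for f' h'
  proof -
    obtain U where U: "openin (topo V) U" "x \<in> U" "\<forall>y\<in>U. f' y = f y"
      using f' by (rule germ_memD)
    obtain W where W: "openin (topo V) W" "x \<in> W" "\<forall>y\<in>W. h' y = h y"
      using h' by (rule germ_memD)
    show ?thesis by (rule F[of "U \<inter> W"]) (use U W in \<open>auto intro: openin_Int\<close>)
  qed
  then show ?thesis using germ_self[OF x, of f] germ_self[OF x, of h] by blast
qed

lemma stalk_mult:
  assumes "x \<in> carrier V"
  shows "germ V x f \<otimes>\<^bsub>stalk V x\<^esub> germ V x h = germ V x (\<lambda>y. f y * h y)"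
  unfolding stalk_def monoid.simps
  by (rule UN_germ_eq_constant[OF assms]) (rule germ_eqI, auto)

lemma stalk_add:
  assumes "x \<in> carrier V"
  shows "germ V x f \<oplus>\<^bsub>stalk V x\<^esub> germ V x h = germ V x (\<lambda>y. f y + h y)"
  unfolding stalk_def ring.simps
  by (rule UN_germ_eq_constant[OF assms]) (rule germ_eqI, auto)

lemma stalk_one: "\<one>\<^bsub>stalk V x\<^esub> = germ V x (\<lambda>_. 1)"
  unfolding stalk_def by (rule monoid.simps)

lemma stalk_zero: "\<zero>\<^bsub>stalk V x\<^esub> = germ V x (\<lambda>_. 0)"
  unfolding stalk_def by (rule ring.simps)

lemma const_in_stalk: "x \<in> carrier V \<Longrightarrow> germ V x (\<lambda>_. c) \<in> carrier (stalk V x)"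
  using stalkI[OF openin_carrier _ reg_const[OF openin_carrier]] .

lemma cring_stalk:
  assumes x: "x \<in> carrier V"
  shows "cring (stalk V x)"
proof -
  note ops = stalk_add[OF x] stalk_mult[OF x] stalk_one stalk_zero
  have two: "a \<oplus>\<^bsub>stalk V x\<^esub> b \<in> carrier (stalk V x)"
    "a \<otimes>\<^bsub>stalk V x\<^esub> b \<in> carrier (stalk V x)"
    "a \<oplus>\<^bsub>stalk V x\<^esub> b = b \<oplus>\<^bsub>stalk V x\<^esub> a"
    "a \<otimes>\<^bsub>stalk V x\<^esub> b = b \<otimes>\<^bsub>stalk V x\<^esub> a"
    if ab: "a \<in> carrier (stalk V x)" "b \<in> carrier (stalk V x)" for a b
  proof -
    obtain f h U where U: "openin (topo V) U" "x \<in> U" "f \<in> reg V U" "h \<in> reg V U"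
      and a: "a = germ V x f" and b: "b = germ V x h"
      using ab by (rule stalk_pairE)
    show "a \<oplus>\<^bsub>stalk V x\<^esub> b \<in> carrier (stalk V x)" "a \<otimes>\<^bsub>stalk V x\<^esub> b \<in> carrier (stalk V x)"
      unfolding a b ops
      using stalkI[OF U(1,2) reg_add[OF U(1,3,4)]] stalkI[OF U(1,2) reg_mult[OF U(1,3,4)]] by auto
    show "a \<oplus>\<^bsub>stalk V x\<^esub> b = b \<oplus>\<^bsub>stalk V x\<^esub> a"
      "a \<otimes>\<^bsub>stalk V x\<^esub> b = b \<otimes>\<^bsub>stalk V x\<^esub> a"
      unfolding a b ops by (simp_all add: add.commute mult.commute)
  qed
  have three: "a \<oplus>\<^bsub>stalk V x\<^esub> b \<oplus>\<^bsub>stalk V x\<^esub> c = a \<oplus>\<^bsub>stalk V x\<^esub> (b \<oplus>\<^bsub>stalk V x\<^esub> c)"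
    "a \<otimes>\<^bsub>stalk V x\<^esub> b \<otimes>\<^bsub>stalk V x\<^esub> c = a \<otimes>\<^bsub>stalk V x\<^esub> (b \<otimes>\<^bsub>stalk V x\<^esub> c)"
    "(a \<oplus>\<^bsub>stalk V x\<^esub> b) \<otimes>\<^bsub>stalk V x\<^esub> c
      = a \<otimes>\<^bsub>stalk V x\<^esub> c \<oplus>\<^bsub>stalk V x\<^esub> b \<otimes>\<^bsub>stalk V x\<^esub> c"
    if abc: "a \<in> carrier (stalk V x)" "b \<in> carrier (stalk V x)" "c \<in> carrier (stalk V x)" for a b c
  proof -
    obtain f where a: "a = germ V x f" using abc(1) by (rule stalkE)
    obtain h where b: "b = germ V x h" using abc(2) by (rule stalkE)
    obtain k where c: "c = germ V x k" using abc(3) by (rule stalkE)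
    show "a \<oplus>\<^bsub>stalk V x\<^esub> b \<oplus>\<^bsub>stalk V x\<^esub> c = a \<oplus>\<^bsub>stalk V x\<^esub> (b \<oplus>\<^bsub>stalk V x\<^esub> c)"
      "a \<otimes>\<^bsub>stalk V x\<^esub> b \<otimes>\<^bsub>stalk V x\<^esub> c = a \<otimes>\<^bsub>stalk V x\<^esub> (b \<otimes>\<^bsub>stalk V x\<^esub> c)"
      "(a \<oplus>\<^bsub>stalk V x\<^esub> b) \<otimes>\<^bsub>stalk V x\<^esub> c
        = a \<otimes>\<^bsub>stalk V x\<^esub> c \<oplus>\<^bsub>stalk V x\<^esub> b \<otimes>\<^bsub>stalk V x\<^esub> c"
      unfolding a b c ops by (simp_all add: algebra_simps)
  qed
  have unit: "\<zero>\<^bsub>stalk V x\<^esub> \<in> carrier (stalk V x)" "\<one>\<^bsub>stalk V x\<^esub> \<in> carrier (stalk V x)"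
    unfolding ops by (rule const_in_stalk[OF x])+
  have one: "\<zero>\<^bsub>stalk V x\<^esub> \<oplus>\<^bsub>stalk V x\<^esub> a = a" "\<one>\<^bsub>stalk V x\<^esub> \<otimes>\<^bsub>stalk V x\<^esub> a = a"
    "\<exists>b\<in>carrier (stalk V x). b \<oplus>\<^bsub>stalk V x\<^esub> a = \<zero>\<^bsub>stalk V x\<^esub>"
    if a_in: "a \<in> carrier (stalk V x)" for a
  proof -
    obtain f U where U: "openin (topo V) U" "x \<in> U" "f \<in> reg V U" and a: "a = germ V x f"
      using a_in by (rule stalkE)
    show "\<zero>\<^bsub>stalk V x\<^esub> \<oplus>\<^bsub>stalk V x\<^esub> a = a" "\<one>\<^bsub>stalk V x\<^esub> \<otimes>\<^bsub>stalk V x\<^esub> a = a"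
      unfolding a ops by simp_all
    have "(\<lambda>y. (-1) * f y) \<in> reg V U"
      by (rule reg_mult[OF U(1) reg_const[OF U(1)] U(3)])
    then have "germ V x (\<lambda>y. (-1) * f y) \<in> carrier (stalk V x)"
      by (rule stalkI[OF U(1,2)])
    moreover have "germ V x (\<lambda>y. (-1) * f y) \<oplus>\<^bsub>stalk V x\<^esub> a = \<zero>\<^bsub>stalk V x\<^esub>"
      unfolding a ops by simp
    ultimately show "\<exists>b\<in>carrier (stalk V x). b \<oplus>\<^bsub>stalk V x\<^esub> a = \<zero>\<^bsub>stalk V x\<^esub>"
      by blast
  qed
  show ?thesis
  proof (rule cringI)
    show "abelian_group (stalk V x)"
      by (rule abelian_groupI) (fact two three unit one)+
    show "comm_monoid (stalk V x)"
      by (rule comm_monoidI) (fact two three unit one)+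
  qed (fact three)
qed

lemma cring_mero: "x \<in> carrier V \<Longrightarrow> cring (mero V x)"
  unfolding mero_def by (rule cring.cring_fraction_ring[OF cring_stalk])

text \<open>
  The germs of sections of the structure sheaf are the image of the stalk in its total ring of
  fractions, so that they form a subring.
\<close>

lemma carrier_hol:
  "carrier (hol V x) = (\<lambda>a. fraction (stalk V x) a \<one>\<^bsub>stalk V x\<^esub>) ` carrier (stalk V x)"
  by (auto simp: hol_def hol_germ_def stalk_def)

lemma hol_eq_mero: "hol V x = (mero V x)\<lparr>carrier := carrier (hol V x)\<rparr>"
  by (simp add: hol_def)

lemma subring_hol:
  assumes "x \<in> carrier V"
  shows "subring (carrier (hol V x)) (mero V x)"
proof -
  interpret R: cring "stalk V x" using assms by (rule cring_stalk)
  interpret M: cring "mero V x" using assms by (rule cring_mero)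
  interpret h: ring_hom_ring "stalk V x" "mero V x" "\<lambda>a. fraction (stalk V x) a \<one>\<^bsub>stalk V x\<^esub>"
    unfolding mero_def
    by (rule ring_hom_ringI2[OF R.ring_axioms M.ring_axioms[unfolded mero_def] R.fraction_over_one_hom])
  show ?thesis
    unfolding carrier_hol by (rule h.img_is_subring[OF R.carrier_is_subring])
qed

definition const_germ :: "'a \<Rightarrow> complex \<Rightarrow> 'a mgerm" where
  "const_germ x c = hol_germ V x (\<lambda>_. c)"

lemma const_germ_hol: "x \<in> carrier V \<Longrightarrow> const_germ x c \<in> carrier (hol V x)"
  by (auto simp: carrier_hol const_germ_def hol_germ_def const_in_stalk)

lemma const_germ_ops:
  assumes "x \<in> carrier V"
  shows "const_germ x 0 = \<zero>\<^bsub>mero V x\<^esub>" "const_germ x 1 = \<one>\<^bsub>mero V x\<^esub>"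
    "const_germ x c \<oplus>\<^bsub>mero V x\<^esub> const_germ x d = const_germ x (c + d)"
    "const_germ x c \<otimes>\<^bsub>mero V x\<^esub> const_germ x d = const_germ x (c * d)"
proof -
  interpret R: cring "stalk V x" using assms by (rule cring_stalk)
  note h = R.fraction_over_one_hom
  note c = const_in_stalk[OF assms]
  show "const_germ x 0 = \<zero>\<^bsub>mero V x\<^esub>" "const_germ x 1 = \<one>\<^bsub>mero V x\<^esub>"
    unfolding const_germ_def hol_germ_def mero_def R.fraction_zero R.fraction_one stalk_zero stalk_one
    by (rule refl)+
  show "const_germ x c \<oplus>\<^bsub>mero V x\<^esub> const_germ x d = const_germ x (c + d)"
    unfolding const_germ_def hol_germ_def mero_def
    using Ring.ring_hom_add[OF h c c, of c d] by (simp add: stalk_add[OF assms])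
  show "const_germ x c \<otimes>\<^bsub>mero V x\<^esub> const_germ x d = const_germ x (c * d)"
    unfolding const_germ_def hol_germ_def mero_def
    using Ring.ring_hom_mult[OF h c c, of c d] by (simp add: stalk_mult[OF assms])
qed

text \<open>
  Division by the number of summands is possible because nonzero constants are invertible germs; this
  makes averaging over a finite group available.
\<close>

lemma const_germ_average:
  assumes x: "x \<in> carrier V" and S: "finite S" "S \<noteq> {}" and a: "a \<in> carrier (mero V x)"
  shows "const_germ x (1 / of_nat (card S)) \<otimes>\<^bsub>mero V x\<^esub> (\<Oplus>\<^bsub>mero V x\<^esub>i\<in>S. a) = a"
proof -
  interpret M: cring "mero V x" using x by (rule cring_mero)
  have cM: "const_germ x c \<in> carrier (mero V x)" for c
    using const_germ_hol[OF x] subringE(1)[OF subring_hol[OF x]] by blast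
  have "(\<Oplus>\<^bsub>mero V x\<^esub>i\<in>S. a) = const_germ x (of_nat (card S)) \<otimes>\<^bsub>mero V x\<^esub> a"
    using S(1)
  proof (induction S rule: finite_induct)
    case empty
    then show ?case using a by (simp add: const_germ_ops[OF x])
  next
    case (insert i S)
    have "const_germ x (of_nat (card (insert i S)))
        = \<one>\<^bsub>mero V x\<^esub> \<oplus>\<^bsub>mero V x\<^esub> const_germ x (of_nat (card S))"
      using insert.hyps by (simp add: const_germ_ops(3)[OF x] flip: const_germ_ops(2)[OF x])
    then show ?case using insert a cM by (simp add: M.l_distr)
  qed
  then have "const_germ x (1 / of_nat (card S)) \<otimes>\<^bsub>mero V x\<^esub> (\<Oplus>\<^bsub>mero V x\<^esub>i\<in>S. a)
    = const_germ x (1 / of_nat (card S) * of_nat (card S)) \<otimes>\<^bsub>mero V x\<^esub> a"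
    using a cM by (simp add: const_germ_ops(4)[OF x] flip: M.m_assoc)
  also have "1 / of_nat (card S) * of_nat (card S) = (1 :: complex)"
    using S by simp
  finally show ?thesis using a by (simp add: const_germ_ops[OF x])
qed

subsection \<open>Transport of germs along automorphisms\<close>

definition morphism :: "('a \<Rightarrow> 'a) \<Rightarrow> bool" where
  "morphism s \<longleftrightarrow> space_morphism (topo V) (reg V) (topo V) (reg V) s"

definition automorphism :: "('a \<Rightarrow> 'a) \<Rightarrow> bool" where
  "automorphism s \<longleftrightarrow>
     morphism s \<and> (\<exists>t. morphism t \<and> (\<forall>z\<in>carrier V. t (s z) = z \<and> s (t z) = z))"

lemma automorphismI:
  assumes "morphism s" "morphism t" "\<And>z. z \<in> carrier V \<Longrightarrow> t (s z) = z"
    "\<And>z. z \<in> carrier V \<Longrightarrow> s (t z) = z"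
  shows "automorphism s"
  using assms by (auto simp: automorphism_def)

lemma morphism_closed: "morphism s \<Longrightarrow> z \<in> carrier V \<Longrightarrow> s z \<in> carrier V"
  using continuous_map_image_subset_topspace[of "topo V" "topo V" s]
  by (auto simp: morphism_def space_morphism_def topspace_eq)

lemma morphism_open:
  "morphism s \<Longrightarrow> openin (topo V) U \<Longrightarrow> openin (topo V) {z \<in> carrier V. s z \<in> U}"
  using openin_continuous_map_preimage[of "topo V" "topo V" s U]
  by (simp add: morphism_def space_morphism_def topspace_eq)

lemma morphism_reg:
  "morphism s \<Longrightarrow> openin (topo V) U \<Longrightarrow> f \<in> reg V U \<Longrightarrow> f \<circ> s \<in> reg V {z \<in> carrier V. s z \<in> U}"
  unfolding morphism_def space_morphism_def by (simp add: topspace_eq)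

lemma morphism_comp:
  assumes "morphism s" "morphism t"
  shows "morphism (\<lambda>z. t (s z))"
  unfolding morphism_def space_morphism_def
proof (intro conjI allI impI)
  show "continuous_map (topo V) (topo V) (\<lambda>z. t (s z))"
    using continuous_map_compose[of "topo V" "topo V" s "topo V" t] assms
    by (simp add: morphism_def space_morphism_def comp_def)
  fix U f assume U: "openin (topo V) U \<and> f \<in> reg V U"
  have "(f \<circ> t) \<circ> s \<in> reg V {z \<in> carrier V. s z \<in> {z \<in> carrier V. t z \<in> U}}"
    using morphism_reg[OF assms(1) morphism_open[OF assms(2)] morphism_reg[OF assms(2)]] U by blast
  also have "{z \<in> carrier V. s z \<in> {z \<in> carrier V. t z \<in> U}} = {x \<in> topspace (topo V). t (s x) \<in> U}"
    using morphism_closed[OF assms(1)] by (auto simp: topspace_eq)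
  finally show "f \<circ> (\<lambda>z. t (s z)) \<in> reg V {x \<in> topspace (topo V). t (s x) \<in> U}"
    by (simp add: comp_def)
qed

lemma automorphism_comp:
  assumes "automorphism s" "automorphism t"
  shows "automorphism (\<lambda>z. t (s z))"
proof -
  obtain s' where s': "morphism s'" "\<forall>z\<in>carrier V. s' (s z) = z \<and> s (s' z) = z"
    using assms(1) by (auto simp: automorphism_def)
  obtain t' where t': "morphism t'" "\<forall>z\<in>carrier V. t' (t z) = z \<and> t (t' z) = z"
    using assms(2) by (auto simp: automorphism_def)
  have st: "morphism s" "morphism t" using assms by (auto simp: automorphism_def)
  show ?thesis
    by (rule automorphismI[OF morphism_comp[OF st] morphism_comp[OF t'(1) s'(1)]])
      (use s' t' st in \<open>auto simp: morphism_closed\<close>)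
qed

lemma push_germ:
  assumes s: "morphism s" and y: "y \<in> carrier V"
  shows "push V s y (germ V (s y) f) = germ V y (f \<circ> s)"
proof -
  have "germ V y (f' \<circ> s) = germ V y (f \<circ> s)" if f': "f' \<in> germ V (s y) f" for f'
  proof -
    obtain U where U: "openin (topo V) U" "s y \<in> U" "\<forall>z\<in>U. f' z = f z"
      using f' by (rule germ_memD)
    show ?thesis
      by (rule germ_eqI[OF morphism_open[OF s U(1)]]) (use y U in auto)
  qed
  moreover have "f \<in> germ V (s y) f"
    by (rule germ_self[OF morphism_closed[OF s y]])
  ultimately show ?thesis unfolding push_def by blast
qed

text \<open>
  A morphism pulls functions back, so it acts on germs contravariantly: \<open>s\<close> takes germs at \<open>s y\<close> to
  germs at \<open>y\<close>.
\<close>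

lemma push_hom:
  assumes s: "morphism s" and y: "y \<in> carrier V"
  shows "push V s y \<in> Ring.ring_hom (stalk V (s y)) (stalk V y)"
proof (rule Ring.ring_hom_memI)
  note sy = morphism_closed[OF s y]
  show "push V s y \<one>\<^bsub>stalk V (s y)\<^esub> = \<one>\<^bsub>stalk V y\<^esub>"
    by (simp add: stalk_one push_germ[OF assms] comp_def)
  fix a b assume ab: "a \<in> carrier (stalk V (s y))" "b \<in> carrier (stalk V (s y))"
  obtain f h U where U: "openin (topo V) U" "s y \<in> U" "f \<in> reg V U" "h \<in> reg V U"
      and a: "a = germ V (s y) f" and b: "b = germ V (s y) h"
    using ab by (rule stalk_pairE)
  show "push V s y (a \<otimes>\<^bsub>stalk V (s y)\<^esub> b) = push V s y a \<otimes>\<^bsub>stalk V y\<^esub> push V s y b"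
    "push V s y (a \<oplus>\<^bsub>stalk V (s y)\<^esub> b) = push V s y a \<oplus>\<^bsub>stalk V y\<^esub> push V s y b"
    unfolding a b by (simp_all add: stalk_mult stalk_add push_germ[OF assms] sy y comp_def)
next
  fix a assume "a \<in> carrier (stalk V (s y))"
  then obtain f U where U: "openin (topo V) U" "s y \<in> U" "f \<in> reg V U"
    and a: "a = germ V (s y) f" by (rule stalkE)
  show "push V s y a \<in> carrier (stalk V y)"
    unfolding a push_germ[OF assms]
    by (rule stalkI[OF morphism_open[OF s U(1)] _ morphism_reg[OF s U(1,3)]]) (use U y in auto)
qed

lemma push_push:
  assumes s: "morphism s" and t: "morphism t" and y: "y \<in> carrier V"
    and a_in: "a \<in> carrier (stalk V (t (s y)))"
  shows "push V s y (push V t (s y) a) = push V (\<lambda>z. t (s z)) y a"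
proof -
  obtain f where a: "a = germ V (t (s y)) f" using a_in by (rule stalkE)
  have "push V (\<lambda>z. t (s z)) y a = germ V y (f \<circ> (\<lambda>z. t (s z)))"
    unfolding a by (rule push_germ[OF morphism_comp[OF s t] y])
  then show ?thesis
    unfolding a by (simp add: push_germ s t y morphism_closed comp_def)
qed

lemma push_cong:
  assumes "\<And>z. z \<in> carrier V \<Longrightarrow> s z = t z" "y \<in> carrier V"
  shows "push V s y = push V t y"
proof
  fix a
  have "germ V y (f \<circ> s) = germ V y (f \<circ> t)" for f
    by (rule germ_eqI[OF openin_carrier]) (use assms in auto)
  then show "push V s y a = push V t y a" by (simp add: push_def)
qed

lemma push_id:
  assumes y: "y \<in> carrier V" and a_in: "a \<in> carrier (stalk V y)"
  shows "push V (\<lambda>z. z) y a = a"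
proof -
  obtain f where a: "a = germ V y f" using a_in by (rule stalkE)
  have "morphism (\<lambda>z. z)"
    unfolding morphism_def space_morphism_def
  proof (intro conjI allI impI)
    fix U f assume U: "openin (topo V) U \<and> f \<in> reg V U"
    then have "{x \<in> topspace (topo V). x \<in> U} = U"
      using openin_subset_carrier by (auto simp: topspace_eq)
    then show "f \<circ> (\<lambda>z. z) \<in> reg V {x \<in> topspace (topo V). x \<in> U}"
      using U by (simp add: comp_def)
  qed simp
  from push_germ[OF this y, of f] show ?thesis unfolding a by (simp add: comp_def)
qed

lemma push_bij:
  assumes s: "automorphism s" and y: "y \<in> carrier V"
  shows "bij_betw (push V s y) (carrier (stalk V (s y))) (carrier (stalk V y))"
proof -
  obtain t where t: "morphism t" "\<And>z. z \<in> carrier V \<Longrightarrow> t (s z) = z"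
      "\<And>z. z \<in> carrier V \<Longrightarrow> s (t z) = z" and sm: "morphism s"
    using s by (auto simp: automorphism_def)
  note sy = morphism_closed[OF sm y]
  have t_hom: "push V t (s y) \<in> Ring.ring_hom (stalk V y) (stalk V (s y))"
    using push_hom[OF t(1) sy] by (simp add: t y)
  show ?thesis
  proof (rule bij_betw_byWitness[where f' = "push V t (s y)"])
    show "\<forall>a\<in>carrier (stalk V (s y)). push V t (s y) (push V s y a) = a"
    proof
      fix a assume a: "a \<in> carrier (stalk V (s y))"
      have "push V t (s y) (push V s (t (s y)) a) = push V (\<lambda>z. s (t z)) (s y) a"
        by (rule push_push[OF t(1) sm sy]) (simp add: t y a)
      also have "push V (\<lambda>z. s (t z)) (s y) = push V (\<lambda>z. z) (s y)"
        by (rule push_cong[OF _ sy]) (simp add: t)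
      finally show "push V t (s y) (push V s y a) = a"
        using push_id[OF sy a] by (simp add: t y)
    qed
    show "\<forall>a\<in>carrier (stalk V y). push V s y (push V t (s y) a) = a"
    proof
      fix a assume a: "a \<in> carrier (stalk V y)"
      have "push V s y (push V t (s y) a) = push V (\<lambda>z. t (s z)) y a"
        by (rule push_push[OF sm t(1) y]) (simp add: t y a)
      also have "push V (\<lambda>z. t (s z)) y = push V (\<lambda>z. z) y"
        by (rule push_cong[OF _ y]) (simp add: t)
      finally show "push V s y (push V t (s y) a) = a"
        using push_id[OF y a] by simp
    qed
    show "push V s y ` carrier (stalk V (s y)) \<subseteq> carrier (stalk V y)"
      using Ring.ring_hom_closed[OF push_hom[OF sm y]] by blast
    show "push V t (s y) ` carrier (stalk V y) \<subseteq> carrier (stalk V (s y))"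
      using Ring.ring_hom_closed[OF t_hom] by blast
  qed
qed

lemma automorphism_morphism: "automorphism s \<Longrightarrow> morphism s"
  by (simp add: automorphism_def)

lemma automorphism_closed: "automorphism s \<Longrightarrow> z \<in> carrier V \<Longrightarrow> s z \<in> carrier V"
  by (simp add: automorphism_morphism morphism_closed)

lemma mero_push_eq: "mero_push V s y = fraction_map (stalk V y) (push V s y)"
  by (simp add: fun_eq_iff mero_push_def fraction_map_def)

lemma mero_push_fraction:
  assumes "automorphism s" "y \<in> carrier V"
    and "a \<in> carrier (stalk V (s y))" "b \<in> nonzerodivisors (stalk V (s y))"
  shows "mero_push V s y (fraction (stalk V (s y)) a b)
    = fraction (stalk V y) (push V s y a) (push V s y b)"
  unfolding mero_push_eq
  by (rule fraction_map_fraction(2)[OF cring_stalk[OF automorphism_closed] cring_stalk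
        push_hom[OF automorphism_morphism] push_bij]) (fact assms)+

lemma push_nonzerodivisor:
  assumes "automorphism s" "y \<in> carrier V" "b \<in> nonzerodivisors (stalk V (s y))"
  shows "push V s y b \<in> nonzerodivisors (stalk V y)"
  by (rule fraction_map_fraction(1)[OF cring_stalk[OF automorphism_closed] cring_stalk
        push_hom[OF automorphism_morphism] push_bij]) (fact assms)+

lemma mero_push_hom:
  assumes "automorphism s" "y \<in> carrier V"
  shows "mero_push V s y \<in> Ring.ring_hom (mero V (s y)) (mero V y)"
  unfolding mero_push_eq mero_def
  by (rule fraction_map_hom[OF cring_stalk[OF automorphism_closed] cring_stalk
        push_hom[OF automorphism_morphism] push_bij]) (fact assms)+

lemma meroE:
  assumes "x \<in> carrier V" "m \<in> carrier (mero V x)"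
  obtains a b where "a \<in> carrier (stalk V x)" "b \<in> nonzerodivisors (stalk V x)"
    "m = fraction (stalk V x) a b"
  using cring.fraction_ringE[OF cring_stalk[OF assms(1)], of m] assms(2)
  unfolding mero_def by metis

text \<open>
  Transport of germs reverses the order of composition, as \<open>f \<circ> t \<circ> s\<close> is obtained from \<open>f\<close> by first
  composing with \<open>t\<close>.
\<close>

lemma mero_push_mero_push:
  assumes s: "automorphism s" and t: "automorphism t" and y: "y \<in> carrier V"
    and m: "m \<in> carrier (mero V (t (s y)))"
  shows "mero_push V s y (mero_push V t (s y) m) = mero_push V (\<lambda>z. t (s z)) y m"
proof -
  note sy = automorphism_closed[OF s y]
  note tsy = automorphism_closed[OF t sy]
  obtain a b where a: "a \<in> carrier (stalk V (t (s y)))"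
    and b: "b \<in> nonzerodivisors (stalk V (t (s y)))" and m: "m = fraction (stalk V (t (s y))) a b"
    using tsy m by (rule meroE)
  have b': "b \<in> carrier (stalk V (t (s y)))"
    using b by (rule cring.nonzerodivisors_closed[OF cring_stalk[OF tsy]])
  have "mero_push V s y (mero_push V t (s y) m)
      = fraction (stalk V y) (push V s y (push V t (s y) a)) (push V s y (push V t (s y) b))"
    unfolding m mero_push_fraction[OF t sy a b]
    by (rule mero_push_fraction[OF s y
          Ring.ring_hom_closed[OF push_hom[OF automorphism_morphism[OF t] sy] a]
          push_nonzerodivisor[OF t sy b]])
  also have "\<dots> = fraction (stalk V y) (push V (\<lambda>z. t (s z)) y a) (push V (\<lambda>z. t (s z)) y b)"
    using push_push[OF s[THEN automorphism_morphism] t[THEN automorphism_morphism] y] a b' by simp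
  also have "\<dots> = mero_push V (\<lambda>z. t (s z)) y m"
    unfolding m by (rule mero_push_fraction[OF automorphism_comp[OF s t] y a b, symmetric])
  finally show ?thesis .
qed

lemma mero_push_cong:
  assumes "\<And>z. z \<in> carrier V \<Longrightarrow> s z = t z" "y \<in> carrier V"
  shows "mero_push V s y = mero_push V t y"
  unfolding mero_push_eq by (subst push_cong[OF assms]) simp_all

lemma mero_push_id:
  assumes y: "y \<in> carrier V" and m: "m \<in> carrier (mero V y)"
  shows "mero_push V (\<lambda>z. z) y m = m"
proof -
  obtain a b where a: "a \<in> carrier (stalk V y)" and b: "b \<in> nonzerodivisors (stalk V y)"
    and m: "m = fraction (stalk V y) a b" using y m by (rule meroE)
  have *: "push V (\<lambda>z. z) y c = c" if "c \<in> carrier (stalk V y)" for c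
    using y that by (rule push_id)
  \<comment> \<open>every pair in a fraction represents this fraction\<close>
  have **: "(\<Union>(a', b')\<in>m. fraction (stalk V y) a' b') = m"
  proof -
    interpret R: cring "stalk V y" using y by (rule cring_stalk)
    show ?thesis
      unfolding m
    proof (rule UN_pair_eq_constant[OF R.fraction_nonempty[OF a b]])
      fix c u assume cu: "(c, u) \<in> fraction (stalk V y) a b"
      note c = R.fraction_memD[OF cu]
      show "fraction (stalk V y) c u = fraction (stalk V y) a b"
        using c by (subst R.fraction_eq_iff) (auto simp: a b)
    qed
  qed
  have "mero_push V (\<lambda>z. z) y m = (\<Union>(a', b')\<in>m. fraction (stalk V y) a' b')"
    unfolding mero_push_def
  proof (rule SUP_cong[OF refl], clarify)
    fix c u assume "(c, u) \<in> m"
    then have "c \<in> carrier (stalk V y)" "u \<in> carrier (stalk V y)"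
      unfolding m fraction_def nonzerodivisors_def by auto
    then show "fraction (stalk V y) (push V (\<lambda>z. z) y c) (push V (\<lambda>z. z) y u)
        = fraction (stalk V y) c u" by (simp add: *)
  qed
  then show ?thesis by (simp add: **)
qed

lemma mero_push_hol_germ:
  assumes s: "automorphism s" and y: "y \<in> carrier V"
    and f: "openin (topo V) U" "s y \<in> U" "f \<in> reg V U"
  shows "mero_push V s y (hol_germ V (s y) f) = hol_germ V y (f \<circ> s)"
proof -
  note sy = automorphism_closed[OF s y]
  interpret R: cring "stalk V (s y)" using sy by (rule cring_stalk)
  note s' = automorphism_morphism[OF s]
  show ?thesis
    unfolding hol_germ_def
    by (subst mero_push_fraction[OF s y stalkI[OF f] R.one_nonzerodivisor])
      (simp add: push_germ[OF s' y] stalk_one comp_def)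
qed

lemma mero_push_const_germ:
  assumes "automorphism s" "y \<in> carrier V"
  shows "mero_push V s y (const_germ (s y) c) = const_germ y c"
  unfolding const_germ_def
  using mero_push_hol_germ[OF assms openin_carrier _ reg_const[OF openin_carrier], of c]
    automorphism_closed[OF assms]
  by (simp add: comp_def)

lemma mero_push_hol:
  assumes s: "automorphism s" and y: "y \<in> carrier V" and a: "a \<in> carrier (hol V (s y))"
  shows "mero_push V s y a \<in> carrier (hol V y)"
proof -
  obtain f U where f: "openin (topo V) U" "s y \<in> U" "f \<in> reg V U" and a: "a = hol_germ V (s y) f"
    using a by (auto simp: hol_def)
  note s' = automorphism_morphism[OF s]
  have "openin (topo V) {z \<in> carrier V. s z \<in> U}" "y \<in> {z \<in> carrier V. s z \<in> U}"
    "f \<circ> s \<in> reg V {z \<in> carrier V. s z \<in> U}"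
    using morphism_open[OF s' f(1)] morphism_reg[OF s' f(1,3)] y f(2) by auto
  then show ?thesis
    unfolding a mero_push_hol_germ[OF s y f] by (auto simp: hol_def)
qed

end

section \<open>Complex Lie groups\<close>

lemma sum_lessThan_add: "(\<Sum>i<n + m. f i) = (\<Sum>i<n. f i) + (\<Sum>i<m. f (n + i))"
  for f :: "nat \<Rightarrow> 'b::comm_monoid_add"
  by (induction m) (simp_all add: add.assoc)

lemma topspace_Cn: "topspace (Cn n) = extensional {..<n}"
  by (simp add: Cn_def topspace_product_topology PiE_UNIV_domain extensional_def PiE_def)

lemma Cn_coordinate_continuous: "i < n \<Longrightarrow> continuous_map (Cn n) euclidean (\<lambda>w. w i)"
  unfolding Cn_def by (rule continuous_map_product_projection) simp

abbreviation Cn_dist :: "nat \<Rightarrow> (nat \<Rightarrow> complex) \<Rightarrow> (nat \<Rightarrow> complex) \<Rightarrow> real" where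
  "Cn_dist n z w \<equiv> L2_set (\<lambda>i. cmod (w i - z i)) {..<n}"

text \<open>
  The vector \<open>c\<close> is the gradient of \<open>f\<close> at \<open>z\<close>: the condition on \<open>c\<close> in \<open>holomorphic_Cn\<close>.
\<close>

definition Cn_derivative ::
  "nat \<Rightarrow> ((nat \<Rightarrow> complex) \<Rightarrow> complex) \<Rightarrow> (nat \<Rightarrow> complex) \<Rightarrow> (nat \<Rightarrow> complex) \<Rightarrow> bool" where
  "Cn_derivative n f c z \<longleftrightarrow>
     ((\<lambda>w. (f w - f z - (\<Sum>i<n. c i * (w i - z i))) / complex_of_real (Cn_dist n z w)) \<longlongrightarrow> 0)
       (atin (Cn n) z)"

lemma holomorphic_Cn_iff:
  "holomorphic_Cn n D f \<longleftrightarrow> openin (Cn n) D \<and> (\<forall>z\<in>D. \<exists>c. Cn_derivative n f c z)"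
  by (simp add: holomorphic_Cn_def Cn_derivative_def)

lemma tendsto_Cn_coordinate:
  assumes "z \<in> topspace (Cn n)" "i < n"
  shows "((\<lambda>w. w i - z i) \<longlongrightarrow> 0) (atin (Cn n) z)"
proof -
  have "((\<lambda>w. w i) \<longlongrightarrow> z i) (atin (Cn n) z)"
    using Cn_coordinate_continuous[OF assms(2)] assms(1) by (simp add: continuous_map_atin)
  then show ?thesis by (rule LIM_zero)
qed

lemma tendsto_Cn_dist:
  assumes "z \<in> topspace (Cn n)"
  shows "(Cn_dist n z \<longlongrightarrow> 0) (atin (Cn n) z)"
proof -
  have "((\<lambda>w. \<Sum>i<n. (cmod (w i - z i))\<^sup>2) \<longlongrightarrow> (\<Sum>i<n. 0)) (atin (Cn n) z)"
  proof (rule tendsto_sum)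
    fix i assume "i \<in> {..<n}"
    then have "((\<lambda>w. (cmod (w i - z i))\<^sup>2) \<longlongrightarrow> 0\<^sup>2) (atin (Cn n) z)"
      by (intro tendsto_power tendsto_norm_zero tendsto_Cn_coordinate assms) simp
    then show "((\<lambda>w. (cmod (w i - z i))\<^sup>2) \<longlongrightarrow> 0) (atin (Cn n) z)" by simp
  qed
  then have "((\<lambda>w. sqrt (\<Sum>i<n. (cmod (w i - z i))\<^sup>2)) \<longlongrightarrow> sqrt (\<Sum>i<n. 0)) (atin (Cn n) z)"
    by (rule tendsto_real_sqrt)
  then show ?thesis by (simp add: L2_set_def)
qed

lemma Cn_linear_bound:
  "cmod (\<Sum>i<n. c i * (w i - z i)) \<le> (\<Sum>i<n. cmod (c i)) * Cn_dist n z w"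
proof -
  have "cmod (\<Sum>i<n. c i * (w i - z i)) \<le> (\<Sum>i<n. cmod (c i * (w i - z i)))"
    by (rule norm_sum)
  also have "\<dots> \<le> (\<Sum>i<n. cmod (c i) * Cn_dist n z w)"
    by (intro sum_mono) (auto simp: norm_mult intro!: mult_left_mono member_le_L2_set)
  finally show ?thesis by (simp add: sum_distrib_right)
qed

lemma Cn_dist_nonzero:
  assumes "z \<in> topspace (Cn n)"
  shows "eventually (\<lambda>w. Cn_dist n z w \<noteq> 0) (atin (Cn n) z)"
  unfolding eventually_atin
proof (intro disjI2 exI conjI ballI)
  fix w assume w: "w \<in> topspace (Cn n) - {z}"
  then obtain i where "w i \<noteq> z i" by (auto simp: fun_eq_iff)
  moreover have "i < n"
  proof (rule ccontr)
    assume "\<not> i < n"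
    then have "w i = undefined" "z i = undefined"
      using w assms by (auto simp: topspace_Cn extensional_def)
    then show False using \<open>w i \<noteq> z i\<close> by simp
  qed
  ultimately show "Cn_dist n z w \<noteq> 0" by (auto simp: L2_set_eq_0_iff)
qed (use assms in auto)

text \<open>
  On the punctured neighbourhood the distance is nonzero, so the increment of \<open>f\<close> is the
  remainder quotient times the distance plus the linear part, and both tend to zero.
\<close>

lemma Cn_derivative_continuous:
  assumes z: "z \<in> topspace (Cn n)" and f: "Cn_derivative n f c z"
  shows "((\<lambda>w. f w - f z) \<longlongrightarrow> 0) (atin (Cn n) z)"
proof -
  let ?L = "\<lambda>w. \<Sum>i<n. c i * (w i - z i)"
  have "((\<lambda>w. (f w - f z - ?L w) / complex_of_real (Cn_dist n z w) * complex_of_real (Cn_dist n z w)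
      + ?L w) \<longlongrightarrow> 0 * complex_of_real 0 + (\<Sum>i<n. c i * 0)) (atin (Cn n) z)"
    using f unfolding Cn_derivative_def
    by (intro tendsto_add tendsto_mult tendsto_of_real tendsto_Cn_dist z tendsto_sum tendsto_const
        tendsto_Cn_coordinate) auto
  then have "((\<lambda>w. (f w - f z - ?L w) / complex_of_real (Cn_dist n z w) * complex_of_real (Cn_dist n z w)
      + ?L w) \<longlongrightarrow> 0) (atin (Cn n) z)" by simp
  then show ?thesis
    by (rule Lim_transform_eventually)
      (rule eventually_mono[OF Cn_dist_nonzero[OF z]], simp)
qed

lemma Cn_derivative_add:
  assumes "Cn_derivative n f c z" "Cn_derivative n h d z"
  shows "Cn_derivative n (\<lambda>w. f w + h w) (\<lambda>i. c i + d i) z"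
proof -
  have "((\<lambda>w. (f w - f z - (\<Sum>i<n. c i * (w i - z i))) / complex_of_real (Cn_dist n z w)
      + (h w - h z - (\<Sum>i<n. d i * (w i - z i))) / complex_of_real (Cn_dist n z w)) \<longlongrightarrow> 0 + 0)
      (atin (Cn n) z)"
    using assms unfolding Cn_derivative_def by (rule tendsto_add)
  moreover have "(f w - f z - (\<Sum>i<n. c i * (w i - z i))) / complex_of_real (Cn_dist n z w)
      + (h w - h z - (\<Sum>i<n. d i * (w i - z i))) / complex_of_real (Cn_dist n z w)
      = (f w + h w - (f z + h z) - (\<Sum>i<n. (c i + d i) * (w i - z i))) / complex_of_real (Cn_dist n z w)" for w
    by (simp add: add_divide_distrib diff_divide_distrib distrib_right sum.distrib)
  ultimately show ?thesis unfolding Cn_derivative_def by simp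
qed

text \<open>
  The product rule. With the increments \<open>\<Delta>f\<close>, \<open>\<Delta>h\<close>, the increment of the product is
  \<open>f(z) \<Delta>h + h(z) \<Delta>f + \<Delta>f \<Delta>h\<close>. In the last term \<open>\<Delta>f\<close> is split into its remainder and its linear part;
  the linear part is bounded by a multiple of the distance, and \<open>\<Delta>h\<close> tends to zero.
\<close>

lemma Cn_derivative_mult:
  assumes z: "z \<in> topspace (Cn n)" and f: "Cn_derivative n f c z" and h: "Cn_derivative n h d z"
  shows "Cn_derivative n (\<lambda>w. f w * h w) (\<lambda>i. f z * d i + h z * c i) z"
proof -
  let ?N = "\<lambda>w. complex_of_real (Cn_dist n z w)"
  let ?L = "\<lambda>w. \<Sum>i<n. c i * (w i - z i)" and ?M = "\<lambda>w. \<Sum>i<n. d i * (w i - z i)"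
  let ?rf = "\<lambda>w. (f w - f z - ?L w) / ?N w" and ?rh = "\<lambda>w. (h w - h z - ?M w) / ?N w"
  \<comment> \<open>for \<open>?N w = 0\<close> the quotient is zero by convention, which does not harm the bound\<close>
  have bounded: "((\<lambda>w. ?L w / ?N w * (h w - h z)) \<longlongrightarrow> 0) (atin (Cn n) z)"
  proof (rule tendsto_0_le[OF Cn_derivative_continuous[OF z h]])
    show "\<forall>\<^sub>F w in atin (Cn n) z. norm (?L w / ?N w * (h w - h z))
        \<le> norm (h w - h z) * (\<Sum>i<n. cmod (c i))"
    proof (rule always_eventually, rule allI)
      fix w
      have "cmod (?L w / ?N w) \<le> (\<Sum>i<n. cmod (c i))"
      proof (cases "Cn_dist n z w = 0")
        case False
        then have "Cn_dist n z w > 0" by (metis L2_set_nonneg less_eq_real_def)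
        then show ?thesis
          using Cn_linear_bound[where c = c and w = w and z = z and n = n]
          by (simp add: norm_divide divide_le_eq)
      qed (simp add: sum_nonneg)
      then have "cmod (?L w / ?N w) * cmod (h w - h z) \<le> (\<Sum>i<n. cmod (c i)) * cmod (h w - h z)"
        by (rule mult_right_mono) simp
      then show "norm (?L w / ?N w * (h w - h z)) \<le> norm (h w - h z) * (\<Sum>i<n. cmod (c i))"
        by (simp only: norm_mult mult.commute[of "cmod (h w - h z)"])
    qed
  qed
  have "((\<lambda>w. f z * ?rh w + h z * ?rf w + (?rf w * (h w - h z) + ?L w / ?N w * (h w - h z)))
      \<longlongrightarrow> f z * 0 + h z * 0 + (0 * 0 + 0)) (atin (Cn n) z)"
    using f h Cn_derivative_continuous[OF z h] bounded unfolding Cn_derivative_def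
    by (intro tendsto_add tendsto_mult tendsto_const)
  moreover have "f z * ?rh w + h z * ?rf w + (?rf w * (h w - h z) + ?L w / ?N w * (h w - h z))
      = (f w * h w - f z * h z - (\<Sum>i<n. (f z * d i + h z * c i) * (w i - z i))) / ?N w" for w
  proof -
    have "(\<Sum>i<n. (f z * d i + h z * c i) * (w i - z i)) = f z * ?M w + h z * ?L w"
      by (simp add: sum_distrib_left sum.distrib distrib_right mult.assoc)
    then have "f w * h w - f z * h z - (\<Sum>i<n. (f z * d i + h z * c i) * (w i - z i))
      = f z * (h w - h z - ?M w) + h z * (f w - f z - ?L w)
        + ((f w - f z - ?L w) * (h w - h z) + ?L w * (h w - h z))"
      by (simp add: algebra_simps)
    then show ?thesis by (simp add: add_divide_distrib)
  qed
  ultimately show ?thesis unfolding Cn_derivative_def by simp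
qed

lemma holomorphic_Cn_const: "openin (Cn n) D \<Longrightarrow> holomorphic_Cn n D (\<lambda>_. a)"
  unfolding holomorphic_Cn_iff Cn_derivative_def
  by (auto intro!: exI[of _ "\<lambda>_. 0"])

lemma holomorphic_Cn_topspace: "holomorphic_Cn n D f \<Longrightarrow> z \<in> D \<Longrightarrow> z \<in> topspace (Cn n)"
  using openin_subset by (fastforce simp: holomorphic_Cn_iff)

lemma holomorphic_Cn_add:
  "holomorphic_Cn n D f \<Longrightarrow> holomorphic_Cn n D h \<Longrightarrow> holomorphic_Cn n D (\<lambda>w. f w + h w)"
  unfolding holomorphic_Cn_iff using Cn_derivative_add by blast

lemma holomorphic_Cn_mult:
  assumes "holomorphic_Cn n D f" "holomorphic_Cn n D h"
  shows "holomorphic_Cn n D (\<lambda>w. f w * h w)"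
  using assms holomorphic_Cn_topspace[OF assms(1)] Cn_derivative_mult
  unfolding holomorphic_Cn_iff by blast

lemma holomorphic_Cn_cong:
  assumes f: "holomorphic_Cn n D f" and eq: "\<And>w. w \<in> D \<Longrightarrow> f w = h w"
  shows "holomorphic_Cn n D h"
  unfolding holomorphic_Cn_iff
proof (intro conjI ballI)
  show D: "openin (Cn n) D" using f by (simp add: holomorphic_Cn_iff)
  fix z assume z: "z \<in> D"
  then obtain c where c: "Cn_derivative n f c z" using f by (auto simp: holomorphic_Cn_iff)
  have "eventually (\<lambda>w. w \<in> D) (atin (Cn n) z)"
    unfolding eventually_atin using D z by blast
  then have "Cn_derivative n h c z"
    using c unfolding Cn_derivative_def
    by (elim Lim_transform_eventually) (auto elim!: eventually_mono simp: eq z)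
  then show "\<exists>c. Cn_derivative n h c z" by blast
qed

text \<open>
  Fixing the first \<open>n\<close> coordinates is a continuous injection that preserves distances, so it takes
  punctured neighbourhoods to punctured neighbourhoods and keeps the remainder quotient.
\<close>

lemma holomorphic_Cn_slice:
  fixes a :: "nat \<Rightarrow> complex" and n m :: nat
  defines "j \<equiv> \<lambda>w. \<lambda>i\<in>{..<n + m}. if i < n then a i else w (i - n)"
  assumes F: "holomorphic_Cn (n + m) D F"
  shows "holomorphic_Cn m {w \<in> topspace (Cn m). j w \<in> D} (F \<circ> j)"
proof -
  have j_cont: "continuous_map (Cn m) (Cn (n + m)) j"
    unfolding Cn_def[of "n + m"] continuous_map_componentwise
  proof (intro conjI ballI)
    fix i assume i: "i \<in> {..<n + m}"
    show "continuous_map (Cn m) euclidean (\<lambda>w. j w i)"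
    proof (cases "i < n")
      case True
      then show ?thesis using i by (simp add: j_def)
    next
      case False
      then have "i - n < m" using i by auto
      then show ?thesis using Cn_coordinate_continuous[of "i - n" m] False i by (simp add: j_def)
    qed
  qed (auto simp: j_def)
  have j_inj: "w = z" if "w \<in> topspace (Cn m)" "z \<in> topspace (Cn m)" "j w = j z" for w z
  proof
    fix i show "w i = z i"
    proof (cases "i < m")
      case True
      then show ?thesis using fun_cong[OF that(3), of "n + i"] by (simp add: j_def)
    next
      case False
      then show ?thesis using that by (simp add: topspace_Cn extensional_def)
    qed
  qed
  have D: "openin (Cn m) {w \<in> topspace (Cn m). j w \<in> D}"
    by (rule openin_continuous_map_preimage[OF j_cont]) (use F in \<open>simp add: holomorphic_Cn_iff\<close>)
  have "\<exists>c. Cn_derivative m (F \<circ> j) c z" if z: "z \<in> topspace (Cn m)" "j z \<in> D" for z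
  proof -
    obtain c where c: "Cn_derivative (n + m) F c (j z)" using F z(2) by (auto simp: holomorphic_Cn_iff)
    have lim: "filterlim j (atin (Cn (n + m)) (j z)) (atin (Cn m) z)"
      unfolding filterlim_iff
    proof (intro allI impI)
      fix P assume "eventually P (atin (Cn (n + m)) (j z))"
      moreover have "j z \<in> topspace (Cn (n + m))" by (rule holomorphic_Cn_topspace[OF F z(2)])
      ultimately obtain U where U: "openin (Cn (n + m)) U" "j z \<in> U" "\<forall>x\<in>U - {j z}. P x"
        by (auto simp: eventually_atin)
      have "openin (Cn m) {w \<in> topspace (Cn m). j w \<in> U}"
        by (rule openin_continuous_map_preimage[OF j_cont U(1)])
      moreover have "\<forall>w\<in>{w \<in> topspace (Cn m). j w \<in> U} - {z}. P (j w)"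
        using U(3) j_inj z(1) by blast
      ultimately show "eventually (\<lambda>w. P (j w)) (atin (Cn m) z)"
        unfolding eventually_atin using z(1) U(2) by blast
    qed
    have dist: "Cn_dist (n + m) (j z) (j w) = Cn_dist m z w" for w
      unfolding L2_set_def sum_lessThan_add by (simp add: j_def)
    have lin: "(\<Sum>i<n + m. c i * (j w i - j z i)) = (\<Sum>i<m. c (n + i) * (w i - z i))" for w
      unfolding sum_lessThan_add by (simp add: j_def)
    have "Cn_derivative m (F \<circ> j) (\<lambda>i. c (n + i)) z"
      using filterlim_compose[OF c[unfolded Cn_derivative_def] lim]
      by (simp add: Cn_derivative_def dist lin)
    then show ?thesis by blast
  qed
  then show ?thesis using D by (simp add: holomorphic_Cn_iff)
qed

locale manifold =
  fixes n :: nat and X :: "'a topology" and S :: "'a set \<Rightarrow> ('a \<Rightarrow> complex) set"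
  assumes manifold: "complex_manifold n X S"
begin

lemma sheaf: "function_sheaf X S"
  using manifold by (simp only: complex_manifold_def)

lemma section_restrict:
  "openin X U \<Longrightarrow> openin X W \<Longrightarrow> W \<subseteq> U \<Longrightarrow> f \<in> S U \<Longrightarrow> f \<in> S W"
  using conjunct1[OF sheaf[unfolded function_sheaf_def]] by blast

lemma section_glue:
  assumes "openin X U" "\<And>x. x \<in> U \<Longrightarrow> \<exists>W. openin X W \<and> x \<in> W \<and> W \<subseteq> U \<and> f \<in> S W"
  shows "f \<in> S U"
  using conjunct2[OF conjunct2[OF sheaf[unfolded function_sheaf_def]]] assms by simp

lemma chart_at:
  assumes "x \<in> topspace X"
  obtains C c where "x \<in> C" "holomorphic_chart n X S C c"
  using manifold assms by (auto simp: complex_manifold_def)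

lemma chart_section_iff:
  "holomorphic_chart n X S C c \<Longrightarrow> openin X W \<Longrightarrow> W \<subseteq> C \<Longrightarrow>
    f \<in> S W \<longleftrightarrow> holomorphic_Cn n (c ` W) (f \<circ> inv_into C c)"
  by (simp add: holomorphic_chart_def)

lemma chart_open: "holomorphic_chart n X S C c \<Longrightarrow> openin X C"
  by (simp add: holomorphic_chart_def)

lemma chart_inj:
  assumes "holomorphic_chart n X S C c"
  shows "inj_on c C"
proof -
  have "homeomorphic_map (subtopology X C) (subtopology (Cn n) (c ` C)) c" "C \<subseteq> topspace X"
    using assms openin_subset by (auto simp: holomorphic_chart_def)
  then show ?thesis
    using homeomorphic_imp_injective_map by (force simp: inf.absorb2)
qed

lemma chart_image_open:
  assumes c: "holomorphic_chart n X S C c" and W: "openin X W" "W \<subseteq> C"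
  shows "openin (Cn n) (c ` W)"
proof -
  have "open_map (subtopology X C) (subtopology (Cn n) (c ` C)) c"
    using c by (auto simp: holomorphic_chart_def intro: homeomorphic_imp_open_map)
  moreover have "openin (subtopology X C) W"
    using W chart_open[OF c] by (simp add: openin_open_subtopology)
  ultimately have "openin (subtopology (Cn n) (c ` C)) (c ` W)" by (simp add: open_map_def)
  then show ?thesis
    using c by (simp add: holomorphic_chart_def openin_open_subtopology)
qed

text \<open>
  Being a section can be tested in charts, by the sheaf property.
\<close>

lemma section_locally:
  assumes U: "openin X U"
    and loc: "\<And>x C c. x \<in> U \<Longrightarrow> x \<in> C \<Longrightarrow> holomorphic_chart n X S C c \<Longrightarrow>
      holomorphic_Cn n (c ` (C \<inter> U)) (f \<circ> inv_into C c)"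
  shows "f \<in> S U"
proof (rule section_glue[OF U])
  fix x assume x: "x \<in> U"
  then have "x \<in> topspace X" using openin_subset[OF U] by blast
  then obtain C c where c: "x \<in> C" "holomorphic_chart n X S C c" by (rule chart_at)
  have W: "openin X (C \<inter> U)" using U chart_open[OF c(2)] by (simp add: openin_Int)
  then have "f \<in> S (C \<inter> U)" using chart_section_iff[OF c(2) W] loc[OF x c] by simp
  then show "\<exists>W. openin X W \<and> x \<in> W \<and> W \<subseteq> U \<and> f \<in> S W" using W x c(1) by blast
qed

lemma section_in_chart:
  assumes "openin X U" "f \<in> S U" "holomorphic_chart n X S C c"
  shows "holomorphic_Cn n (c ` (C \<inter> U)) (f \<circ> inv_into C c)"
proof -
  have W: "openin X (C \<inter> U)" using assms chart_open by (simp add: openin_Int)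
  then show ?thesis
    using chart_section_iff[OF assms(3) W] section_restrict[OF assms(1) W _ assms(2)] by simp
qed

lemma section_const:
  assumes "openin X U"
  shows "(\<lambda>_. a) \<in> S U"
proof (rule section_locally[OF assms])
  fix C c assume c: "holomorphic_chart n X S C c"
  have "openin (Cn n) (c ` (C \<inter> U))"
    by (rule chart_image_open[OF c openin_Int[OF chart_open[OF c] assms]]) simp
  then show "holomorphic_Cn n (c ` (C \<inter> U)) ((\<lambda>_. a) \<circ> inv_into C c)"
    using holomorphic_Cn_const by (simp add: comp_def)
qed

lemma section_add:
  assumes "openin X U" "f \<in> S U" "h \<in> S U"
  shows "(\<lambda>x. f x + h x) \<in> S U"
proof (rule section_locally[OF assms(1)])
  fix C c assume "holomorphic_chart n X S C c"
  then show "holomorphic_Cn n (c ` (C \<inter> U)) ((\<lambda>x. f x + h x) \<circ> inv_into C c)"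
    using holomorphic_Cn_add[OF section_in_chart[OF assms(1,2)] section_in_chart[OF assms(1,3)]]
    by (simp add: comp_def)
qed

lemma section_mult:
  assumes "openin X U" "f \<in> S U" "h \<in> S U"
  shows "(\<lambda>x. f x * h x) \<in> S U"
proof (rule section_locally[OF assms(1)])
  fix C c assume "holomorphic_chart n X S C c"
  then show "holomorphic_Cn n (c ` (C \<inter> U)) ((\<lambda>x. f x * h x) \<circ> inv_into C c)"
    using holomorphic_Cn_mult[OF section_in_chart[OF assms(1,2)] section_in_chart[OF assms(1,3)]]
    by (simp add: comp_def)
qed

text \<open>
  In charts around \<open>x\<close> and around a point of \<open>U\<close>, this is the restriction of a holomorphic
  function to the slice on which the first \<open>n\<close> coordinates are those of \<open>x\<close>.
\<close>

lemma product_holomorphic_slice: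
  assumes F: "F \<in> product_holomorphic n X S W" and x: "x \<in> topspace X"
    and U: "openin X U" and UW: "\<And>y. y \<in> topspace X \<Longrightarrow> (x, y) \<in> W \<longleftrightarrow> y \<in> U"
  shows "(\<lambda>y. F (x, y)) \<in> S U"
proof (rule section_locally[OF U])
  fix y C c assume yC: "y \<in> C" and c: "holomorphic_chart n X S C c"
  obtain B b where b: "x \<in> B" "holomorphic_chart n X S B b" using x by (rule chart_at)
  define l where "l = (\<lambda>z :: nat \<Rightarrow> complex. \<lambda>i\<in>{..<n}. z i)"
  define r where "r = (\<lambda>z :: nat \<Rightarrow> complex. \<lambda>i\<in>{..<n}. z (n + i))"
  define p where "p = (\<lambda>z. (inv_into B b (l z), inv_into C c (r z)))"
  define D where "D = {z \<in> topspace (Cn (n + n)). l z \<in> b ` B \<and> r z \<in> c ` C \<and> p z \<in> W}"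
  define j where "j = (\<lambda>w. \<lambda>i\<in>{..<n + n}. if i < n then b x i else w (i - n))"
  have "holomorphic_Cn (n + n) D (F \<circ> p)"
    using F b(2) c unfolding product_holomorphic_def D_def p_def l_def r_def Let_def by blast
  then have *: "holomorphic_Cn n {w \<in> topspace (Cn n). j w \<in> D} ((F \<circ> p) \<circ> j)"
    unfolding j_def by (rule holomorphic_Cn_slice)
  have bx: "b x \<in> topspace (Cn n)"
    using openin_subset[OF chart_image_open[OF b(2) chart_open[OF b(2)]]] b(1) by auto
  have cC: "c ` C \<subseteq> topspace (Cn n)"
    using openin_subset[OF chart_image_open[OF c chart_open[OF c]]] by auto
  have CX: "C \<subseteq> topspace X" using chart_open[OF c] by (rule openin_subset)
  have jl: "l (j w) = b x" for w
  proof
    fix i show "l (j w) i = b x i"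
      using bx by (cases "i < n") (auto simp: l_def j_def topspace_Cn extensional_def)
  qed
  have jr: "r (j w) = w" if "w \<in> topspace (Cn n)" for w
    using that by (auto simp: r_def j_def topspace_Cn extensional_def)
  have jp: "p (j w) = (x, inv_into C c w)" if "w \<in> topspace (Cn n)" for w
    using jr[OF that] b(1) chart_inj[OF b(2)] by (simp add: p_def jl)
  have jtop: "j w \<in> topspace (Cn (n + n))" for w by (simp add: topspace_Cn j_def)
  have "j w \<in> D \<longleftrightarrow> w \<in> c ` (C \<inter> U)" if w: "w \<in> topspace (Cn n)" for w
  proof -
    have "j w \<in> D \<longleftrightarrow> w \<in> c ` C \<and> (x, inv_into C c w) \<in> W"
      using jtop b(1) by (simp add: D_def jl jr[OF w] jp[OF w])
    also have "\<dots> \<longleftrightarrow> w \<in> c ` (C \<inter> U)"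
      using UW CX chart_inj[OF c] by (auto simp: subset_iff)
    finally show ?thesis .
  qed
  then have D_eq: "{w \<in> topspace (Cn n). j w \<in> D} = c ` (C \<inter> U)" using cC by auto
  show "holomorphic_Cn n (c ` (C \<inter> U)) ((\<lambda>y. F (x, y)) \<circ> inv_into C c)"
    using *[unfolded D_eq] by (rule holomorphic_Cn_cong) (use jp cC in auto)
qed

end

lemma lie_group_space_with_functions:
  assumes V: "complex_lie_group V"
  shows "space_with_functions V"
proof -
  obtain n where "complex_manifold n (topo V) (reg V)" using V by (auto simp: complex_lie_group_def)
  then interpret manifold n "topo V" "reg V" by unfold_locales
  show ?thesis
    by unfold_locales
      (use V section_restrict section_const section_add section_mult in \<open>auto simp: complex_lie_group_def\<close>)
qed

lemma lie_group_translation: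
  assumes V: "complex_lie_group V" and x: "x \<in> carrier V"
  shows "space_morphism (topo V) (reg V) (topo V) (reg V) (\<lambda>y. x \<otimes>\<^bsub>V\<^esub> y)"
proof -
  obtain n where n: "complex_manifold n (topo V) (reg V)"
    "space_morphism (prod_topology (topo V) (topo V)) (product_holomorphic n (topo V) (reg V))
          (topo V) (reg V) (\<lambda>(x, y). x \<otimes>\<^bsub>V\<^esub> y)" and top: "topspace (topo V) = carrier V"
    using V by (auto simp: complex_lie_group_def)
  interpret manifold n "topo V" "reg V" by unfold_locales (rule n(1))
  have "continuous_map (topo V) (prod_topology (topo V) (topo V)) (\<lambda>y. (x, y))"
    using x by (simp add: continuous_map_pairwise comp_def top)
  from continuous_map_compose[OF this, of "topo V" "\<lambda>(x, y). x \<otimes>\<^bsub>V\<^esub> y"]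
  have cont: "continuous_map (topo V) (topo V) (\<lambda>y. x \<otimes>\<^bsub>V\<^esub> y)"
    using n(2) by (simp add: space_morphism_def comp_def)
  have "f \<circ> (\<lambda>y. x \<otimes>\<^bsub>V\<^esub> y) \<in> reg V {y \<in> topspace (topo V). x \<otimes>\<^bsub>V\<^esub> y \<in> U}"
    if U: "openin (topo V) U" "f \<in> reg V U" for U f
  proof -
    have "f \<circ> (\<lambda>(x, y). x \<otimes>\<^bsub>V\<^esub> y) \<in> product_holomorphic n (topo V) (reg V)
        {p \<in> topspace (prod_topology (topo V) (topo V)). (case p of (x, y) \<Rightarrow> x \<otimes>\<^bsub>V\<^esub> y) \<in> U}"
      using n(2) U unfolding space_morphism_def by blast
    from product_holomorphic_slice[OF this, of x "{y \<in> topspace (topo V). x \<otimes>\<^bsub>V\<^esub> y \<in> U}"]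
    show ?thesis
      using openin_continuous_map_preimage[OF cont U(1)] x by (simp add: comp_def top)
  qed
  then show ?thesis using cont by (simp add: space_morphism_def)
qed

section \<open>Complex linear algebraic groups\<close>

lemma generated_algebra_sum:
  assumes "finite I" "\<And>i. i \<in> I \<Longrightarrow> f i \<in> generated_algebra E"
  shows "(\<lambda>x. \<Sum>i\<in>I. f i x) \<in> generated_algebra E"
  using assms
proof (induction I rule: finite_induct)
  case empty
  then show ?case using generated_algebra.const[of 0] by simp
next
  case (insert i I)
  then show ?case using generated_algebra.add[of "f i" E "\<lambda>x. \<Sum>i\<in>I. f i x"] by simp
qed

lemma GL_carrier: "M \<in> carrier (GL n) \<Longrightarrow> M \<in> carrier_mat n n"
  by (auto simp: GL_def units_of_def Units_def ring_mat_simps)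

lemma GL_mult: "M \<otimes>\<^bsub>GL n\<^esub> N = M * N"
  by (simp add: GL_def units_of_def ring_mat_simps)

lemma GL_polynomials_const: "(\<lambda>_. c) \<in> GL_polynomials n"
  and GL_polynomials_add: "p \<in> GL_polynomials n \<Longrightarrow> q \<in> GL_polynomials n \<Longrightarrow>
    (\<lambda>M. p M + q M) \<in> GL_polynomials n"
  and GL_polynomials_mult: "p \<in> GL_polynomials n \<Longrightarrow> q \<in> GL_polynomials n \<Longrightarrow>
    (\<lambda>M. p M * q M) \<in> GL_polynomials n"
  by (simp_all add: GL_polynomials_def generated_algebra.intros)

text \<open>
  The entries of \<open>N * M\<close> are linear in the entries of \<open>M\<close>, and its determinant is multiplicative; so
  replacing \<open>M\<close> by \<open>N * M\<close> maps the generators of the algebra into the algebra.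
\<close>

lemma GL_polynomials_translate:
  assumes N: "N \<in> carrier (GL n)" and p: "p \<in> GL_polynomials n"
  shows "\<exists>q\<in>GL_polynomials n. \<forall>M\<in>carrier (GL n). q M = p (N * M)"
  using p unfolding GL_polynomials_def
proof (induction rule: generated_algebra.induct)
  case (const c)
  then show ?case by (intro bexI[of _ "\<lambda>_. c"]) (auto intro: generated_algebra.const)
next
  case (gen f)
  let ?E = "{\<lambda>M. M $$ (i, j) | i j. i < n \<and> j < n} \<union> {\<lambda>M. 1 / Determinant.det M} :: (complex mat \<Rightarrow> complex) set"
  from gen consider (entry) i j where "i < n" "j < n" "f = (\<lambda>M. M $$ (i, j))"
    | (det) "f = (\<lambda>M. 1 / Determinant.det M)" by blast
  then show ?case
  proof cases
    case entry
    have "(\<lambda>M. \<Sum>k\<in>{0..<n}. N $$ (i, k) * M $$ (k, j)) \<in> generated_algebra ?E"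
      by (rule generated_algebra_sum, simp,
          rule generated_algebra.mult[OF generated_algebra.const generated_algebra.gen])
        (use entry in auto)
    moreover have "(\<Sum>k\<in>{0..<n}. N $$ (i, k) * M $$ (k, j)) = f (N * M)" if "M \<in> carrier (GL n)" for M
      using GL_carrier[OF that] GL_carrier[OF N] entry by (simp add: scalar_prod_def)
    ultimately show ?thesis by (intro bexI ballI)
  next
    case det
    have "(\<lambda>M. 1 / Determinant.det N * (1 / Determinant.det M)) \<in> generated_algebra ?E"
      by (rule generated_algebra.mult[OF generated_algebra.const generated_algebra.gen]) simp
    moreover have "1 / Determinant.det N * (1 / Determinant.det M) = f (N * M)"
      if "M \<in> carrier (GL n)" for M
      using det_mult[OF GL_carrier[OF N] GL_carrier[OF that]] det by simp
    ultimately show ?thesis by (intro bexI ballI)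
  qed
next
  case (add f h)
  obtain f' where f': "f' \<in> generated_algebra ({\<lambda>M. M $$ (i, j) | i j. i < n \<and> j < n} \<union> {\<lambda>M. 1 / Determinant.det M})" "\<forall>M\<in>carrier (GL n). f' M = f (N * M)"
    using add.IH(1) by (rule bexE)
  obtain h' where h': "h' \<in> generated_algebra ({\<lambda>M. M $$ (i, j) | i j. i < n \<and> j < n} \<union> {\<lambda>M. 1 / Determinant.det M})" "\<forall>M\<in>carrier (GL n). h' M = h (N * M)"
    using add.IH(2) by (rule bexE)
  show ?case
    by (rule bexI[OF _ generated_algebra.add[OF f'(1) h'(1)]]) (simp add: f'(2) h'(2))
next
  case (mult f h)
  obtain f' where f': "f' \<in> generated_algebra ({\<lambda>M. M $$ (i, j) | i j. i < n \<and> j < n} \<union> {\<lambda>M. 1 / Determinant.det M})" "\<forall>M\<in>carrier (GL n). f' M = f (N * M)"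
    using mult.IH(1) by (rule bexE)
  obtain h' where h': "h' \<in> generated_algebra ({\<lambda>M. M $$ (i, j) | i j. i < n \<and> j < n} \<union> {\<lambda>M. 1 / Determinant.det M})" "\<forall>M\<in>carrier (GL n). h' M = h (N * M)"
    using mult.IH(2) by (rule bexE)
  show ?case
    by (rule bexI[OF _ generated_algebra.mult[OF f'(1) h'(1)]]) (simp add: f'(2) h'(2))
qed

text \<open>
  A representation along which topology and regular functions are pulled back from the general
  linear group, chosen once and for all.
\<close>

locale embedded_algebraic_group = V: group V for V :: "'a space_group" +
  fixes n :: nat and \<rho> :: "'a \<Rightarrow> complex mat"
  assumes \<rho>_hom: "\<rho> \<in> hom V (GL n)"
    and open_iff: "openin (topo V) U \<longleftrightarrow>
      (\<exists>P \<subseteq> GL_polynomials n. U = {x \<in> carrier V. \<exists>p\<in>P. p (\<rho> x) \<noteq> 0})"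
    and reg_eq: "reg V U =
      {f. \<forall>x\<in>U. \<exists>W p q. openin (topo V) W \<and> x \<in> W \<and> W \<subseteq> U \<and>
         p \<in> GL_polynomials n \<and> q \<in> GL_polynomials n \<and>
         (\<forall>y\<in>W. q (\<rho> y) \<noteq> 0 \<and> f y = p (\<rho> y) / q (\<rho> y))}"
begin

lemma regI:
  assumes "\<And>x. x \<in> U \<Longrightarrow> \<exists>W p q. openin (topo V) W \<and> x \<in> W \<and> W \<subseteq> U \<and>
    p \<in> GL_polynomials n \<and> q \<in> GL_polynomials n \<and>
    (\<forall>y\<in>W. q (\<rho> y) \<noteq> 0 \<and> f y = p (\<rho> y) / q (\<rho> y))"
  shows "f \<in> reg V U"
  unfolding reg_eq using assms by blast

lemma regE:
  assumes "f \<in> reg V U" "x \<in> U"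
  obtains W p q where "openin (topo V) W" "x \<in> W" "W \<subseteq> U" "p \<in> GL_polynomials n"
    "q \<in> GL_polynomials n" "\<forall>y\<in>W. q (\<rho> y) \<noteq> 0 \<and> f y = p (\<rho> y) / q (\<rho> y)"
  using assms unfolding reg_eq by blast

lemma topspace_eq: "topspace (topo V) = carrier V"
proof
  show "topspace (topo V) \<subseteq> carrier V"
    using openin_topspace[of "topo V"] unfolding open_iff by blast
  have "openin (topo V) (carrier V)"
    unfolding open_iff by (rule exI[of _ "{\<lambda>_. 1}"]) (simp add: GL_polynomials_const)
  then show "carrier V \<subseteq> topspace (topo V)" by (rule openin_subset)
qed

lemma space_with_functions: "space_with_functions V"
proof (unfold_locales)
  show "topspace (topo V) = carrier V" by (rule topspace_eq)
next
  fix U W f assume UW: "openin (topo V) U" "openin (topo V) W" "W \<subseteq> U" "f \<in> reg V U"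
  show "f \<in> reg V W"
  proof (rule regI)
    fix x assume x: "x \<in> W"
    obtain W' p q where "openin (topo V) W'" "x \<in> W'" "W' \<subseteq> U" "p \<in> GL_polynomials n"
      "q \<in> GL_polynomials n" "\<forall>y\<in>W'. q (\<rho> y) \<noteq> 0 \<and> f y = p (\<rho> y) / q (\<rho> y)"
      using UW(4) subsetD[OF UW(3) x] by (rule regE)
    then show "\<exists>W' p q. openin (topo V) W' \<and> x \<in> W' \<and> W' \<subseteq> W \<and>
      p \<in> GL_polynomials n \<and> q \<in> GL_polynomials n \<and> (\<forall>y\<in>W'. q (\<rho> y) \<noteq> 0 \<and> f y = p (\<rho> y) / q (\<rho> y))"
      using UW(2) x by (intro exI[of _ "W \<inter> W'"] exI[of _ p] exI[of _ q]) (simp add: openin_Int)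
  qed
next
  fix U c assume "openin (topo V) U"
  then show "(\<lambda>_. c) \<in> reg V U"
    by (intro regI exI[of _ U] exI[of _ "\<lambda>_. c"] exI[of _ "\<lambda>_. 1"]) (simp add: GL_polynomials_const)
next
  fix U f h assume U: "openin (topo V) U" "f \<in> reg V U" "h \<in> reg V U"
  have common: "\<exists>W p q p' q'. openin (topo V) W \<and> x \<in> W \<and> W \<subseteq> U \<and>
      p \<in> GL_polynomials n \<and> q \<in> GL_polynomials n \<and> p' \<in> GL_polynomials n \<and> q' \<in> GL_polynomials n \<and>
      (\<forall>y\<in>W. q (\<rho> y) \<noteq> 0 \<and> f y = p (\<rho> y) / q (\<rho> y) \<and> q' (\<rho> y) \<noteq> 0 \<and> h y = p' (\<rho> y) / q' (\<rho> y))"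
    if x: "x \<in> U" for x
  proof -
    obtain W1 p q where 1: "openin (topo V) W1" "x \<in> W1" "W1 \<subseteq> U" "p \<in> GL_polynomials n"
      "q \<in> GL_polynomials n" "\<forall>y\<in>W1. q (\<rho> y) \<noteq> 0 \<and> f y = p (\<rho> y) / q (\<rho> y)"
      using U(2) x by (rule regE)
    obtain W2 p' q' where 2: "openin (topo V) W2" "x \<in> W2" "W2 \<subseteq> U" "p' \<in> GL_polynomials n"
      "q' \<in> GL_polynomials n" "\<forall>y\<in>W2. q' (\<rho> y) \<noteq> 0 \<and> h y = p' (\<rho> y) / q' (\<rho> y)"
      using U(3) x by (rule regE)
    show ?thesis
      by (rule exI[of _ "W1 \<inter> W2"], rule exI[of _ p], rule exI[of _ q], rule exI[of _ p'], rule exI[of _ q'])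
        (use 1 2 in \<open>auto simp: openin_Int\<close>)
  qed
  show "(\<lambda>x. f x + h x) \<in> reg V U"
  proof (rule regI)
    fix x assume x: "x \<in> U"
    obtain W p q p' q' where W: "openin (topo V) W" "x \<in> W" "W \<subseteq> U"
      "p \<in> GL_polynomials n" "q \<in> GL_polynomials n" "p' \<in> GL_polynomials n" "q' \<in> GL_polynomials n"
      "\<forall>y\<in>W. q (\<rho> y) \<noteq> 0 \<and> f y = p (\<rho> y) / q (\<rho> y) \<and> q' (\<rho> y) \<noteq> 0 \<and> h y = p' (\<rho> y) / q' (\<rho> y)"
      using common[OF x] by (elim exE conjE) (rule that)
    show "\<exists>W p q. openin (topo V) W \<and> x \<in> W \<and> W \<subseteq> U \<and> p \<in> GL_polynomials n \<and>
      q \<in> GL_polynomials n \<and> (\<forall>y\<in>W. q (\<rho> y) \<noteq> 0 \<and> f y + h y = p (\<rho> y) / q (\<rho> y))"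
      by (rule exI[of _ W], rule exI[of _ "\<lambda>M. p M * q' M + p' M * q M"], rule exI[of _ "\<lambda>M. q M * q' M"])
        (use W in \<open>simp add: GL_polynomials_add GL_polynomials_mult add_frac_eq\<close>)
  qed
  show "(\<lambda>x. f x * h x) \<in> reg V U"
  proof (rule regI)
    fix x assume x: "x \<in> U"
    obtain W p q p' q' where W: "openin (topo V) W" "x \<in> W" "W \<subseteq> U"
      "p \<in> GL_polynomials n" "q \<in> GL_polynomials n" "p' \<in> GL_polynomials n" "q' \<in> GL_polynomials n"
      "\<forall>y\<in>W. q (\<rho> y) \<noteq> 0 \<and> f y = p (\<rho> y) / q (\<rho> y) \<and> q' (\<rho> y) \<noteq> 0 \<and> h y = p' (\<rho> y) / q' (\<rho> y)"
      using common[OF x] by (elim exE conjE) (rule that)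
    show "\<exists>W p q. openin (topo V) W \<and> x \<in> W \<and> W \<subseteq> U \<and> p \<in> GL_polynomials n \<and>
      q \<in> GL_polynomials n \<and> (\<forall>y\<in>W. q (\<rho> y) \<noteq> 0 \<and> f y * h y = p (\<rho> y) / q (\<rho> y))"
      by (rule exI[of _ W], rule exI[of _ "\<lambda>M. p M * p' M"], rule exI[of _ "\<lambda>M. q M * q' M"])
        (use W in \<open>simp add: GL_polynomials_mult\<close>)
  qed
qed

lemma translation:
  assumes x: "x \<in> carrier V"
  shows "space_morphism (topo V) (reg V) (topo V) (reg V) (\<lambda>y. x \<otimes>\<^bsub>V\<^esub> y)"
proof -
  have \<rho>x: "\<rho> x \<in> carrier (GL n)" using \<rho>_hom x by (rule hom_in_carrier)
  have \<rho>_mult: "\<rho> (x \<otimes>\<^bsub>V\<^esub> y) = \<rho> x * \<rho> y" "\<rho> y \<in> carrier (GL n)" if "y \<in> carrier V" for y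
    using hom_mult[OF \<rho>_hom x that] hom_in_carrier[OF \<rho>_hom that] by (simp_all add: GL_mult)
  have pre: "openin (topo V) {y \<in> topspace (topo V). x \<otimes>\<^bsub>V\<^esub> y \<in> U}" if "openin (topo V) U" for U
  proof -
    from that obtain P where P: "P \<subseteq> GL_polynomials n" "U = {x \<in> carrier V. \<exists>p\<in>P. p (\<rho> x) \<noteq> 0}"
      unfolding open_iff by blast
    \<comment> \<open>all translates of the functions in \<open>P\<close>, which avoids choosing one for each of them\<close>
    define Q where "Q = {q \<in> GL_polynomials n. \<exists>p\<in>P. \<forall>M\<in>carrier (GL n). q M = p (\<rho> x * M)}"
    have "x \<otimes>\<^bsub>V\<^esub> y \<in> U \<longleftrightarrow> (\<exists>q\<in>Q. q (\<rho> y) \<noteq> 0)" if y: "y \<in> carrier V" for y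
    proof
      assume "x \<otimes>\<^bsub>V\<^esub> y \<in> U"
      then obtain p where p: "p \<in> P" "p (\<rho> x * \<rho> y) \<noteq> 0" using P(2) \<rho>_mult[OF y] by auto
      then obtain q where "q \<in> GL_polynomials n" "\<forall>M\<in>carrier (GL n). q M = p (\<rho> x * M)"
        using GL_polynomials_translate[OF \<rho>x subsetD[OF P(1) p(1)]] by (elim bexE) (rule that)
      then have "q \<in> Q" "q (\<rho> y) = p (\<rho> x * \<rho> y)"
        using p(1) \<rho>_mult(2)[OF y] by (auto simp: Q_def)
      then show "\<exists>q\<in>Q. q (\<rho> y) \<noteq> 0" using p(2) by (intro bexI[of _ q]) simp_all
    next
      assume "\<exists>q\<in>Q. q (\<rho> y) \<noteq> 0"
      then obtain q p where "p \<in> P" "\<forall>M\<in>carrier (GL n). q M = p (\<rho> x * M)" "q (\<rho> y) \<noteq> 0"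
        unfolding Q_def by auto
      then show "x \<otimes>\<^bsub>V\<^esub> y \<in> U" using P(2) x y \<rho>_mult[OF y] by auto
    qed
    then have "{y \<in> topspace (topo V). x \<otimes>\<^bsub>V\<^esub> y \<in> U} = {y \<in> carrier V. \<exists>q\<in>Q. q (\<rho> y) \<noteq> 0}"
      by (auto simp: topspace_eq)
    moreover have "Q \<subseteq> GL_polynomials n" by (auto simp: Q_def)
    ultimately show ?thesis unfolding open_iff by blast
  qed
  have "f \<circ> (\<lambda>y. x \<otimes>\<^bsub>V\<^esub> y) \<in> reg V {y \<in> topspace (topo V). x \<otimes>\<^bsub>V\<^esub> y \<in> U}"
    if f: "f \<in> reg V U" for U f
  proof (rule regI)
    fix y assume "y \<in> {y \<in> topspace (topo V). x \<otimes>\<^bsub>V\<^esub> y \<in> U}"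
    then have y: "y \<in> carrier V" "x \<otimes>\<^bsub>V\<^esub> y \<in> U" by (auto simp: topspace_eq)
    obtain W p q where W: "openin (topo V) W" "x \<otimes>\<^bsub>V\<^esub> y \<in> W" "W \<subseteq> U" "p \<in> GL_polynomials n"
      "q \<in> GL_polynomials n" "\<forall>y\<in>W. q (\<rho> y) \<noteq> 0 \<and> f y = p (\<rho> y) / q (\<rho> y)"
      using f y(2) by (rule regE)
    obtain p' where p': "p' \<in> GL_polynomials n" "\<forall>M\<in>carrier (GL n). p' M = p (\<rho> x * M)"
      using GL_polynomials_translate[OF \<rho>x W(4)] by (elim bexE) (rule that)
    obtain q' where q': "q' \<in> GL_polynomials n" "\<forall>M\<in>carrier (GL n). q' M = q (\<rho> x * M)"
      using GL_polynomials_translate[OF \<rho>x W(5)] by (elim bexE) (rule that)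
    show "\<exists>W p q. openin (topo V) W \<and> y \<in> W \<and> W \<subseteq> {y \<in> topspace (topo V). x \<otimes>\<^bsub>V\<^esub> y \<in> U} \<and>
      p \<in> GL_polynomials n \<and> q \<in> GL_polynomials n \<and>
      (\<forall>z\<in>W. q (\<rho> z) \<noteq> 0 \<and> (f \<circ> (\<lambda>y. x \<otimes>\<^bsub>V\<^esub> y)) z = p (\<rho> z) / q (\<rho> z))"
      by (rule exI[of _ "{y \<in> topspace (topo V). x \<otimes>\<^bsub>V\<^esub> y \<in> W}"], rule exI[of _ p'], rule exI[of _ q'])
        (use W y p' q' \<rho>_mult pre[OF W(1)] in \<open>auto simp: topspace_eq\<close>)
  qed
  then show ?thesis
    using pre x by (auto simp: space_morphism_def continuous_map_def topspace_eq)
qed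

end

lemma algebraic_group_embedding:
  assumes V: "linear_algebraic_group V"
  obtains n \<rho> where "embedded_algebraic_group V n \<rho>"
proof -
  from V obtain n \<rho> where "group V" "\<rho> \<in> hom V (GL n)"
    "\<forall>U. openin (topo V) U \<longleftrightarrow>
      (\<exists>P \<subseteq> GL_polynomials n. U = {x \<in> carrier V. \<exists>p\<in>P. p (\<rho> x) \<noteq> 0})"
    "\<forall>U. reg V U =
      {f. \<forall>x\<in>U. \<exists>W p q. openin (topo V) W \<and> x \<in> W \<and> W \<subseteq> U \<and>
         p \<in> GL_polynomials n \<and> q \<in> GL_polynomials n \<and>
         (\<forall>y\<in>W. q (\<rho> y) \<noteq> 0 \<and> f y = p (\<rho> y) / q (\<rho> y))}"
    unfolding linear_algebraic_group_def by (elim conjE exE) (rule that)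
  then have "embedded_algebraic_group V n \<rho>"
    by (intro embedded_algebraic_group.intro embedded_algebraic_group_axioms.intro) simp_all
  then show thesis by (rule that)
qed

section \<open>Groups with a finite group of automorphisms\<close>

lemma (in cring) finsum_mem:
  assumes "finite S" "I \<subseteq> carrier R" "\<zero> \<in> I" "\<And>a b. a \<in> I \<Longrightarrow> b \<in> I \<Longrightarrow> a \<oplus> b \<in> I"
    and "\<And>i. i \<in> S \<Longrightarrow> f i \<in> I"
  shows "finsum R f S \<in> I"
  using assms(1,5)
proof (induction S rule: finite_induct)
  case (insert i S)
  have "f \<in> S \<rightarrow> carrier R" "f i \<in> carrier R" using insert.prems assms(2) by auto
  then show ?case using insert by (simp add: assms(4))
qed (simp add: assms)

text \<open>
  The first isomorphism theorem in the form needed here: an endomorphism that preserves the kernel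
  of a surjection descends along it. That the target is a group follows from surjectivity.
\<close>

lemma hom_factors_through_surjection:
  assumes Q: "group Q" and phi: "\<phi> \<in> hom Q E" "\<phi> ` carrier Q = carrier E" "\<phi> \<one>\<^bsub>Q\<^esub> = \<one>\<^bsub>E\<^esub>"
    and a: "a \<in> hom Q Q" "a ` kernel Q E \<phi> \<subseteq> kernel Q E \<phi>"
  shows "\<exists>B\<in>hom E E. \<forall>F\<in>carrier Q. B (\<phi> F) = \<phi> (a F)"
proof -
  interpret Q: group Q by (rule Q)
  have "E\<lparr>carrier := \<phi> ` carrier Q, one := \<phi> \<one>\<^bsub>Q\<^esub>\<rparr> = E"
    by (simp add: phi)
  then interpret E: group E using Q.hom_imp_img_group[OF phi(1)] by simp
  interpret phi: group_hom Q E \<phi>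
    by unfold_locales (rule phi(1))
  interpret a: group_hom Q Q a
    by unfold_locales (rule a(1))
  have well_defined: "\<phi> (a F) = \<phi> (a F')"
    if F: "F \<in> carrier Q" "F' \<in> carrier Q" and eq: "\<phi> F = \<phi> F'" for F F'
  proof -
    have "F \<otimes>\<^bsub>Q\<^esub> inv\<^bsub>Q\<^esub> F' \<in> kernel Q E \<phi>"
      using F eq by (simp add: kernel_def)
    then have "\<phi> (a (F \<otimes>\<^bsub>Q\<^esub> inv\<^bsub>Q\<^esub> F')) = \<one>\<^bsub>E\<^esub>"
      using a(2) by (auto simp: kernel_def)
    then have "\<phi> (a F) \<otimes>\<^bsub>E\<^esub> inv\<^bsub>E\<^esub> \<phi> (a F') = \<one>\<^bsub>E\<^esub>"
      using F by (simp only: a.hom_mult a.hom_inv phi.hom_mult phi.hom_inv Q.inv_closed a.hom_closed)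
    then have "\<phi> (a F) = \<one>\<^bsub>E\<^esub> \<otimes>\<^bsub>E\<^esub> \<phi> (a F')"
      using F E.inv_solve_right[of "\<one>\<^bsub>E\<^esub>" "\<phi> (a F)" "\<phi> (a F')"] by (metis E.one_closed a.hom_closed phi.hom_closed)
    then show ?thesis
      using F by (simp only: E.l_one a.hom_closed phi.hom_closed)
  qed
  define r where "r = inv_into (carrier Q) \<phi>"
  have r: "r c \<in> carrier Q \<and> \<phi> (r c) = c" if "c \<in> carrier E" for c
    using that phi(2) inv_into_into[of c \<phi> "carrier Q"] f_inv_into_f[of c \<phi> "carrier Q"]
    by (simp add: r_def)
  have hom_r: "\<phi> (a (r (c \<otimes>\<^bsub>E\<^esub> d))) = \<phi> (a (r c)) \<otimes>\<^bsub>E\<^esub> \<phi> (a (r d))"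
    if cd: "c \<in> carrier E" "d \<in> carrier E" for c d
  proof -
    have rc: "r c \<in> carrier Q" "r d \<in> carrier Q" "\<phi> (r c) = c" "\<phi> (r d) = d"
      using r cd by blast+
    have rcd: "r (c \<otimes>\<^bsub>E\<^esub> d) \<in> carrier Q" "\<phi> (r (c \<otimes>\<^bsub>E\<^esub> d)) = c \<otimes>\<^bsub>E\<^esub> d"
      using r E.m_closed[OF cd] by blast+
    have "\<phi> (a (r (c \<otimes>\<^bsub>E\<^esub> d))) = \<phi> (a (r c \<otimes>\<^bsub>Q\<^esub> r d))"
      by (rule well_defined[OF rcd(1) Q.m_closed[OF rc(1,2)]])
        (simp only: rc rcd phi.hom_mult)
    also have "\<dots> = \<phi> (a (r c)) \<otimes>\<^bsub>E\<^esub> \<phi> (a (r d))"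
      by (simp only: rc a.hom_mult phi.hom_mult a.hom_closed)
    finally show ?thesis .
  qed
  show ?thesis
  proof (intro bexI ballI)
    show "\<phi> (a (r (\<phi> F))) = \<phi> (a F)" if "F \<in> carrier Q" for F
      using well_defined r phi.hom_closed that by blast
    show "(\<lambda>c. \<phi> (a (r c))) \<in> hom E E"
      by (rule homI) (use r a.hom_closed phi.hom_closed hom_r in blast)+
  qed
qed

locale group_with_finite_action =
  space_with_functions V + V: group V + G: group G
  for V :: "'a space_group" and G :: "'g monoid" +
  fixes act :: "'g \<Rightarrow> 'a \<Rightarrow> 'a"
  assumes finite_G: "finite (carrier G)"
    and action: "acts_by_automorphisms V G act"
    and translation: "\<And>\<xi>. \<xi> \<in> carrier V \<Longrightarrow>
      space_morphism (topo V) (reg V) (topo V) (reg V) (\<lambda>y. \<xi> \<otimes>\<^bsub>V\<^esub> y)"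
begin

lemma act_auto: "g \<in> carrier G \<Longrightarrow> act g \<in> hom V V \<inter> Bij (carrier V)"
  using action hom_in_carrier[of act G "AutoGroup V" g]
  by (auto simp: acts_by_automorphisms_def AutoGroup_def auto_def)

lemma act_closed [simp, intro]: "g \<in> carrier G \<Longrightarrow> x \<in> carrier V \<Longrightarrow> act g x \<in> carrier V"
  using act_auto by (blast intro: hom_in_carrier)

lemma act_mult: "g \<in> carrier G \<Longrightarrow> x \<in> carrier V \<Longrightarrow> y \<in> carrier V \<Longrightarrow>
    act g (x \<otimes>\<^bsub>V\<^esub> y) = act g x \<otimes>\<^bsub>V\<^esub> act g y"
  using act_auto by (blast intro: hom_mult)

lemma act_comp:
  assumes "g \<in> carrier G" "h \<in> carrier G" "x \<in> carrier V"
  shows "act (g \<otimes>\<^bsub>G\<^esub> h) x = act g (act h x)"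
proof -
  have "act (g \<otimes>\<^bsub>G\<^esub> h) = act g \<otimes>\<^bsub>AutoGroup V\<^esub> act h"
    using action assms by (auto simp: acts_by_automorphisms_def intro: hom_mult)
  then show ?thesis
    using act_auto[OF assms(1)] act_auto[OF assms(2)] assms(3)
    by (simp add: AutoGroup_def BijGroup_def compose_def)
qed

lemma act_one [simp]: "x \<in> carrier V \<Longrightarrow> act \<one>\<^bsub>G\<^esub> x = x"
  using hom_one[of act G "AutoGroup V"] action G.group_axioms V.AutoGroup
  by (simp add: acts_by_automorphisms_def AutoGroup_def BijGroup_def)

lemma act_inv_left [simp]:
  "g \<in> carrier G \<Longrightarrow> x \<in> carrier V \<Longrightarrow> act (inv\<^bsub>G\<^esub> g) (act g x) = x"
  by (simp flip: act_comp)

lemma act_inv_right [simp]: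
  "g \<in> carrier G \<Longrightarrow> x \<in> carrier V \<Longrightarrow> act g (act (inv\<^bsub>G\<^esub> g) x) = x"
  by (simp flip: act_comp)

lemma act_group_hom: "g \<in> carrier G \<Longrightarrow> group_hom V V (act g)"
  using act_auto by unfold_locales blast

lemma act_unit [simp]: "g \<in> carrier G \<Longrightarrow> act g \<one>\<^bsub>V\<^esub> = \<one>\<^bsub>V\<^esub>"
  by (rule group_hom.hom_one[OF act_group_hom])

lemma act_inv: "g \<in> carrier G \<Longrightarrow> x \<in> carrier V \<Longrightarrow> act g (inv\<^bsub>V\<^esub> x) = inv\<^bsub>V\<^esub> act g x"
  by (rule group_hom.hom_inv[OF act_group_hom])

lemma inv_mult_cancel [simp]:
  "x \<in> carrier V \<Longrightarrow> y \<in> carrier V \<Longrightarrow> inv\<^bsub>V\<^esub> x \<otimes>\<^bsub>V\<^esub> (x \<otimes>\<^bsub>V\<^esub> y) = y"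
  "x \<in> carrier V \<Longrightarrow> y \<in> carrier V \<Longrightarrow> x \<otimes>\<^bsub>V\<^esub> (inv\<^bsub>V\<^esub> x \<otimes>\<^bsub>V\<^esub> y) = y"
  by (simp_all flip: V.m_assoc)

lemma automorphism_translation: "\<xi> \<in> carrier V \<Longrightarrow> automorphism (\<lambda>y. \<xi> \<otimes>\<^bsub>V\<^esub> y)"
  by (rule automorphismI[where t = "\<lambda>y. inv\<^bsub>V\<^esub> \<xi> \<otimes>\<^bsub>V\<^esub> y"]) (simp_all add: morphism_def translation)

lemma automorphism_act: "g \<in> carrier G \<Longrightarrow> automorphism (act g)"
  using action
  by (intro automorphismI[where t = "act (inv\<^bsub>G\<^esub> g)"])
    (simp_all add: morphism_def acts_by_automorphisms_def)

subsection \<open>Translations and group elements acting on germs\<close>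

abbreviation "mero1 \<equiv> mero V \<one>\<^bsub>V\<^esub>"
abbreviation "hol1 \<equiv> hol V \<one>\<^bsub>V\<^esub>"
abbreviation "tau \<equiv> translate V"
abbreviation "gam \<equiv> gact V G act"

lemma tau_hom:
  assumes "\<xi> \<in> carrier V" "x \<in> carrier V"
  shows "tau \<xi> x \<in> Ring.ring_hom (mero V x) (mero V (\<xi> \<otimes>\<^bsub>V\<^esub> x))"
  using mero_push_hom[OF automorphism_translation[of "inv\<^bsub>V\<^esub> \<xi>"], of "\<xi> \<otimes>\<^bsub>V\<^esub> x"] assms
  by (simp add: translate_def)

lemma gam_hom:
  assumes "g \<in> carrier G" "x \<in> carrier V"
  shows "gam g x \<in> Ring.ring_hom (mero V x) (mero V (act g x))"
  using mero_push_hom[OF automorphism_act[of "inv\<^bsub>G\<^esub> g"], of "act g x"] assms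
  by (simp add: gact_def)

lemma tau_hol:
  assumes "\<xi> \<in> carrier V" "x \<in> carrier V" "a \<in> carrier (hol V x)"
  shows "tau \<xi> x a \<in> carrier (hol V (\<xi> \<otimes>\<^bsub>V\<^esub> x))"
  using mero_push_hol[OF automorphism_translation[of "inv\<^bsub>V\<^esub> \<xi>"], of "\<xi> \<otimes>\<^bsub>V\<^esub> x"] assms
  by (simp add: translate_def)

lemma gam_hol:
  assumes "g \<in> carrier G" "x \<in> carrier V" "a \<in> carrier (hol V x)"
  shows "gam g x a \<in> carrier (hol V (act g x))"
  using mero_push_hol[OF automorphism_act[of "inv\<^bsub>G\<^esub> g"], of "act g x"] assms
  by (simp add: gact_def)

lemma gam_const_germ:
  assumes "g \<in> carrier G" "x \<in> carrier V"
  shows "gam g x (const_germ x c) = const_germ (act g x) c"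
  using mero_push_const_germ[OF automorphism_act[of "inv\<^bsub>G\<^esub> g"], of "act g x"] assms
  by (simp add: gact_def)

lemma tau_one:
  assumes "x \<in> carrier V" "a \<in> carrier (mero V x)"
  shows "tau \<one>\<^bsub>V\<^esub> x a = a"
  using mero_push_cong[of "\<lambda>y. inv\<^bsub>V\<^esub> \<one>\<^bsub>V\<^esub> \<otimes>\<^bsub>V\<^esub> y" "\<lambda>y. y" x] mero_push_id assms
  by (simp add: translate_def)

lemma gam_one:
  assumes "x \<in> carrier V" "a \<in> carrier (mero V x)"
  shows "gam \<one>\<^bsub>G\<^esub> x a = a"
  using mero_push_cong[of "act (inv\<^bsub>G\<^esub> \<one>\<^bsub>G\<^esub>)" "\<lambda>y. y" x] mero_push_id assms
  by (simp add: gact_def)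

text \<open>
  The three rules \<open>tau_tau\<close>, \<open>gam_gam\<close> and \<open>gam_tau\<close> say that the semidirect product of \<open>G\<close> and \<open>V\<close>
  acts on germs, an element \<open>\<xi>\<close> of \<open>V\<close> by the translation \<open>\<phi>\<^sub>\<xi>\<close>. They come from the corresponding
  identities between maps of the space.
\<close>

lemma tau_tau:
  assumes "\<xi> \<in> carrier V" "\<eta> \<in> carrier V" "x \<in> carrier V" "a \<in> carrier (mero V x)"
  shows "tau \<xi> (\<eta> \<otimes>\<^bsub>V\<^esub> x) (tau \<eta> x a) = tau (\<xi> \<otimes>\<^bsub>V\<^esub> \<eta>) x a"
proof -
  have "tau \<xi> (\<eta> \<otimes>\<^bsub>V\<^esub> x) (tau \<eta> x a)
    = mero_push V (\<lambda>y. inv\<^bsub>V\<^esub> \<eta> \<otimes>\<^bsub>V\<^esub> (inv\<^bsub>V\<^esub> \<xi> \<otimes>\<^bsub>V\<^esub> y)) (\<xi> \<otimes>\<^bsub>V\<^esub> (\<eta> \<otimes>\<^bsub>V\<^esub> x)) a"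
    using mero_push_mero_push[OF automorphism_translation[of "inv\<^bsub>V\<^esub> \<xi>"]
        automorphism_translation[of "inv\<^bsub>V\<^esub> \<eta>"], of "\<xi> \<otimes>\<^bsub>V\<^esub> (\<eta> \<otimes>\<^bsub>V\<^esub> x)" a] assms
    by (simp add: translate_def)
  also have "mero_push V (\<lambda>y. inv\<^bsub>V\<^esub> \<eta> \<otimes>\<^bsub>V\<^esub> (inv\<^bsub>V\<^esub> \<xi> \<otimes>\<^bsub>V\<^esub> y)) (\<xi> \<otimes>\<^bsub>V\<^esub> (\<eta> \<otimes>\<^bsub>V\<^esub> x))
    = mero_push V (\<lambda>y. inv\<^bsub>V\<^esub> (\<xi> \<otimes>\<^bsub>V\<^esub> \<eta>) \<otimes>\<^bsub>V\<^esub> y) (\<xi> \<otimes>\<^bsub>V\<^esub> (\<eta> \<otimes>\<^bsub>V\<^esub> x))"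
    by (rule mero_push_cong) (use assms in \<open>simp_all add: V.inv_mult_group V.m_assoc\<close>)
  finally show ?thesis using assms by (simp add: translate_def V.m_assoc)
qed

lemma gam_gam:
  assumes "g \<in> carrier G" "h \<in> carrier G" "x \<in> carrier V" "a \<in> carrier (mero V x)"
  shows "gam g (act h x) (gam h x a) = gam (g \<otimes>\<^bsub>G\<^esub> h) x a"
proof -
  have "gam g (act h x) (gam h x a)
    = mero_push V (\<lambda>y. act (inv\<^bsub>G\<^esub> h) (act (inv\<^bsub>G\<^esub> g) y)) (act g (act h x)) a"
    using mero_push_mero_push[OF automorphism_act[of "inv\<^bsub>G\<^esub> g"]
        automorphism_act[of "inv\<^bsub>G\<^esub> h"], of "act g (act h x)" a] assms
    by (simp add: gact_def)
  also have "mero_push V (\<lambda>y. act (inv\<^bsub>G\<^esub> h) (act (inv\<^bsub>G\<^esub> g) y)) (act g (act h x))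
    = mero_push V (act (inv\<^bsub>G\<^esub> (g \<otimes>\<^bsub>G\<^esub> h))) (act g (act h x))"
    by (rule mero_push_cong) (use assms in \<open>simp_all add: G.inv_mult_group act_comp\<close>)
  finally show ?thesis using assms by (simp add: gact_def act_comp)
qed

lemma gam_tau:
  assumes "g \<in> carrier G" "\<xi> \<in> carrier V" "x \<in> carrier V" "a \<in> carrier (mero V x)"
  shows "gam g (\<xi> \<otimes>\<^bsub>V\<^esub> x) (tau \<xi> x a) = tau (act g \<xi>) (act g x) (gam g x a)"
proof -
  have "gam g (\<xi> \<otimes>\<^bsub>V\<^esub> x) (tau \<xi> x a)
    = mero_push V (\<lambda>y. inv\<^bsub>V\<^esub> \<xi> \<otimes>\<^bsub>V\<^esub> act (inv\<^bsub>G\<^esub> g) y) (act g (\<xi> \<otimes>\<^bsub>V\<^esub> x)) a"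
    using mero_push_mero_push[OF automorphism_act[of "inv\<^bsub>G\<^esub> g"]
        automorphism_translation[of "inv\<^bsub>V\<^esub> \<xi>"], of "act g (\<xi> \<otimes>\<^bsub>V\<^esub> x)" a] assms
    by (simp add: translate_def gact_def)
  also have "mero_push V (\<lambda>y. inv\<^bsub>V\<^esub> \<xi> \<otimes>\<^bsub>V\<^esub> act (inv\<^bsub>G\<^esub> g) y) (act g (\<xi> \<otimes>\<^bsub>V\<^esub> x))
    = mero_push V (\<lambda>y. act (inv\<^bsub>G\<^esub> g) (inv\<^bsub>V\<^esub> act g \<xi> \<otimes>\<^bsub>V\<^esub> y)) (act g (\<xi> \<otimes>\<^bsub>V\<^esub> x))"
    by (rule mero_push_cong) (use assms in \<open>simp_all add: act_mult flip: act_inv\<close>)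
  also have "\<dots> a = tau (act g \<xi>) (act g x) (gam g x a)"
    using mero_push_mero_push[OF automorphism_translation[of "inv\<^bsub>V\<^esub> act g \<xi>"]
        automorphism_act[of "inv\<^bsub>G\<^esub> g"], of "act g (\<xi> \<otimes>\<^bsub>V\<^esub> x)" a] assms
    by (simp add: translate_def gact_def act_mult)
  finally show ?thesis .
qed

lemmas tau_closed = Ring.ring_hom_closed[OF tau_hom]
  and tau_mult = Ring.ring_hom_mult[OF tau_hom]
  and tau_add = Ring.ring_hom_add[OF tau_hom]
  and gam_closed = Ring.ring_hom_closed[OF gam_hom]
  and gam_mult = Ring.ring_hom_mult[OF gam_hom]
  and gam_add = Ring.ring_hom_add[OF gam_hom]

lemma ring_mero: "x \<in> carrier V \<Longrightarrow> ring (mero V x)"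
  by (rule cring.axioms(1)[OF cring_mero])

lemma tau_zero: "\<xi> \<in> carrier V \<Longrightarrow> x \<in> carrier V \<Longrightarrow> tau \<xi> x \<zero>\<^bsub>mero V x\<^esub> = \<zero>\<^bsub>mero V (\<xi> \<otimes>\<^bsub>V\<^esub> x)\<^esub>"
  by (rule Ring.ring_hom_zero[OF tau_hom]) (simp_all add: ring_mero)

lemma gam_zero: "g \<in> carrier G \<Longrightarrow> x \<in> carrier V \<Longrightarrow> gam g x \<zero>\<^bsub>mero V x\<^esub> = \<zero>\<^bsub>mero V (act g x)\<^esub>"
  by (rule Ring.ring_hom_zero[OF gam_hom]) (simp_all add: ring_mero)

lemma gam_finsum:
  assumes "g \<in> carrier G" "x \<in> carrier V" "f \<in> S \<rightarrow> carrier (mero V x)"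
  shows "gam g x (finsum (mero V x) f S) = (\<Oplus>\<^bsub>mero V (act g x)\<^esub>i\<in>S. gam g x (f i))"
proof -
  interpret h: ring_hom_cring "mero V x" "mero V (act g x)" "gam g x"
    by (intro ring_hom_cring.intro ring_hom_cring_axioms.intro cring_mero gam_hom act_closed assms)
  show ?thesis using h.hom_finsum[OF assms(3)] by (simp add: comp_def)
qed

lemma hol_simps [simp]:
  "\<zero>\<^bsub>hol V x\<^esub> = \<zero>\<^bsub>mero V x\<^esub>" "\<one>\<^bsub>hol V x\<^esub> = \<one>\<^bsub>mero V x\<^esub>"
  "a \<oplus>\<^bsub>hol V x\<^esub> b = a \<oplus>\<^bsub>mero V x\<^esub> b" "a \<otimes>\<^bsub>hol V x\<^esub> b = a \<otimes>\<^bsub>mero V x\<^esub> b"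
  by (simp_all add: hol_def)

lemma hol_mero: "x \<in> carrier V \<Longrightarrow> a \<in> carrier (hol V x) \<Longrightarrow> a \<in> carrier (mero V x)"
  using subringE(1)[OF subring_hol] by blast

lemmas hol_closed = subringE(2,3,6,7)[OF subring_hol]

lemma cring_hol: "x \<in> carrier V \<Longrightarrow> cring (hol V x)"
  using ring.subcring_iff[OF ring_mero subringE(1)[OF subring_hol]]
    cring.subcringI'[OF cring_mero subring_hol]
  by (subst hol_eq_mero) simp

end

section \<open>Families of germs and averaging\<close>

locale invariant_subset = group_with_finite_action V G act
  for V :: "'a space_group" and G :: "'g monoid" and act +
  fixes W :: "'a set"
  assumes W_subset: "W \<subseteq> carrier V"
    and W_stable: "\<And>g x. g \<in> carrier G \<Longrightarrow> x \<in> W \<Longrightarrow> act g x \<in> W"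
begin

lemma act_W_iff: "g \<in> carrier G \<Longrightarrow> x \<in> carrier V \<Longrightarrow> act g x \<in> W \<longleftrightarrow> x \<in> W"
  using W_stable[of g x] W_stable[of "inv\<^bsub>G\<^esub> g" "act g x"] by auto

text \<open>
  Equivariance on each orbit separately, for the family cut off outside this orbit, amounts to
  equivariance at all points: different orbits do not interact, and outside of \<open>W\<close> the family is
  zero.
\<close>

lemma carrier_invariant_sum:
  assumes grp: "\<And>x. x \<in> carrier V \<Longrightarrow> group (add_monoid (R x))"
    and zero: "\<And>g x. g \<in> carrier G \<Longrightarrow> x \<in> carrier V \<Longrightarrow> \<sigma> g x \<zero>\<^bsub>R x\<^esub> = \<zero>\<^bsub>R (act g x)\<^esub>"
  shows "F \<in> carrier (invariant_sum V G act R \<sigma> W) \<longleftrightarrow>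
    F \<in> (\<Pi>\<^sub>E x\<in>carrier V. carrier (R x)) \<and> finite {x \<in> carrier V. F x \<noteq> \<zero>\<^bsub>R x\<^esub>} \<and>
    (\<forall>x\<in>carrier V - W. F x = \<zero>\<^bsub>R x\<^esub>) \<and>
    (\<forall>g\<in>carrier G. \<forall>x\<in>carrier V. F (act g x) = \<sigma> g x (F x))"
    (is "_ \<longleftrightarrow> ?rhs")
proof -
  have ps: "F \<in> carrier (point_sum V R) \<longleftrightarrow>
      F \<in> (\<Pi>\<^sub>E x\<in>carrier V. carrier (R x)) \<and> finite {x \<in> carrier V. F x \<noteq> \<zero>\<^bsub>R x\<^esub>}" for F
    using grp by (simp add: point_sum_def carrier_sum_group)
  have zero_closed: "\<zero>\<^bsub>R x\<^esub> \<in> carrier (R x)" if "x \<in> carrier V" for x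
    using group.is_monoid[OF grp[OF that]] monoid.one_closed by fastforce
  have orbit_stable: "act g x \<in> T" if T: "T \<in> orbits G W act" "x \<in> T" and g: "g \<in> carrier G" for T g x
  proof -
    obtain y h where y: "y \<in> W" "T = orbit G act y" "h \<in> carrier G" "x = act h y"
      using T by (auto simp: orbits_def orbit_def)
    then have "act g x = act (g \<otimes>\<^bsub>G\<^esub> h) y" using g W_subset by (auto simp: act_comp)
    then show ?thesis using y g by (auto simp: orbit_def)
  qed
  have orbit_sub: "T \<subseteq> W" if "T \<in> orbits G W act" for T
    using that W_stable by (auto simp: orbits_def orbit_def)
  show ?thesis
  proof
    assume F: "F \<in> carrier (invariant_sum V G act R \<sigma> W)"
    then have F1: "F \<in> carrier (point_sum V R)" "\<forall>x\<in>carrier V - W. F x = \<zero>\<^bsub>R x\<^esub>"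
      by (auto simp: invariant_sum_def)
    have "F (act g x) = \<sigma> g x (F x)" if g: "g \<in> carrier G" and x: "x \<in> carrier V" for g x
    proof (cases "x \<in> W")
      case True
      define T where "T = orbit G act x"
      have T: "T \<in> orbits G W act" using True by (auto simp: T_def orbits_def)
      have "\<exists>h\<in>carrier G. act h x = x" using x act_one by blast
      then have xT: "x \<in> T" unfolding T_def orbit_def by (metis (mono_tags, lifting) mem_Collect_eq)
      have "(\<lambda>x\<in>carrier V. if x \<in> T then F x else \<zero>\<^bsub>R x\<^esub>) \<in> orbit_invariants V G act R \<sigma> T"
        using F T by (auto simp: invariant_sum_def)
      then have "(\<lambda>x\<in>carrier V. if x \<in> T then F x else \<zero>\<^bsub>R x\<^esub>) (act g x)
          = \<sigma> g x ((\<lambda>x\<in>carrier V. if x \<in> T then F x else \<zero>\<^bsub>R x\<^esub>) x)"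
        using g xT by (auto simp: orbit_invariants_def)
      then show ?thesis using orbit_stable[OF T xT g] xT g x by simp
    next
      case False
      then show ?thesis using F1(2) g x by (simp add: zero act_W_iff)
    qed
    then show ?rhs using F1 ps by blast
  next
    assume F: ?rhs
    have "(\<lambda>x\<in>carrier V. if x \<in> T then F x else \<zero>\<^bsub>R x\<^esub>) \<in> orbit_invariants V G act R \<sigma> T"
      if T: "T \<in> orbits G W act" for T
    proof -
      let ?F = "\<lambda>x\<in>carrier V. if x \<in> T then F x else \<zero>\<^bsub>R x\<^esub>"
      have "finite {x \<in> carrier V. ?F x \<noteq> \<zero>\<^bsub>R x\<^esub>}"
        by (rule finite_subset[of _ "{x \<in> carrier V. F x \<noteq> \<zero>\<^bsub>R x\<^esub>}"]) (use F in auto)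
      moreover have "?F \<in> (\<Pi>\<^sub>E x\<in>carrier V. carrier (R x))"
        using F zero_closed by (auto simp: PiE_iff)
      moreover have "?F (act g x) = \<sigma> g x (?F x)" if "g \<in> carrier G" "x \<in> T" for g x
        using that orbit_stable[OF T that(2,1)] orbit_sub[OF T] W_subset F by auto
      ultimately show ?thesis by (auto simp: orbit_invariants_def ps)
    qed
    then show "F \<in> carrier (invariant_sum V G act R \<sigma> W)"
      using F ps by (auto simp: invariant_sum_def)
  qed
qed

definition families :: "('a \<Rightarrow> 'a mgerm) set" where
  "families = (\<Pi>\<^sub>E x\<in>carrier V. carrier (mero V x))"

definition finite_families :: "('a \<Rightarrow> 'a mgerm) set" where
  "finite_families = {F \<in> (\<Pi>\<^sub>E x\<in>carrier V. carrier (hol V x)).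
     finite {x \<in> carrier V. F x \<noteq> \<zero>\<^bsub>mero V x\<^esub>} \<and> (\<forall>x\<in>carrier V - W. F x = \<zero>\<^bsub>mero V x\<^esub>)}"

definition family_add (infixl "\<boxplus>" 65) where
  "F \<boxplus> F' = (\<lambda>x\<in>carrier V. F x \<oplus>\<^bsub>mero V x\<^esub> F' x)"

definition family_mult (infixl "\<boxdot>" 70) where
  "F \<boxdot> F' = (\<lambda>x\<in>carrier V. F x \<otimes>\<^bsub>mero V x\<^esub> F' x)"

definition family_zero :: "'a \<Rightarrow> 'a mgerm" where
  "family_zero = (\<lambda>x\<in>carrier V. \<zero>\<^bsub>mero V x\<^esub>)"

lemma family_apply [simp]:
  "x \<in> carrier V \<Longrightarrow> (F \<boxplus> F') x = F x \<oplus>\<^bsub>mero V x\<^esub> F' x"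
  "x \<in> carrier V \<Longrightarrow> (F \<boxdot> F') x = F x \<otimes>\<^bsub>mero V x\<^esub> F' x"
  "x \<in> carrier V \<Longrightarrow> family_zero x = \<zero>\<^bsub>mero V x\<^esub>"
  by (simp_all add: family_add_def family_mult_def family_zero_def)

lemma family_outside [simp]:
  "x \<notin> carrier V \<Longrightarrow> (F \<boxplus> F') x = undefined"
  "x \<notin> carrier V \<Longrightarrow> (F \<boxdot> F') x = undefined"
  "x \<notin> carrier V \<Longrightarrow> family_zero x = undefined"
  by (simp_all add: family_add_def family_mult_def family_zero_def)

definition point_family :: "'a \<Rightarrow> 'a mgerm \<Rightarrow> 'a \<Rightarrow> 'a mgerm" where
  "point_family x a = (\<lambda>y\<in>carrier V. if y = x then a else \<zero>\<^bsub>mero V y\<^esub>)"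

text \<open>
  The translation-invariant family with germ \<open>p\<close> at the identity.
\<close>

definition constant_family :: "'a mgerm \<Rightarrow> 'a \<Rightarrow> 'a mgerm" where
  "constant_family p = (\<lambda>x\<in>carrier V. tau x \<one>\<^bsub>V\<^esub> p)"

abbreviation shifted :: "('a \<Rightarrow> 'a mgerm) \<Rightarrow> 'g \<Rightarrow> 'a \<Rightarrow> 'a mgerm" where
  "shifted F g x \<equiv> gam g (act (inv\<^bsub>G\<^esub> g) x) (F (act (inv\<^bsub>G\<^esub> g) x))"

definition average :: "('a \<Rightarrow> 'a mgerm) \<Rightarrow> 'a \<Rightarrow> 'a mgerm" where
  "average F = (\<lambda>x\<in>carrier V. const_germ x (1 / of_nat (card (carrier G))) \<otimes>\<^bsub>mero V x\<^esub>
     (\<Oplus>\<^bsub>mero V x\<^esub>g\<in>carrier G. shifted F g x))"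

abbreviation "\<O> \<equiv> O_sum V G act W"

lemma group_add_hol: "x \<in> carrier V \<Longrightarrow> group (add_monoid (hol V x))"
  by (rule abelian_group.a_group[OF ring.is_abelian_group[OF cring.axioms(1)[OF cring_hol]]])

lemma carrier_O:
  "F \<in> carrier \<O> \<longleftrightarrow> F \<in> finite_families \<and>
     (\<forall>g\<in>carrier G. \<forall>x\<in>carrier V. F (act g x) = gam g x (F x))"
proof -
  have "F \<in> carrier \<O> \<longleftrightarrow> F \<in> (\<Pi>\<^sub>E x\<in>carrier V. carrier (hol V x)) \<and>
    finite {x \<in> carrier V. F x \<noteq> \<zero>\<^bsub>hol V x\<^esub>} \<and> (\<forall>x\<in>carrier V - W. F x = \<zero>\<^bsub>hol V x\<^esub>) \<and>
    (\<forall>g\<in>carrier G. \<forall>x\<in>carrier V. F (act g x) = gam g x (F x))"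
    unfolding O_sum_def
    by (rule carrier_invariant_sum[OF group_add_hol]) (simp_all add: gam_zero)
  then show ?thesis by (auto simp: finite_families_def)
qed

lemma O_mult: "F \<otimes>\<^bsub>\<O>\<^esub> F' = F \<boxplus> F'"
  by (simp add: O_sum_def invariant_sum_def point_sum_def family_add_def)

lemma O_one: "\<one>\<^bsub>\<O>\<^esub> = family_zero"
  by (simp add: O_sum_def invariant_sum_def point_sum_def family_zero_def)

lemma families_closed: "F \<in> families \<Longrightarrow> x \<in> carrier V \<Longrightarrow> F x \<in> carrier (mero V x)"
  by (auto simp: families_def)

lemma finite_families_hol: "F \<in> finite_families \<Longrightarrow> x \<in> carrier V \<Longrightarrow> F x \<in> carrier (hol V x)"
  by (auto simp: finite_families_def)

lemma finite_families_families: "F \<in> finite_families \<Longrightarrow> F \<in> families"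
  by (auto simp: finite_families_def families_def intro: hol_mero)

lemma O_finite_families: "F \<in> carrier \<O> \<Longrightarrow> F \<in> finite_families"
  and O_equivariant: "F \<in> carrier \<O> \<Longrightarrow> g \<in> carrier G \<Longrightarrow> x \<in> carrier V \<Longrightarrow> F (act g x) = gam g x (F x)"
  by (simp_all add: carrier_O)

lemma family_zero_finite: "family_zero \<in> finite_families"
  by (auto simp: finite_families_def family_zero_def hol_closed)

lemma family_add_closed: "F \<in> families \<Longrightarrow> F' \<in> families \<Longrightarrow> F \<boxplus> F' \<in> families"
  by (auto simp: families_def family_add_def PiE_iff intro!: cring.cring_simprules(1) cring_mero)

lemma family_mult_closed: "F \<in> families \<Longrightarrow> F' \<in> families \<Longrightarrow> F \<boxdot> F' \<in> families"
  by (auto simp: families_def family_mult_def PiE_iff intro!: cring.cring_simprules(5) cring_mero)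

lemma family_add_finite:
  assumes F: "F \<in> finite_families" "F' \<in> finite_families"
  shows "F \<boxplus> F' \<in> finite_families"
proof -
  have z: "\<zero>\<^bsub>mero V x\<^esub> \<oplus>\<^bsub>mero V x\<^esub> \<zero>\<^bsub>mero V x\<^esub> = \<zero>\<^bsub>mero V x\<^esub>" if "x \<in> carrier V" for x
    using cring_mero[OF that] cring.cring_simprules(2,8) by metis
  have "finite {x \<in> carrier V. (F \<boxplus> F') x \<noteq> \<zero>\<^bsub>mero V x\<^esub>}"
    by (rule finite_subset[of _ "{x \<in> carrier V. F x \<noteq> \<zero>\<^bsub>mero V x\<^esub>} \<union> {x \<in> carrier V. F' x \<noteq> \<zero>\<^bsub>mero V x\<^esub>}"])
      (use F z in \<open>auto simp: finite_families_def family_add_def\<close>)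
  then show ?thesis
    using F z by (auto simp: finite_families_def family_add_def PiE_iff hol_closed W_subset)
qed

lemma family_mult_finite:
  assumes P: "\<And>x. x \<in> carrier V \<Longrightarrow> P x \<in> carrier (hol V x)" and F: "F \<in> finite_families"
  shows "P \<boxdot> F \<in> finite_families"
proof -
  have z: "P x \<otimes>\<^bsub>mero V x\<^esub> \<zero>\<^bsub>mero V x\<^esub> = \<zero>\<^bsub>mero V x\<^esub>" if "x \<in> carrier V" for x
    using cring.cring_simprules(27)[OF cring_mero[OF that]] hol_mero[OF that P[OF that]] by simp
  have "finite {x \<in> carrier V. (P \<boxdot> F) x \<noteq> \<zero>\<^bsub>mero V x\<^esub>}"
    by (rule finite_subset[of _ "{x \<in> carrier V. F x \<noteq> \<zero>\<^bsub>mero V x\<^esub>}"])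
      (use F z in \<open>auto simp: finite_families_def family_mult_def\<close>)
  then show ?thesis
    using F z P by (auto simp: finite_families_def family_mult_def PiE_iff hol_closed)
qed

lemma constant_family_hol:
  "p \<in> carrier hol1 \<Longrightarrow> x \<in> carrier V \<Longrightarrow> constant_family p x \<in> carrier (hol V x)"
  using tau_hol[of x "\<one>\<^bsub>V\<^esub>" p] by (simp add: constant_family_def)

lemma constant_family_in: "p \<in> carrier hol1 \<Longrightarrow> constant_family p \<in> families"
  using constant_family_hol[of p] hol_mero by (auto simp: families_def constant_family_def)

text \<open>
  Since \<open>g \<cdot> \<phi>\<^sub>x(p) = \<phi>\<^bsub>g\<cdot>x\<^esub>(g \<cdot> p)\<close>, invariance of the single germ \<open>p\<close> suffices.
\<close>

lemma constant_family_equivariant: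
  assumes "p \<in> carrier hol1" "\<And>g. g \<in> carrier G \<Longrightarrow> gam g \<one>\<^bsub>V\<^esub> p = p"
    and "g \<in> carrier G" "x \<in> carrier V"
  shows "constant_family p (act g x) = gam g x (constant_family p x)"
  using gam_tau[of g x "\<one>\<^bsub>V\<^esub>" p] assms hol_mero by (simp add: constant_family_def)

lemma O_group: "group \<O>"
proof (rule groupI)
  fix F F' assume F: "F \<in> carrier \<O>" "F' \<in> carrier \<O>"
  have "(F \<boxplus> F') (act g x) = gam g x ((F \<boxplus> F') x)" if "g \<in> carrier G" "x \<in> carrier V" for g x
    using that F[THEN O_equivariant] F[THEN O_finite_families, THEN finite_families_families, THEN families_closed]
    by (simp add: gam_add)
  then show "F \<otimes>\<^bsub>\<O>\<^esub> F' \<in> carrier \<O>"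
    using F by (simp add: O_mult carrier_O family_add_finite)
next
  show "\<one>\<^bsub>\<O>\<^esub> \<in> carrier \<O>"
    by (simp add: O_one carrier_O family_zero_finite gam_zero)
  note cl = O_finite_families[THEN finite_families_families, THEN families_closed]
  fix F assume F: "F \<in> carrier \<O>"
  show "\<one>\<^bsub>\<O>\<^esub> \<otimes>\<^bsub>\<O>\<^esub> F = F"
    using F cl[OF F] cring.cring_simprules(8)[OF cring_mero]
    by (auto simp: O_one O_mult family_add_def family_zero_def carrier_O finite_families_def
        PiE_iff extensional_def fun_eq_iff)
  \<comment> \<open>the negative of \<open>F\<close>, as a product with a family that is known to be equivariant\<close>
  define N where "N = (\<lambda>x. const_germ x (-1)) \<boxdot> F"
  have "N \<in> finite_families"
    unfolding N_def by (rule family_mult_finite) (simp_all add: const_germ_hol O_finite_families F)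
  moreover have "N (act g x) = gam g x (N x)" if "g \<in> carrier G" "x \<in> carrier V" for g x
    using that cl[OF F] const_germ_hol[of x "-1"] hol_mero[of x]
    by (simp add: N_def family_mult_def gam_mult gam_const_germ O_equivariant F)
  ultimately have "N \<in> carrier \<O>" by (simp add: carrier_O)
  moreover have "N x \<oplus>\<^bsub>mero V x\<^esub> F x = \<zero>\<^bsub>mero V x\<^esub>" if x: "x \<in> carrier V" for x
  proof -
    interpret M: cring "mero V x" using x by (rule cring_mero)
    have c: "const_germ x c \<in> carrier (mero V x)" for c
      using x const_germ_hol hol_mero by blast
    have "N x \<oplus>\<^bsub>mero V x\<^esub> F x
        = (const_germ x (-1) \<oplus>\<^bsub>mero V x\<^esub> const_germ x 1) \<otimes>\<^bsub>mero V x\<^esub> F x"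
      using x cl[OF F x] c[of "-1"] by (simp add: N_def family_mult_def M.l_distr const_germ_ops(2)[OF x])
    moreover have "const_germ x (-1) \<oplus>\<^bsub>mero V x\<^esub> const_germ x 1 = \<zero>\<^bsub>mero V x\<^esub>"
      by (simp add: const_germ_ops(1,3)[OF x])
    ultimately show ?thesis using cl[OF F x] by simp
  qed
  ultimately show "\<exists>N\<in>carrier \<O>. N \<otimes>\<^bsub>\<O>\<^esub> F = \<one>\<^bsub>\<O>\<^esub>"
    by (intro bexI[of _ N]) (auto simp: O_one O_mult family_add_def family_zero_def intro: restrict_ext)
next
  note cl = O_finite_families[THEN finite_families_families, THEN families_closed]
  fix F F' F'' assume "F \<in> carrier \<O>" "F' \<in> carrier \<O>" "F'' \<in> carrier \<O>"
  then show "F \<otimes>\<^bsub>\<O>\<^esub> F' \<otimes>\<^bsub>\<O>\<^esub> F'' = F \<otimes>\<^bsub>\<O>\<^esub> (F' \<otimes>\<^bsub>\<O>\<^esub> F'')"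
    using cl cring.cring_simprules(7)[OF cring_mero] by (auto simp: O_mult family_add_def intro: restrict_ext)
qed

subsection \<open>Averaging\<close>

lemma average_term_closed:
  assumes "F \<in> families" "x \<in> carrier V" "g \<in> carrier G"
  shows "shifted F g x \<in> carrier (mero V x)"
  using gam_closed[of g "act (inv\<^bsub>G\<^esub> g) x" "F (act (inv\<^bsub>G\<^esub> g) x)"] families_closed assms by simp

lemma const_germ_mero: "x \<in> carrier V \<Longrightarrow> const_germ x c \<in> carrier (mero V x)"
  by (simp add: const_germ_hol hol_mero)

lemma average_outside: "x \<notin> carrier V \<Longrightarrow> average F x = undefined"
  by (simp add: average_def)

lemma carrier_G_nonempty: "carrier G \<noteq> {}"
  using G.one_closed by blast

lemma average_invariant:
  assumes F: "F \<in> families" and eq: "\<And>g x. g \<in> carrier G \<Longrightarrow> x \<in> carrier V \<Longrightarrow> F (act g x) = gam g x (F x)"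
  shows "average F = F"
proof
  fix x show "average F x = F x"
  proof (cases "x \<in> carrier V")
    case True
    interpret M: cring "mero V x" using True by (rule cring_mero)
    have "(\<Oplus>\<^bsub>mero V x\<^esub>g\<in>carrier G. shifted F g x)
        = (\<Oplus>\<^bsub>mero V x\<^esub>g\<in>carrier G. F x)"
      by (rule M.finsum_cong') (use True F in \<open>auto simp: families_closed simp flip: eq\<close>)
    then show ?thesis
      using True const_germ_average[OF True finite_G carrier_G_nonempty families_closed[OF F True]]
      by (simp add: average_def)
  next
    case False
    then show ?thesis using F by (auto simp: average_def families_def PiE_iff extensional_def)
  qed
qed

lemma average_add:
  assumes F: "F \<in> families" "F' \<in> families"
  shows "average (F \<boxplus> F') = average F \<boxplus> average F'"
proof -
  have "average (F \<boxplus> F') x = average F x \<oplus>\<^bsub>mero V x\<^esub> average F' x" if x: "x \<in> carrier V" for x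
  proof -
    interpret M: cring "mero V x" using x by (rule cring_mero)
    note cl = average_term_closed[OF F(1) x] average_term_closed[OF F(2) x]
    have "shifted (F \<boxplus> F') g x
      = shifted F g x \<oplus>\<^bsub>mero V x\<^esub>
        shifted F' g x" if "g \<in> carrier G" for g
      using gam_add[of g "act (inv\<^bsub>G\<^esub> g) x"] that x F by (simp add: family_add_def families_closed)
    then have "(\<Oplus>\<^bsub>mero V x\<^esub>g\<in>carrier G. shifted (F \<boxplus> F') g x)
      = (\<Oplus>\<^bsub>mero V x\<^esub>g\<in>carrier G. shifted F g x \<oplus>\<^bsub>mero V x\<^esub>
        shifted F' g x)"
      by (intro M.finsum_cong') (auto simp: cl)
    also have "\<dots> = (\<Oplus>\<^bsub>mero V x\<^esub>g\<in>carrier G. shifted F g x) \<oplus>\<^bsub>mero V x\<^esub>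
       (\<Oplus>\<^bsub>mero V x\<^esub>g\<in>carrier G. shifted F' g x)"
      by (rule M.finsum_addf) (auto simp: cl)
    finally show ?thesis
      using x cl by (simp add: average_def M.r_distr const_germ_mero M.finsum_closed)
  qed
  then show ?thesis
    by (intro ext, rename_tac x, case_tac "x \<in> carrier V") (simp_all add: average_outside)
qed

text \<open>
  An equivariant factor is the same in all summands of the average: transported from \<open>g\<inverse> \<cdot> x\<close> to \<open>x\<close>
  by \<open>g\<close>, its germ is the one at \<open>x\<close>.
\<close>

lemma average_mult:
  assumes P: "P \<in> families" "\<And>g x. g \<in> carrier G \<Longrightarrow> x \<in> carrier V \<Longrightarrow> P (act g x) = gam g x (P x)"
    and F: "F \<in> families"
  shows "average (P \<boxdot> F) = P \<boxdot> average F"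
proof -
  have "average (P \<boxdot> F) x = P x \<otimes>\<^bsub>mero V x\<^esub> average F x" if x: "x \<in> carrier V" for x
  proof -
    interpret M: cring "mero V x" using x by (rule cring_mero)
    note cl = average_term_closed[OF F x]
    have "shifted (P \<boxdot> F) g x
      = P x \<otimes>\<^bsub>mero V x\<^esub> shifted F g x" if "g \<in> carrier G" for g
      using gam_mult[of g "act (inv\<^bsub>G\<^esub> g) x"] P(2)[of g "act (inv\<^bsub>G\<^esub> g) x"] that x F P(1)
      by (simp add: family_mult_def families_closed)
    then have "(\<Oplus>\<^bsub>mero V x\<^esub>g\<in>carrier G. shifted (P \<boxdot> F) g x)
      = (\<Oplus>\<^bsub>mero V x\<^esub>g\<in>carrier G. P x \<otimes>\<^bsub>mero V x\<^esub> shifted F g x)"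
      by (intro M.finsum_cong') (auto simp: cl families_closed P x)
    also have "\<dots> = P x \<otimes>\<^bsub>mero V x\<^esub> (\<Oplus>\<^bsub>mero V x\<^esub>g\<in>carrier G. shifted F g x)"
      by (rule M.finsum_rdistr[symmetric]) (auto simp: cl finite_G families_closed P x)
    finally show ?thesis
      using x cl by (simp add: average_def M.m_lcomm const_germ_mero M.finsum_closed families_closed P)
  qed
  then show ?thesis
    by (intro ext, rename_tac x, case_tac "x \<in> carrier V") (simp_all add: average_outside)
qed

text \<open>
  The average is supported on the finitely many translates of the support. It is equivariant
  because \<open>h\<close> takes the summand of \<open>g\<close> at \<open>x\<close> to the summand of \<open>h g\<close> at \<open>h \<cdot> x\<close>, and left
  multiplication by \<open>h\<close> permutes \<open>G\<close>.
\<close>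

lemma average_O:
  assumes F: "F \<in> finite_families"
  shows "average F \<in> carrier \<O>"
  unfolding carrier_O
proof (intro conjI ballI)
  note Ff = finite_families_families[OF F]
  define supp where "supp = {x \<in> carrier V. F x \<noteq> \<zero>\<^bsub>mero V x\<^esub>}"
  have hol: "average F x \<in> carrier (hol V x)" if x: "x \<in> carrier V" for x
  proof -
    interpret M: cring "mero V x" using x by (rule cring_mero)
    have "(\<Oplus>\<^bsub>mero V x\<^esub>g\<in>carrier G. shifted F g x) \<in> carrier (hol V x)"
    proof (rule M.finsum_mem[OF finite_G subringE(1)[OF subring_hol[OF x]]])
      fix g assume g: "g \<in> carrier G"
      show "shifted F g x \<in> carrier (hol V x)"
        using gam_hol[OF g, of "act (inv\<^bsub>G\<^esub> g) x"] g x finite_families_hol[OF F] by simp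
    qed (use x in \<open>simp_all add: hol_closed\<close>)
    then show ?thesis using x by (simp add: average_def hol_closed const_germ_hol)
  qed
  have vanish: "average F x = \<zero>\<^bsub>mero V x\<^esub>"
    if x: "x \<in> carrier V" and 0: "\<And>g. g \<in> carrier G \<Longrightarrow> act (inv\<^bsub>G\<^esub> g) x \<notin> supp" for x
  proof -
    interpret M: cring "mero V x" using x by (rule cring_mero)
    have "(\<Oplus>\<^bsub>mero V x\<^esub>g\<in>carrier G. shifted F g x)
      = (\<Oplus>\<^bsub>mero V x\<^esub>g\<in>carrier G. \<zero>\<^bsub>mero V x\<^esub>)"
    proof (rule M.finsum_cong')
      fix g assume g: "g \<in> carrier G"
      have "F (act (inv\<^bsub>G\<^esub> g) x) = \<zero>\<^bsub>mero V (act (inv\<^bsub>G\<^esub> g) x)\<^esub>"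
        using 0[OF g] g x by (simp add: supp_def)
      then show "shifted F g x = \<zero>\<^bsub>mero V x\<^esub>"
        using gam_zero[OF g, of "act (inv\<^bsub>G\<^esub> g) x"] g x by simp
    qed auto
    then show ?thesis using x by (simp add: average_def const_germ_mero)
  qed
  have "{x \<in> carrier V. average F x \<noteq> \<zero>\<^bsub>mero V x\<^esub>} \<subseteq> (\<Union>g\<in>carrier G. act g ` supp)"
  proof
    fix x assume x: "x \<in> {x \<in> carrier V. average F x \<noteq> \<zero>\<^bsub>mero V x\<^esub>}"
    then obtain g where g: "g \<in> carrier G" "act (inv\<^bsub>G\<^esub> g) x \<in> supp" using vanish by blast
    have "x = act g (act (inv\<^bsub>G\<^esub> g) x)" using g x by simp
    then show "x \<in> (\<Union>g\<in>carrier G. act g ` supp)" using g by blast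
  qed
  moreover have "finite (\<Union>g\<in>carrier G. act g ` supp)"
    using finite_G F by (simp add: supp_def finite_families_def)
  ultimately have "finite {x \<in> carrier V. average F x \<noteq> \<zero>\<^bsub>mero V x\<^esub>}" by (rule finite_subset)
  moreover have "average F x = \<zero>\<^bsub>mero V x\<^esub>" if "x \<in> carrier V - W" for x
    by (rule vanish) (use that F in \<open>auto simp: supp_def finite_families_def act_W_iff\<close>)
  ultimately show "average F \<in> finite_families"
    using hol by (auto simp: finite_families_def average_def)
  fix h x assume h: "h \<in> carrier G" and x: "x \<in> carrier V"
  note hx = act_closed[OF h x]
  interpret M: cring "mero V x" using x by (rule cring_mero)
  interpret N: cring "mero V (act h x)" using hx by (rule cring_mero)
  define T where "T k = shifted F k (act h x)" for k
  have T: "T k \<in> carrier (mero V (act h x))" if "k \<in> carrier G" for k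
    unfolding T_def by (rule average_term_closed[OF Ff hx that])
  have hT: "gam h x (shifted F g x) = T (h \<otimes>\<^bsub>G\<^esub> g)"
    if g: "g \<in> carrier G" for g
  proof -
    have "act (inv\<^bsub>G\<^esub> (h \<otimes>\<^bsub>G\<^esub> g)) (act h x) = act (inv\<^bsub>G\<^esub> g) x"
      using g h x by (simp add: G.inv_mult_group act_comp)
    then show ?thesis
      using gam_gam[OF h g, of "act (inv\<^bsub>G\<^esub> g) x" "F (act (inv\<^bsub>G\<^esub> g) x)"] g x Ff
      by (simp add: T_def families_closed)
  qed
  note cl = average_term_closed[OF Ff x]
  have "gam h x (\<Oplus>\<^bsub>mero V x\<^esub>g\<in>carrier G. shifted F g x)
    = (\<Oplus>\<^bsub>mero V (act h x)\<^esub>g\<in>carrier G. gam h x (shifted F g x))"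
    by (rule gam_finsum[OF h x]) (use cl in auto)
  also have "\<dots> = (\<Oplus>\<^bsub>mero V (act h x)\<^esub>g\<in>carrier G. T (h \<otimes>\<^bsub>G\<^esub> g))"
    by (rule N.finsum_cong') (use hT T h in auto)
  also have "\<dots> = finsum (mero V (act h x)) T ((\<lambda>g. h \<otimes>\<^bsub>G\<^esub> g) ` carrier G)"
    by (rule N.finsum_reindex[symmetric]) (use T h in \<open>auto simp: G.inj_on_cmult\<close>)
  also have "(\<lambda>g. h \<otimes>\<^bsub>G\<^esub> g) ` carrier G = carrier G"
    by (rule G.surj_const_mult[OF h])
  finally show "average F (act h x) = gam h x (average F x)"
    using h x hx cl
    by (simp add: average_def gam_mult gam_const_germ const_germ_mero M.finsum_closed T_def)
qed

end

section \<open>The ideals defining the quotients\<close>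

context group_with_finite_action
begin

abbreviation "J \<equiv> J_e V G act"
abbreviation "invh x \<equiv> inv_hol V G act (stabilizer G act x) x"
abbreviation "J_gens \<equiv> carrier (inv_hol V G act (carrier G) \<one>\<^bsub>V\<^esub>) \<inter> vanishing_germs V \<one>\<^bsub>V\<^esub>"

lemma J_gens: "p \<in> J_gens \<Longrightarrow> p \<in> carrier hol1"
  "p \<in> J_gens \<Longrightarrow> g \<in> carrier G \<Longrightarrow> gam g \<one>\<^bsub>V\<^esub> p = p"
  by (auto simp: inv_hol_def)

lemma ring_hol: "x \<in> carrier V \<Longrightarrow> ring (hol V x)"
  by (rule cring.axioms(1)[OF cring_hol])

lemma J_ideal: "ideal J (hol1)"
  unfolding J_e_def
  by (rule ring.genideal_ideal[OF ring_hol]) (use J_gens in auto)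

lemma J_gens_subset: "J_gens \<subseteq> J"
  unfolding J_e_def
  by (rule ring.genideal_self[OF ring_hol]) (use J_gens in auto)

lemma J_hol: "a \<in> J \<Longrightarrow> a \<in> carrier hol1"
  using ideal.Icarr[OF J_ideal] .

lemma J_zero: "\<zero>\<^bsub>mero1\<^esub> \<in> J"
  using additive_subgroup.zero_closed[OF ideal.axioms(1)[OF J_ideal]] by simp

lemma J_add: "a \<in> J \<Longrightarrow> b \<in> J \<Longrightarrow> a \<oplus>\<^bsub>mero1\<^esub> b \<in> J"
  using additive_subgroup.a_closed[OF ideal.axioms(1)[OF J_ideal]] by simp

lemma J_mult: "a \<in> J \<Longrightarrow> r \<in> carrier hol1 \<Longrightarrow> r \<otimes>\<^bsub>mero1\<^esub> a \<in> J"
  using ideal.I_l_closed[OF J_ideal] by simp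

lemma ideal_of_closed:
  assumes R: "cring R" and I: "I \<subseteq> carrier R" "\<zero>\<^bsub>R\<^esub> \<in> I"
    "\<And>a b. a \<in> I \<Longrightarrow> b \<in> I \<Longrightarrow> a \<oplus>\<^bsub>R\<^esub> b \<in> I"
    "\<And>a r. a \<in> I \<Longrightarrow> r \<in> carrier R \<Longrightarrow> r \<otimes>\<^bsub>R\<^esub> a \<in> I"
  shows "ideal I R"
proof -
  interpret R: cring R by (rule R)
  show ?thesis
  proof (rule idealI)
    show "subgroup I (add_monoid R)"
    proof (rule R.add.subgroupI)
      fix a assume a: "a \<in> I"
      have "(\<ominus>\<^bsub>R\<^esub> \<one>\<^bsub>R\<^esub>) \<otimes>\<^bsub>R\<^esub> a \<in> I" by (rule I(4)[OF a]) simp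
      then show "\<ominus>\<^bsub>R\<^esub> a \<in> I" using a I(1) by (auto simp: R.l_minus)
    qed (use I in auto)
    fix a r assume "a \<in> I" "r \<in> carrier R"
    then show "r \<otimes>\<^bsub>R\<^esub> a \<in> I" "a \<otimes>\<^bsub>R\<^esub> r \<in> I"
      using I(1,4) R.m_comm by (metis subsetD)+
  qed (rule R.ring_axioms)
qed

lemma J_induct:
  assumes I: "I \<subseteq> carrier hol1" "\<zero>\<^bsub>mero1\<^esub> \<in> I"
    "\<And>a b. a \<in> I \<Longrightarrow> b \<in> I \<Longrightarrow> a \<oplus>\<^bsub>mero1\<^esub> b \<in> I"
    "\<And>a r. a \<in> I \<Longrightarrow> r \<in> carrier hol1 \<Longrightarrow> r \<otimes>\<^bsub>mero1\<^esub> a \<in> I"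
    and gens: "J_gens \<subseteq> I"
  shows "J \<subseteq> I"
  unfolding J_e_def
  by (rule ring.genideal_minimal[OF ring_hol ideal_of_closed[OF cring_hol]]) (use I gens in auto)

lemma J_gam:
  assumes g: "g \<in> carrier G" and a: "a \<in> J"
  shows "gam g \<one>\<^bsub>V\<^esub> a \<in> J"
proof -
  have "J \<subseteq> {a \<in> carrier hol1. gam g \<one>\<^bsub>V\<^esub> a \<in> J}"
  proof (rule J_induct)
    show "J_gens \<subseteq> {a \<in> carrier hol1. gam g \<one>\<^bsub>V\<^esub> a \<in> J}"
      using J_gens J_gens_subset g by auto
  next
    fix a r assume "a \<in> {a \<in> carrier hol1. gam g \<one>\<^bsub>V\<^esub> a \<in> J}"
      and r: "r \<in> carrier hol1"
    then show "r \<otimes>\<^bsub>mero1\<^esub> a \<in> {a \<in> carrier hol1. gam g \<one>\<^bsub>V\<^esub> a \<in> J}"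
      using gam_mult[OF g, of "\<one>\<^bsub>V\<^esub>" r a] gam_hol[OF g, of "\<one>\<^bsub>V\<^esub>" r] g
      by (simp add: hol_mero hol_closed J_mult)
  next
    fix a b assume "a \<in> {a \<in> carrier hol1. gam g \<one>\<^bsub>V\<^esub> a \<in> J}"
      "b \<in> {a \<in> carrier hol1. gam g \<one>\<^bsub>V\<^esub> a \<in> J}"
    then show "a \<oplus>\<^bsub>mero1\<^esub> b \<in> {a \<in> carrier hol1. gam g \<one>\<^bsub>V\<^esub> a \<in> J}"
      using gam_add[OF g, of "\<one>\<^bsub>V\<^esub>" a b] g by (simp add: hol_mero hol_closed J_add)
  next
    show "\<zero>\<^bsub>mero1\<^esub> \<in> {a \<in> carrier hol1. gam g \<one>\<^bsub>V\<^esub> a \<in> J}"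
      using gam_zero[OF g, of "\<one>\<^bsub>V\<^esub>"] g by (simp add: hol_closed J_zero)
  qed auto
  then show ?thesis using a by blast
qed

definition pull_back :: "'a \<Rightarrow> 'a mgerm \<Rightarrow> 'a mgerm" where
  "pull_back x = tau (inv\<^bsub>V\<^esub> x) x"

lemma pull_back_hom: "x \<in> carrier V \<Longrightarrow> pull_back x \<in> Ring.ring_hom (mero V x) mero1"
  unfolding pull_back_def using tau_hom[of "inv\<^bsub>V\<^esub> x" x] by simp

lemmas pull_back_mult = Ring.ring_hom_mult[OF pull_back_hom]
  and pull_back_add = Ring.ring_hom_add[OF pull_back_hom]
  and pull_back_closed = Ring.ring_hom_closed[OF pull_back_hom]

lemma pull_back_zero: "x \<in> carrier V \<Longrightarrow> pull_back x \<zero>\<^bsub>mero V x\<^esub> = \<zero>\<^bsub>mero1\<^esub>"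
  by (rule Ring.ring_hom_zero[OF pull_back_hom]) (simp_all add: ring_mero)

lemma pull_back_hol: "x \<in> carrier V \<Longrightarrow> a \<in> carrier (hol V x) \<Longrightarrow> pull_back x a \<in> carrier hol1"
  unfolding pull_back_def using tau_hol[of "inv\<^bsub>V\<^esub> x" x a] by simp

lemma pull_back_tau:
  "x \<in> carrier V \<Longrightarrow> a \<in> carrier mero1 \<Longrightarrow> pull_back x (tau x \<one>\<^bsub>V\<^esub> a) = a"
  unfolding pull_back_def using tau_tau[of "inv\<^bsub>V\<^esub> x" x "\<one>\<^bsub>V\<^esub>" a] tau_one by simp

lemma tau_pull_back:
  "x \<in> carrier V \<Longrightarrow> a \<in> carrier (mero V x) \<Longrightarrow> tau x \<one>\<^bsub>V\<^esub> (pull_back x a) = a"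
  unfolding pull_back_def using tau_tau[of x "inv\<^bsub>V\<^esub> x" x a] tau_one by simp

text \<open>
  The translation of \<open>x\<close> to the identity is conjugated by \<open>g\<close> into the translation of \<open>g \<cdot> x\<close> to the
  identity, and \<open>g\<close> fixes the identity.
\<close>

lemma gam_pull_back:
  "g \<in> carrier G \<Longrightarrow> x \<in> carrier V \<Longrightarrow> a \<in> carrier (mero V x) \<Longrightarrow>
    gam g \<one>\<^bsub>V\<^esub> (pull_back x a) = pull_back (act g x) (gam g x a)"
  unfolding pull_back_def using gam_tau[of g "inv\<^bsub>V\<^esub> x" x a] by (simp add: act_inv)

lemma stabilizerD: "g \<in> stabilizer G act x \<Longrightarrow> g \<in> carrier G" "g \<in> stabilizer G act x \<Longrightarrow> act g x = x"
  by (simp_all add: stabilizer_def)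

lemma invh_iff: "a \<in> carrier (invh x) \<longleftrightarrow> a \<in> carrier (hol V x) \<and> (\<forall>g\<in>stabilizer G act x. gam g x a = a)"
  by (simp add: inv_hol_def)

lemma invh_simps [simp]:
  "\<zero>\<^bsub>invh x\<^esub> = \<zero>\<^bsub>mero V x\<^esub>" "\<one>\<^bsub>invh x\<^esub> = \<one>\<^bsub>mero V x\<^esub>"
  "a \<oplus>\<^bsub>invh x\<^esub> b = a \<oplus>\<^bsub>mero V x\<^esub> b" "a \<otimes>\<^bsub>invh x\<^esub> b = a \<otimes>\<^bsub>mero V x\<^esub> b"
  by (simp_all add: inv_hol_def)

lemma invh_closed:
  assumes x: "x \<in> carrier V"
  shows "\<zero>\<^bsub>mero V x\<^esub> \<in> carrier (invh x)" "const_germ x c \<in> carrier (invh x)"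
    "a \<in> carrier (invh x) \<Longrightarrow> b \<in> carrier (invh x) \<Longrightarrow> a \<oplus>\<^bsub>mero V x\<^esub> b \<in> carrier (invh x)"
    "a \<in> carrier (invh x) \<Longrightarrow> b \<in> carrier (invh x) \<Longrightarrow> a \<otimes>\<^bsub>mero V x\<^esub> b \<in> carrier (invh x)"
proof -
  have stab: "act g x = x" "g \<in> carrier G" if "g \<in> stabilizer G act x" for g
    using that by (simp_all add: stabilizer_def)
  show "\<zero>\<^bsub>mero V x\<^esub> \<in> carrier (invh x)"
    using gam_zero[OF stab(2) x] stab x by (simp add: invh_iff hol_closed)
  show "const_germ x c \<in> carrier (invh x)"
    using gam_const_germ[OF stab(2) x] stab x by (simp add: invh_iff const_germ_hol)
  show "a \<oplus>\<^bsub>mero V x\<^esub> b \<in> carrier (invh x)" if "a \<in> carrier (invh x)" "b \<in> carrier (invh x)"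
    using gam_add[OF stab(2) x] stab x that by (simp add: invh_iff hol_closed hol_mero)
  show "a \<otimes>\<^bsub>mero V x\<^esub> b \<in> carrier (invh x)" if "a \<in> carrier (invh x)" "b \<in> carrier (invh x)"
    using gam_mult[OF stab(2) x] stab x that by (simp add: invh_iff hol_closed hol_mero)
qed

lemma invh_mero: "x \<in> carrier V \<Longrightarrow> a \<in> carrier (invh x) \<Longrightarrow> a \<in> carrier (mero V x)"
  by (simp add: invh_iff hol_mero)

lemma cring_invh:
  assumes x: "x \<in> carrier V"
  shows "cring (invh x)"
proof -
  interpret M: cring "mero V x" using x by (rule cring_mero)
  have sub: "subring (carrier (invh x)) (mero V x)"
  proof (rule M.subringI)
    show "carrier (invh x) \<subseteq> carrier (mero V x)" using invh_mero[OF x] by blast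
    show "\<one>\<^bsub>mero V x\<^esub> \<in> carrier (invh x)"
      using invh_closed(2)[OF x, of 1] by (simp add: const_germ_ops(2)[OF x])
    fix a assume a: "a \<in> carrier (invh x)"
    have c: "const_germ x c \<in> carrier (mero V x)" for c
      using invh_mero[OF x invh_closed(2)[OF x]] .
    have "const_germ x (-1) \<oplus>\<^bsub>mero V x\<^esub> \<one>\<^bsub>mero V x\<^esub> = \<zero>\<^bsub>mero V x\<^esub>"
      unfolding const_germ_ops(2)[OF x, symmetric] const_germ_ops(3)[OF x] by (simp add: const_germ_ops(1)[OF x])
    then have "const_germ x (-1) = \<ominus>\<^bsub>mero V x\<^esub> \<one>\<^bsub>mero V x\<^esub>"
      using c by (intro M.minus_equality[symmetric]) simp_all
    then have "\<ominus>\<^bsub>mero V x\<^esub> a = const_germ x (-1) \<otimes>\<^bsub>mero V x\<^esub> a"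
      using invh_mero[OF x a] by (simp add: M.l_minus)
    then show "\<ominus>\<^bsub>mero V x\<^esub> a \<in> carrier (invh x)"
      using invh_closed(4)[OF x invh_closed(2)[OF x] a] by simp
  qed (use invh_closed[OF x] in auto)
  have "invh x = (mero V x)\<lparr>carrier := carrier (invh x)\<rparr>"
    by (simp add: inv_hol_def hol_def)
  then show ?thesis
    using M.subcring_iff[OF subringE(1)[OF sub]] M.subcringI'[OF sub] by metis
qed

text \<open>
  By definition \<open>E_ideal\<close> is the image under translation of an ideal at the identity, cut down to the
  germs invariant under the stabilizer of \<open>x\<close>. The translation to \<open>x\<close> commutes with this stabilizer,
  so invariance can be required at \<open>x\<close> instead. This turns membership into a condition on the
  germ itself, with no existential quantifier.
\<close>

lemma E_ideal_iff:
  assumes x: "x \<in> carrier V"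
  shows "a \<in> E_ideal V G act x \<longleftrightarrow> a \<in> carrier (invh x) \<and> pull_back x a \<in> J"
proof
  assume "a \<in> E_ideal V G act x"
  then obtain b where b: "b \<in> carrier hol1"
    "\<And>g. g \<in> stabilizer G act x \<Longrightarrow> gam g \<one>\<^bsub>V\<^esub> b = b" "b \<in> J" and a: "a = tau x \<one>\<^bsub>V\<^esub> b"
    by (auto simp: E_ideal_def inv_hol_def)
  have "gam g x a = a" if "g \<in> stabilizer G act x" for g
    using gam_tau[of g x "\<one>\<^bsub>V\<^esub>" b] that stabilizerD[OF that] b x by (simp add: a hol_mero)
  moreover have "a \<in> carrier (hol V x)" using tau_hol[of x "\<one>\<^bsub>V\<^esub>" b] b x by (simp add: a)
  ultimately show "a \<in> carrier (invh x) \<and> pull_back x a \<in> J"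
    using b x by (simp add: a pull_back_tau hol_mero invh_iff)
next
  assume a: "a \<in> carrier (invh x) \<and> pull_back x a \<in> J"
  then have ah: "a \<in> carrier (hol V x)" by (simp add: invh_iff)
  have "gam g \<one>\<^bsub>V\<^esub> (pull_back x a) = pull_back x a" if "g \<in> stabilizer G act x" for g
    using gam_pull_back[of g x a] that stabilizerD[OF that] a x by (simp add: hol_mero ah invh_iff)
  then have "pull_back x a \<in> carrier (inv_hol V G act (stabilizer G act x) \<one>\<^bsub>V\<^esub>) \<inter> J"
    using a ah x by (simp add: inv_hol_def pull_back_hol)
  then show "a \<in> E_ideal V G act x"
    using tau_pull_back[OF x hol_mero[OF x ah]] unfolding E_ideal_def by (metis image_eqI)
qed

lemma E_ideal_ideal:
  assumes x: "x \<in> carrier V"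
  shows "ideal (E_ideal V G act x) (invh x)"
proof (rule ideal_of_closed[OF cring_invh[OF x]])
  show "E_ideal V G act x \<subseteq> carrier (invh x)" using E_ideal_iff[OF x] by blast
  show "\<zero>\<^bsub>invh x\<^esub> \<in> E_ideal V G act x"
    using x by (simp add: E_ideal_iff pull_back_zero J_zero invh_closed)
  fix a assume a: "a \<in> E_ideal V G act x"
  show "a \<oplus>\<^bsub>invh x\<^esub> b \<in> E_ideal V G act x" if b: "b \<in> E_ideal V G act x" for b
    using a b x by (simp add: E_ideal_iff pull_back_add J_add invh_closed invh_mero)
  show "r \<otimes>\<^bsub>invh x\<^esub> a \<in> E_ideal V G act x" if r: "r \<in> carrier (invh x)" for r
    using a r x J_mult[of "pull_back x a" "pull_back x r"] pull_back_hol[of x r]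
    by (simp add: E_ideal_iff pull_back_mult invh_closed invh_mero) (simp add: invh_iff)
qed

lemma gam_invh:
  assumes g: "g \<in> carrier G" and x: "x \<in> carrier V" and a: "a \<in> carrier (invh x)"
  shows "gam g x a \<in> carrier (invh (act g x))"
proof -
  have "gam h (act g x) (gam g x a) = gam g x a" if h: "h \<in> stabilizer G act (act g x)" for h
  proof -
    \<comment> \<open>conjugation by \<open>g\<inverse>\<close> maps the stabilizer of \<open>g \<cdot> x\<close> to that of \<open>x\<close>\<close>
    define k where "k = inv\<^bsub>G\<^esub> g \<otimes>\<^bsub>G\<^esub> (h \<otimes>\<^bsub>G\<^esub> g)"
    note hG = stabilizerD[OF h]
    have kG: "k \<in> carrier G" using g hG by (simp add: k_def)
    have "act k x = x" using g hG x by (simp add: k_def act_comp)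
    then have k: "k \<in> stabilizer G act x" using kG by (simp add: stabilizer_def)
    have "g \<otimes>\<^bsub>G\<^esub> k = h \<otimes>\<^bsub>G\<^esub> g" using g hG by (simp add: k_def flip: G.m_assoc)
    then have "gam h (act g x) (gam g x a) = gam g (act k x) (gam k x a)"
      using gam_gam[OF hG(1) g x] gam_gam[OF g kG x] invh_mero[OF x a] by simp
    also have "\<dots> = gam g x a"
      using a k \<open>act k x = x\<close> by (simp add: invh_iff)
    finally show ?thesis .
  qed
  then show ?thesis using gam_hol[OF g x] a by (simp add: invh_iff)
qed

lemma gam_E_ideal:
  assumes g: "g \<in> carrier G" and x: "x \<in> carrier V" and a: "a \<in> E_ideal V G act x"
  shows "gam g x a \<in> E_ideal V G act (act g x)"
  using a gam_invh[OF g x, of a] J_gam[OF g, of "pull_back x a"] gam_pull_back[OF g x, of a] g x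
  by (simp add: E_ideal_iff invh_mero)

definition coset :: "'a \<Rightarrow> 'a mgerm \<Rightarrow> 'a mgerm set" where
  "coset x a = E_ideal V G act x +>\<^bsub>invh x\<^esub> a"

lemma coset_eq: "coset x a = (\<lambda>i. i \<oplus>\<^bsub>mero V x\<^esub> a) ` E_ideal V G act x"
  by (auto simp: coset_def a_r_coset_def')

text \<open>
  Elements of \<open>G\<close> map the ideal at \<open>x\<close> onto the ideal at \<open>g \<cdot> x\<close>: into it because they preserve \<open>J\<close>,
  and onto it because the inverse maps back.
\<close>

lemma gam_coset:
  assumes g: "g \<in> carrier G" and x: "x \<in> carrier V" and a: "a \<in> carrier (mero V x)"
  shows "gam g x ` coset x a = coset (act g x) (gam g x a)"
proof -
  have E_mero: "i \<in> carrier (mero V y)" if "i \<in> E_ideal V G act y" "y \<in> carrier V" for i y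
    using that by (simp add: E_ideal_iff invh_mero)
  have img: "gam g x ` E_ideal V G act x = E_ideal V G act (act g x)"
  proof
    show "gam g x ` E_ideal V G act x \<subseteq> E_ideal V G act (act g x)"
      using gam_E_ideal[OF g x] by blast
    show "E_ideal V G act (act g x) \<subseteq> gam g x ` E_ideal V G act x"
    proof
      fix b assume b: "b \<in> E_ideal V G act (act g x)"
      have "gam (inv\<^bsub>G\<^esub> g) (act g x) b \<in> E_ideal V G act x"
        using gam_E_ideal[of "inv\<^bsub>G\<^esub> g" "act g x" b] g x b by simp
      moreover have "gam g x (gam (inv\<^bsub>G\<^esub> g) (act g x) b) = b"
        using gam_gam[of g "inv\<^bsub>G\<^esub> g" "act g x" b] gam_one[of "act g x" b] g x E_mero[OF b] by simp
      ultimately show "b \<in> gam g x ` E_ideal V G act x" by (metis image_eqI)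
    qed
  qed
  have "gam g x ` coset x a
      = (\<lambda>i. gam g x i \<oplus>\<^bsub>mero V (act g x)\<^esub> gam g x a) ` E_ideal V G act x"
    unfolding coset_eq image_image
    by (rule image_cong[OF refl]) (use g x a E_mero in \<open>simp add: gam_add\<close>)
  also have "\<dots> = (\<lambda>i. i \<oplus>\<^bsub>mero V (act g x)\<^esub> gam g x a) ` gam g x ` E_ideal V G act x"
    by (simp add: image_image)
  finally show ?thesis by (simp add: img coset_eq)
qed

lemma carrier_E_ring: "carrier (E_ring V G act x) = coset x ` carrier (invh x)"
  by (auto simp: E_ring_def FactRing_def A_RCOSETS_def' coset_def)

lemma zero_E_ring: "\<zero>\<^bsub>E_ring V G act x\<^esub> = E_ideal V G act x"
  by (simp add: E_ring_def FactRing_def)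

lemma add_E_ring:
  assumes "x \<in> carrier V" "a \<in> carrier (invh x)" "b \<in> carrier (invh x)"
  shows "coset x a \<oplus>\<^bsub>E_ring V G act x\<^esub> coset x b = coset x (a \<oplus>\<^bsub>mero V x\<^esub> b)"
  using abelian_subgroup.a_rcos_sum[OF abelian_subgroupI3[OF ideal.axioms(1)[OF E_ideal_ideal]
        ring.is_abelian_group[OF cring.axioms(1)[OF cring_invh]]], of x a b] assms
  by (simp add: E_ring_def FactRing_def coset_def)

lemma group_E_ring: "x \<in> carrier V \<Longrightarrow> group (add_monoid (E_ring V G act x))"
  unfolding E_ring_def
  by (rule abelian_group.a_group[OF ring.is_abelian_group[OF ideal.quotient_is_ring[OF E_ideal_ideal]]])

lemma coset_self: "x \<in> carrier V \<Longrightarrow> a \<in> carrier (invh x) \<Longrightarrow> a \<in> coset x a"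
  using abelian_subgroup.a_rcos_self[OF abelian_subgroupI3[OF ideal.axioms(1)[OF E_ideal_ideal]
        ring.is_abelian_group[OF cring.axioms(1)[OF cring_invh]]], of x a]
  by (simp add: coset_def)

lemma coset_eqI:
  "x \<in> carrier V \<Longrightarrow> a \<in> carrier (invh x) \<Longrightarrow> b \<in> coset x a \<Longrightarrow> coset x b = coset x a"
  using abelian_subgroup.a_repr_independence'[OF abelian_subgroupI3[OF ideal.axioms(1)[OF E_ideal_ideal]
        ring.is_abelian_group[OF cring.axioms(1)[OF cring_invh]]], of x b a]
  by (simp add: coset_def)

lemma coset_zero: "x \<in> carrier V \<Longrightarrow> coset x \<zero>\<^bsub>mero V x\<^esub> = E_ideal V G act x"
proof -
  assume x: "x \<in> carrier V"
  interpret M: cring "mero V x" using x by (rule cring_mero)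
  have "(\<lambda>i. i \<oplus>\<^bsub>mero V x\<^esub> \<zero>\<^bsub>mero V x\<^esub>) ` E_ideal V G act x = (\<lambda>i. i) ` E_ideal V G act x"
    by (rule image_cong[OF refl]) (use x in \<open>simp add: E_ideal_iff invh_mero\<close>)
  then show ?thesis by (simp add: coset_eq)
qed

lemma coset_eq_ideal_iff:
  assumes x: "x \<in> carrier V" and a: "a \<in> carrier (invh x)"
  shows "coset x a = E_ideal V G act x \<longleftrightarrow> pull_back x a \<in> J"
proof
  assume "coset x a = E_ideal V G act x"
  then show "pull_back x a \<in> J" using coset_self[OF x a] x by (simp add: E_ideal_iff)
next
  assume "pull_back x a \<in> J"
  then have "a \<in> coset x \<zero>\<^bsub>mero V x\<^esub>" using x a by (simp add: coset_zero E_ideal_iff)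
  then show "coset x a = E_ideal V G act x"
    using coset_eqI[OF x invh_closed(1)[OF x]] coset_zero[OF x] by simp
qed

end

section \<open>The quotient and the kernel\<close>

context invariant_subset
begin

abbreviation "\<E> \<equiv> E_sum V G act W"
abbreviation "quot \<equiv> O_to_E V G act"

lemma O_invh: "F \<in> carrier \<O> \<Longrightarrow> x \<in> carrier V \<Longrightarrow> F x \<in> carrier (invh x)"
  using O_equivariant[of F _ x, symmetric] finite_families_hol[OF O_finite_families]
  unfolding invh_iff by (simp add: stabilizer_def)

lemma carrier_E:
  "c \<in> carrier \<E> \<longleftrightarrow> c \<in> (\<Pi>\<^sub>E x\<in>carrier V. carrier (E_ring V G act x)) \<and>
    finite {x \<in> carrier V. c x \<noteq> E_ideal V G act x} \<and>
    (\<forall>x\<in>carrier V - W. c x = E_ideal V G act x) \<and>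
    (\<forall>g\<in>carrier G. \<forall>x\<in>carrier V. c (act g x) = gam g x ` c x)"
proof -
  have z: "gam g x ` E_ideal V G act x = E_ideal V G act (act g x)" if "g \<in> carrier G" "x \<in> carrier V" for g x
    using gam_coset[OF that cring.cring_simprules(2)[OF cring_mero]] that by (simp add: coset_zero gam_zero)
  show ?thesis
    unfolding E_sum_def
    by (subst carrier_invariant_sum[OF group_E_ring]) (simp_all add: zero_E_ring z)
qed

lemma E_mult: "c \<otimes>\<^bsub>\<E>\<^esub> d = (\<lambda>x\<in>carrier V. c x \<oplus>\<^bsub>E_ring V G act x\<^esub> d x)"
  by (simp add: E_sum_def invariant_sum_def point_sum_def)

lemma E_one: "\<one>\<^bsub>\<E>\<^esub> = (\<lambda>x\<in>carrier V. E_ideal V G act x)"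
  by (simp add: E_sum_def invariant_sum_def point_sum_def zero_E_ring)

lemma quot_eq: "quot F = (\<lambda>x\<in>carrier V. coset x (F x))"
  by (simp add: O_to_E_def coset_def)

lemma quot_in_E:
  assumes F: "F \<in> carrier \<O>"
  shows "quot F \<in> carrier \<E>"
proof -
  have "finite {x \<in> carrier V. quot F x \<noteq> E_ideal V G act x}"
    by (rule finite_subset[of _ "{x \<in> carrier V. F x \<noteq> \<zero>\<^bsub>mero V x\<^esub>}"])
      (use O_finite_families[OF F] in \<open>auto simp: quot_eq finite_families_def coset_zero\<close>)
  then show ?thesis
    using O_finite_families[OF F] O_invh[OF F] O_equivariant[OF F]
    by (auto simp: carrier_E quot_eq carrier_E_ring gam_coset invh_mero finite_families_def coset_zero)
qed

lemma quot_hom: "quot \<in> hom \<O> \<E>"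
proof (rule homI)
  fix F F' assume F: "F \<in> carrier \<O>" "F' \<in> carrier \<O>"
  show "quot (F \<otimes>\<^bsub>\<O>\<^esub> F') = quot F \<otimes>\<^bsub>\<E>\<^esub> quot F'"
    unfolding E_mult O_mult quot_eq
    by (rule restrict_ext) (use F in \<open>simp add: add_E_ring O_invh\<close>)
qed (rule quot_in_E)

lemma quot_one: "quot \<one>\<^bsub>\<O>\<^esub> = \<one>\<^bsub>\<E>\<^esub>"
  unfolding E_one O_one quot_eq by (rule restrict_ext) (simp add: coset_zero)

text \<open>
  Invariance under stabilizers is automatic for an invariant family, so only the condition at the
  identity remains.
\<close>

lemma kernel_quot_iff:
  "F \<in> kernel \<O> \<E> quot \<longleftrightarrow> F \<in> carrier \<O> \<and> (\<forall>x\<in>carrier V. pull_back x (F x) \<in> J)"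
proof -
  have "quot F = \<one>\<^bsub>\<E>\<^esub> \<longleftrightarrow> (\<forall>x\<in>carrier V. coset x (F x) = E_ideal V G act x)"
  proof
    assume eq: "quot F = \<one>\<^bsub>\<E>\<^esub>"
    show "\<forall>x\<in>carrier V. coset x (F x) = E_ideal V G act x"
    proof
      fix x assume "x \<in> carrier V"
      then show "coset x (F x) = E_ideal V G act x"
        using fun_cong[OF eq, of x] by (simp add: E_one quot_eq)
    qed
  qed (unfold E_one quot_eq, auto intro: restrict_ext)
  moreover have "coset x (F x) = E_ideal V G act x \<longleftrightarrow> pull_back x (F x) \<in> J"
    if "F \<in> carrier \<O>" "x \<in> carrier V" for x
    by (rule coset_eq_ideal_iff[OF that(2) O_invh[OF that]])
  ultimately show ?thesis unfolding kernel_def by blast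
qed

text \<open>
  Cosets of an ideal are affine subspaces over the constants, hence closed under averages.
\<close>

lemma coset_average:
  assumes x: "x \<in> carrier V" and a: "a \<in> carrier (invh x)"
    and S: "finite S" "S \<noteq> {}" and b: "\<And>i. i \<in> S \<Longrightarrow> b i \<in> coset x a"
  shows "const_germ x (1 / of_nat (card S)) \<otimes>\<^bsub>mero V x\<^esub> (\<Oplus>\<^bsub>mero V x\<^esub>i\<in>S. b i) \<in> coset x a"
proof -
  interpret M: cring "mero V x" using x by (rule cring_mero)
  interpret I: ideal "E_ideal V G act x" "invh x" using x by (rule E_ideal_ideal)
  let ?c = "const_germ x (1 / of_nat (card S))"
  have I_mero: "E_ideal V G act x \<subseteq> carrier (mero V x)"
    using x by (auto simp: E_ideal_iff invh_mero)
  have c: "?c \<in> carrier (mero V x)" using x by (rule const_germ_mero)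
  have am: "a \<in> carrier (mero V x)" using x a by (rule invh_mero)
  have "\<forall>i\<in>S. \<exists>j\<in>E_ideal V G act x. b i = j \<oplus>\<^bsub>mero V x\<^esub> a"
    using b by (auto simp: coset_eq)
  then obtain j where j: "\<And>i. i \<in> S \<Longrightarrow> j i \<in> E_ideal V G act x"
    "\<And>i. i \<in> S \<Longrightarrow> b i = j i \<oplus>\<^bsub>mero V x\<^esub> a" by metis
  have jm: "j \<in> S \<rightarrow> carrier (mero V x)" using j(1) I_mero by auto
  have "(\<Oplus>\<^bsub>mero V x\<^esub>i\<in>S. b i) = (\<Oplus>\<^bsub>mero V x\<^esub>i\<in>S. j i \<oplus>\<^bsub>mero V x\<^esub> a)"
    by (rule M.finsum_cong') (use j jm am in auto)
  also have "\<dots> = (\<Oplus>\<^bsub>mero V x\<^esub>i\<in>S. j i) \<oplus>\<^bsub>mero V x\<^esub> (\<Oplus>\<^bsub>mero V x\<^esub>i\<in>S. a)"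
    by (rule M.finsum_addf) (use jm am in auto)
  finally have sum: "?c \<otimes>\<^bsub>mero V x\<^esub> (\<Oplus>\<^bsub>mero V x\<^esub>i\<in>S. b i)
      = ?c \<otimes>\<^bsub>mero V x\<^esub> (\<Oplus>\<^bsub>mero V x\<^esub>i\<in>S. j i) \<oplus>\<^bsub>mero V x\<^esub> a"
    using M.r_distr[OF M.finsum_closed[OF jm] M.finsum_closed[of "\<lambda>_. a" S] c] am
      const_germ_average[OF x S am] by simp
  have "(\<Oplus>\<^bsub>mero V x\<^esub>i\<in>S. j i) \<in> E_ideal V G act x"
    by (rule M.finsum_mem[OF S(1) I_mero]) (use j(1) additive_subgroup.zero_closed[OF I.is_additive_subgroup]
          additive_subgroup.a_closed[OF I.is_additive_subgroup] in simp_all)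
  then have "?c \<otimes>\<^bsub>mero V x\<^esub> (\<Oplus>\<^bsub>mero V x\<^esub>i\<in>S. j i) \<in> E_ideal V G act x"
    using I.I_l_closed[of _ ?c] invh_closed(2)[OF x] by simp
  then show ?thesis unfolding sum coset_eq by blast
qed

text \<open>
  Representatives chosen at each point of the support need not fit together equivariantly. The
  average of their transports does, and it is still in the right coset: since the family of cosets
  is equivariant, all the germs that are averaged at \<open>x\<close> lie in the coset at \<open>x\<close>.
\<close>

lemma quot_surj: "quot ` carrier \<O> = carrier \<E>"
proof
  show "quot ` carrier \<O> \<subseteq> carrier \<E>" using quot_in_E by blast
  show "carrier \<E> \<subseteq> quot ` carrier \<O>"
  proof
    fix c assume c: "c \<in> carrier \<E>"
    have "\<exists>a\<in>carrier (invh x). c x = coset x a" if "x \<in> carrier V" for x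
    proof -
      have "c x \<in> carrier (E_ring V G act x)"
        using c that unfolding carrier_E by (blast intro: PiE_mem)
      then show ?thesis unfolding carrier_E_ring by blast
    qed
    then have "\<forall>x\<in>carrier V. \<exists>a. a \<in> carrier (invh x) \<and> c x = coset x a" by blast
    from bchoice[OF this] obtain a where
      "\<forall>x\<in>carrier V. a x \<in> carrier (invh x) \<and> c x = coset x (a x)" by (elim exE)
    then have a: "\<And>x. x \<in> carrier V \<Longrightarrow> a x \<in> carrier (invh x)"
      "\<And>x. x \<in> carrier V \<Longrightarrow> c x = coset x (a x)" by blast+
    \<comment> \<open>zero wherever the coset is trivial, so that the support stays finite\<close>
    define F where "F = (\<lambda>x\<in>carrier V. if c x = E_ideal V G act x then \<zero>\<^bsub>mero V x\<^esub> else a x)"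
    have Fc: "F x \<in> c x" if "x \<in> carrier V" for x
      using that a coset_self[of x "a x"] coset_self[of x "\<zero>\<^bsub>mero V x\<^esub>"] invh_closed(1)[OF that]
      by (auto simp: F_def coset_zero)
    have "finite {x \<in> carrier V. F x \<noteq> \<zero>\<^bsub>mero V x\<^esub>}"
      by (rule finite_subset[of _ "{x \<in> carrier V. c x \<noteq> E_ideal V G act x}"])
        (use c in \<open>auto simp: F_def carrier_E\<close>)
    then have F: "F \<in> finite_families"
      using c a(1) by (auto simp: finite_families_def F_def carrier_E hol_closed invh_iff)
    have "coset x (average F x) = c x" if x: "x \<in> carrier V" for x
    proof -
      have "shifted F g x \<in> coset x (a x)" if g: "g \<in> carrier G" for g
      proof -
        have "c (act g (act (inv\<^bsub>G\<^esub> g) x)) = gam g (act (inv\<^bsub>G\<^esub> g) x) ` c (act (inv\<^bsub>G\<^esub> g) x)"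
          using c g act_closed[OF G.inv_closed[OF g] x] unfolding carrier_E by blast
        then have "c x = gam g (act (inv\<^bsub>G\<^esub> g) x) ` c (act (inv\<^bsub>G\<^esub> g) x)"
          using g x by simp
        then show ?thesis using Fc[of "act (inv\<^bsub>G\<^esub> g) x"] g x a(2)[OF x] by auto
      qed
      then have "average F x \<in> coset x (a x)"
        using coset_average[OF x a(1)[OF x] finite_G carrier_G_nonempty] x by (simp add: average_def)
      then show ?thesis using coset_eqI[OF x a(1)[OF x]] a(2)[OF x] by simp
    qed
    then have "quot (average F) = c"
      by (intro ext) (use c in \<open>auto simp: quot_eq carrier_E PiE_iff extensional_def\<close>)
    then show "c \<in> quot ` carrier \<O>" using average_O[OF F] by blast
  qed
qed

text \<open>
  Translated back to the identity, the germ of the product is a multiple of the generator \<open>p\<close>.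
\<close>

lemma constant_mult_kernel:
  assumes p: "p \<in> J_gens" and F: "F \<in> carrier \<O>"
  shows "constant_family p \<boxdot> F \<in> kernel \<O> \<E> quot"
proof -
  note ph = J_gens(1)[OF p]
  note Fh = finite_families_hol[OF O_finite_families[OF F]]
  have "(constant_family p \<boxdot> F) (act g x) = gam g x ((constant_family p \<boxdot> F) x)"
    if "g \<in> carrier G" "x \<in> carrier V" for g x
    using that constant_family_equivariant[OF ph J_gens(2)[OF p], of g x] O_equivariant[OF F]
      families_closed[OF constant_family_in[OF ph]] Fh
    by (simp add: gam_mult hol_mero)
  moreover have "constant_family p \<boxdot> F \<in> finite_families"
    by (rule family_mult_finite[OF constant_family_hol[OF ph] O_finite_families[OF F]])
  ultimately have "constant_family p \<boxdot> F \<in> carrier \<O>"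
    by (simp add: carrier_O)
  moreover have "pull_back x ((constant_family p \<boxdot> F) x) \<in> J" if x: "x \<in> carrier V" for x
  proof -
    interpret M: cring "mero1" by (rule cring_mero) simp
    have pm: "p \<in> carrier mero1" using ph by (simp add: hol_mero)
    have "pull_back x ((constant_family p \<boxdot> F) x) = p \<otimes>\<^bsub>mero1\<^esub> pull_back x (F x)"
      using x pm Fh[OF x] tau_closed[OF x, of "\<one>\<^bsub>V\<^esub>" p]
      by (simp add: constant_family_def pull_back_mult pull_back_tau hol_mero)
    also have "\<dots> = pull_back x (F x) \<otimes>\<^bsub>mero1\<^esub> p"
      using x pm Fh[OF x] by (simp add: M.m_comm pull_back_closed hol_mero)
    finally show ?thesis
      using J_mult[of p "pull_back x (F x)"] J_gens_subset p pull_back_hol[OF x Fh[OF x]] by auto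
  qed
  ultimately show ?thesis by (simp add: kernel_quot_iff)
qed

end

section \<open>Operators of the skew group ring\<close>

locale skew_operator = invariant_subset V G act W
  for V :: "'a space_group" and G :: "'g monoid" and act W +
  fixes L :: "'a set" and A :: "'a \<Rightarrow> 'a \<Rightarrow> 'a mgerm"
  assumes L_subgroup: "subgroup L V"
    and A: "A \<in> carrier (skew_group_ring V L)"
    and A_preserves: "skew_act V L A ` carrier \<O> \<subseteq> carrier \<O>"
begin

abbreviation "op \<equiv> skew_act V L A"

lemma finite_support: "finite (skew_support V L A)"
  using A by (simp add: skew_group_ring_def)

lemma support_in: "\<xi> \<in> skew_support V L A \<Longrightarrow> \<xi> \<in> carrier V"
  using subgroup.subset[OF L_subgroup] by (auto simp: skew_support_def)

lemma coefficient_closed: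
  assumes "\<xi> \<in> skew_support V L A" "x \<in> carrier V"
  shows "A \<xi> x \<in> carrier (mero V x)"
proof -
  have "A \<xi> \<in> global_mero V"
    using A assms(1) by (auto simp: skew_group_ring_def skew_support_def)
  then show ?thesis using assms(2) by (auto simp: global_mero_def)
qed

lemma translate_family_apply:
  "\<xi> \<in> carrier V \<Longrightarrow> x \<in> carrier V \<Longrightarrow>
    translate_family V \<xi> F x = tau \<xi> (inv\<^bsub>V\<^esub> \<xi> \<otimes>\<^bsub>V\<^esub> x) (F (inv\<^bsub>V\<^esub> \<xi> \<otimes>\<^bsub>V\<^esub> x))"
  by (simp add: translate_family_def)

lemma translate_family_closed:
  assumes "F \<in> families" "\<xi> \<in> carrier V" "x \<in> carrier V"
  shows "translate_family V \<xi> F x \<in> carrier (mero V x)"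
  using tau_closed[of \<xi> "inv\<^bsub>V\<^esub> \<xi> \<otimes>\<^bsub>V\<^esub> x"] assms
  by (simp add: translate_family_apply families_closed)

lemma op_apply:
  "x \<in> carrier V \<Longrightarrow> op F x =
    (\<Oplus>\<^bsub>mero V x\<^esub>\<xi>\<in>skew_support V L A. A \<xi> x \<otimes>\<^bsub>mero V x\<^esub> translate_family V \<xi> F x)"
  by (simp add: skew_act_def)

lemma op_outside: "x \<notin> carrier V \<Longrightarrow> op F x = undefined"
  by (simp add: skew_act_def)

lemma op_term_closed:
  assumes "F \<in> families" "\<xi> \<in> skew_support V L A" "x \<in> carrier V"
  shows "A \<xi> x \<otimes>\<^bsub>mero V x\<^esub> translate_family V \<xi> F x \<in> carrier (mero V x)"
  by (rule cring.cring_simprules(5)[OF cring_mero[OF assms(3)] coefficient_closed[OF assms(2,3)]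
        translate_family_closed[OF assms(1) support_in[OF assms(2)] assms(3)]])

lemma op_zero: "op family_zero = family_zero"
proof
  fix x show "op family_zero x = family_zero x"
  proof (cases "x \<in> carrier V")
    case x: True
    interpret M: cring "mero V x" using x by (rule cring_mero)
    have "translate_family V \<xi> family_zero x = \<zero>\<^bsub>mero V x\<^esub>" if "\<xi> \<in> carrier V" for \<xi>
      using that x tau_zero[of \<xi> "inv\<^bsub>V\<^esub> \<xi> \<otimes>\<^bsub>V\<^esub> x"] by (simp add: translate_family_apply)
    then have "op family_zero x = (\<Oplus>\<^bsub>mero V x\<^esub>\<xi>\<in>skew_support V L A. \<zero>\<^bsub>mero V x\<^esub>)"
      unfolding op_apply[OF x]
      by (intro M.finsum_cong') (auto simp: support_in coefficient_closed x)
    then show ?thesis using x by simp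
  qed (simp add: op_outside)
qed

lemma op_add:
  assumes F: "F \<in> families" "F' \<in> families"
  shows "op (F \<boxplus> F') = op F \<boxplus> op F'"
proof
  fix x show "op (F \<boxplus> F') x = (op F \<boxplus> op F') x"
  proof (cases "x \<in> carrier V")
    case x: True
    interpret M: cring "mero V x" using x by (rule cring_mero)
    have tr: "translate_family V \<xi> (F \<boxplus> F') x = translate_family V \<xi> F x \<oplus>\<^bsub>mero V x\<^esub> translate_family V \<xi> F' x"
      if "\<xi> \<in> carrier V" for \<xi>
      using that x F tau_add[of \<xi> "inv\<^bsub>V\<^esub> \<xi> \<otimes>\<^bsub>V\<^esub> x"] by (simp add: translate_family_apply families_closed)
    note cl = op_term_closed[OF F(1) _ x] op_term_closed[OF F(2) _ x]
    have "op (F \<boxplus> F') x = (\<Oplus>\<^bsub>mero V x\<^esub>\<xi>\<in>skew_support V L A.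
        A \<xi> x \<otimes>\<^bsub>mero V x\<^esub> translate_family V \<xi> F x \<oplus>\<^bsub>mero V x\<^esub> A \<xi> x \<otimes>\<^bsub>mero V x\<^esub> translate_family V \<xi> F' x)"
      unfolding op_apply[OF x]
      by (rule M.finsum_cong')
        (auto simp: tr support_in coefficient_closed translate_family_closed F x M.r_distr)
    also have "\<dots> = op F x \<oplus>\<^bsub>mero V x\<^esub> op F' x"
      unfolding op_apply[OF x] by (rule M.finsum_addf) (use cl in auto)
    finally show ?thesis using x by simp
  qed (simp add: op_outside)
qed

text \<open>
  A family that is invariant under translations passes through every term \<open>f\<^sub>i \<phi>\<^bsub>\<xi>\<^sub>i\<^esub>\<close> of the operator.
\<close>

lemma op_constant_mult:
  assumes p: "p \<in> carrier hol1" and F: "F \<in> families"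
  shows "op (constant_family p \<boxdot> F) = constant_family p \<boxdot> op F"
proof
  fix x show "op (constant_family p \<boxdot> F) x = (constant_family p \<boxdot> op F) x"
  proof (cases "x \<in> carrier V")
    case x: True
    interpret M: cring "mero V x" using x by (rule cring_mero)
    note P = families_closed[OF constant_family_in[OF p]]
    have tr: "translate_family V \<xi> (constant_family p \<boxdot> F) x
        = constant_family p x \<otimes>\<^bsub>mero V x\<^esub> translate_family V \<xi> F x"
      if \<xi>: "\<xi> \<in> carrier V" for \<xi>
    proof -
      let ?y = "inv\<^bsub>V\<^esub> \<xi> \<otimes>\<^bsub>V\<^esub> x"
      have y: "?y \<in> carrier V" using \<xi> x by simp
      have "tau \<xi> ?y (constant_family p ?y) = constant_family p x"
        using tau_tau[OF \<xi> y, of "\<one>\<^bsub>V\<^esub>" p] \<xi> x y p by (simp add: constant_family_def hol_mero)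
      then show ?thesis
        using tau_mult[OF \<xi> y P[OF y] families_closed[OF F y]] \<xi> x y by (simp add: translate_family_apply)
    qed
    note cl = op_term_closed[OF F _ x]
    have "op (constant_family p \<boxdot> F) x = (\<Oplus>\<^bsub>mero V x\<^esub>\<xi>\<in>skew_support V L A.
        constant_family p x \<otimes>\<^bsub>mero V x\<^esub> (A \<xi> x \<otimes>\<^bsub>mero V x\<^esub> translate_family V \<xi> F x))"
      unfolding op_apply[OF x]
      by (rule M.finsum_cong')
        (auto simp: tr support_in coefficient_closed translate_family_closed F x P M.m_lcomm)
    also have "\<dots> = constant_family p x \<otimes>\<^bsub>mero V x\<^esub> op F x"
      unfolding op_apply[OF x]
      by (rule M.finsum_rdistr[symmetric]) (use cl finite_support P x in auto)
    finally show ?thesis using x by simp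
  qed (simp add: op_outside)
qed

text \<open>
  The conclusion for a single family, as a set of families of meromorphic germs in which the
  inductions over the ideal and over the support take place.
\<close>

definition sent_to_kernel :: "('a \<Rightarrow> 'a mgerm) set" where
  "sent_to_kernel = {F \<in> families. op F \<in> kernel \<O> \<E> quot}"

lemma sent_to_kernel_zero: "family_zero \<in> sent_to_kernel"
  using monoid.one_closed[OF group.is_monoid[OF O_group]]
  by (simp add: sent_to_kernel_def op_zero finite_families_families family_zero_finite kernel_quot_iff
      O_one pull_back_zero J_zero)

lemma sent_to_kernel_add:
  assumes F: "F \<in> sent_to_kernel" "F' \<in> sent_to_kernel"
  shows "F \<boxplus> F' \<in> sent_to_kernel"
proof -
  have k: "op F \<in> carrier \<O>" "op F' \<in> carrier \<O>"
    "\<And>x. x \<in> carrier V \<Longrightarrow> pull_back x (op F x) \<in> J" "\<And>x. x \<in> carrier V \<Longrightarrow> pull_back x (op F' x) \<in> J"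
    using F by (auto simp: sent_to_kernel_def kernel_quot_iff)
  have "op F \<boxplus> op F' \<in> carrier \<O>"
    using monoid.m_closed[OF group.is_monoid[OF O_group] k(1,2)] by (simp add: O_mult)
  moreover have "pull_back x ((op F \<boxplus> op F') x) \<in> J" if x: "x \<in> carrier V" for x
    using k(3,4)[OF x] x invh_mero[OF x O_invh[OF k(1) x]] invh_mero[OF x O_invh[OF k(2) x]]
    by (simp add: pull_back_add J_add)
  ultimately show ?thesis
    using F by (simp add: sent_to_kernel_def family_add_closed op_add kernel_quot_iff)
qed

lemma point_family_finite:
  assumes "x \<in> W" "a \<in> carrier (hol V x)"
  shows "point_family x a \<in> finite_families"
proof -
  have "finite {y \<in> carrier V. point_family x a y \<noteq> \<zero>\<^bsub>mero V y\<^esub>}"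
    by (rule finite_subset[of _ "{x}"]) (auto simp: point_family_def)
  then show ?thesis
    using assms by (auto simp: finite_families_def point_family_def hol_closed)
qed

text \<open>
  The heart of the proof: the family concentrated at \<open>x\<close> with germ \<open>\<phi>\<^sub>x(r p)\<close> is the product of the
  translation-invariant family of \<open>p\<close> with a family concentrated at \<open>x\<close>. The first factor can be taken
  out of the average and out of the operator, and what is left is an invariant family.
\<close>

lemma sent_to_kernel_generator_multiple:
  assumes p: "p \<in> J_gens" and r: "r \<in> carrier hol1" and x: "x \<in> W"
  shows "average (point_family x (tau x \<one>\<^bsub>V\<^esub> (r \<otimes>\<^bsub>mero1\<^esub> p))) \<in> sent_to_kernel"
proof -
  note ph = J_gens(1)[OF p]
  have xV: "x \<in> carrier V" using x W_subset by blast
  define D where "D = point_family x (tau x \<one>\<^bsub>V\<^esub> r)"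
  have D: "D \<in> finite_families"
    unfolding D_def by (rule point_family_finite[OF x]) (use tau_hol[OF xV _ r] xV in simp)
  have "point_family x (tau x \<one>\<^bsub>V\<^esub> (r \<otimes>\<^bsub>mero1\<^esub> p)) = constant_family p \<boxdot> D"
  proof
    fix y
    interpret N: cring "mero V x" using xV by (rule cring_mero)
    have one: "constant_family p y \<otimes>\<^bsub>mero V y\<^esub> \<zero>\<^bsub>mero V y\<^esub> = \<zero>\<^bsub>mero V y\<^esub>" if y: "y \<in> carrier V"
      using cring.cring_simprules(27)[OF cring_mero[OF y] families_closed[OF constant_family_in[OF ph] y]] .
    have "tau x \<one>\<^bsub>V\<^esub> (r \<otimes>\<^bsub>mero1\<^esub> p) = tau x \<one>\<^bsub>V\<^esub> p \<otimes>\<^bsub>mero V x\<^esub> tau x \<one>\<^bsub>V\<^esub> r"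
      using tau_mult[OF xV, of "\<one>\<^bsub>V\<^esub>" r p] tau_closed[OF xV, of "\<one>\<^bsub>V\<^esub>"] r ph xV
      by (simp add: hol_mero N.m_comm)
    then show "point_family x (tau x \<one>\<^bsub>V\<^esub> (r \<otimes>\<^bsub>mero1\<^esub> p)) y = (constant_family p \<boxdot> D) y"
      using one xV by (cases "y \<in> carrier V") (auto simp: D_def point_family_def constant_family_def)
  qed
  then have eq: "average (point_family x (tau x \<one>\<^bsub>V\<^esub> (r \<otimes>\<^bsub>mero1\<^esub> p)))
      = constant_family p \<boxdot> average D"
    using average_mult[OF constant_family_in[OF ph] constant_family_equivariant[OF ph J_gens(2)[OF p]]
        finite_families_families[OF D]] by simp
  have avD: "average D \<in> carrier \<O>" by (rule average_O[OF D])
  have fam: "average D \<in> families"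
    by (rule finite_families_families[OF O_finite_families[OF avD]])
  have "op (average D) \<in> carrier \<O>" using A_preserves avD by blast
  then have "op (constant_family p \<boxdot> average D) \<in> kernel \<O> \<E> quot"
    unfolding op_constant_mult[OF ph fam] by (rule constant_mult_kernel[OF p])
  then show ?thesis
    using family_mult_closed[OF constant_family_in[OF ph] fam] by (simp add: eq sent_to_kernel_def)
qed

lemma sent_to_kernel_point_family:
  assumes x: "x \<in> W" and a: "a \<in> J"
  shows "average (point_family x (tau x \<one>\<^bsub>V\<^esub> a)) \<in> sent_to_kernel"
proof -
  have xV: "x \<in> carrier V" using x W_subset by blast
  interpret M: cring "mero1" by (rule cring_mero) simp
  interpret N: cring "mero V x" using xV by (rule cring_mero)
  have hm: "b \<in> carrier mero1" if "b \<in> carrier hol1" for b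
    using that by (simp add: hol_mero)
  let ?av = "\<lambda>b. average (point_family x (tau x \<one>\<^bsub>V\<^esub> b))"
  \<comment> \<open>quantifying over the multiplier \<open>r\<close> makes this set closed under multiples\<close>
  let ?I = "{b \<in> carrier hol1. \<forall>r\<in>carrier hol1. ?av (r \<otimes>\<^bsub>mero1\<^esub> b) \<in> sent_to_kernel}"
  have pf: "point_family x (tau x \<one>\<^bsub>V\<^esub> b) \<in> finite_families" if "b \<in> carrier hol1" for b
    by (rule point_family_finite[OF x]) (use tau_hol[OF xV _ that] xV in simp)
  have add: "?av (b \<oplus>\<^bsub>mero1\<^esub> c) = ?av b \<boxplus> ?av c"
    if b: "b \<in> carrier hol1" and c: "c \<in> carrier hol1" for b c
  proof -
    have "point_family x (tau x \<one>\<^bsub>V\<^esub> (b \<oplus>\<^bsub>mero1\<^esub> c))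
      = point_family x (tau x \<one>\<^bsub>V\<^esub> b) \<boxplus> point_family x (tau x \<one>\<^bsub>V\<^esub> c)"
      unfolding family_add_def
      using tau_add[OF xV, of "\<one>\<^bsub>V\<^esub>" b c] b c xV cring.cring_simprules(2,8)[OF cring_mero]
      by (auto simp: point_family_def hm intro!: restrict_ext)
    then show ?thesis
      using average_add[OF finite_families_families[OF pf[OF b]] finite_families_families[OF pf[OF c]]] by simp
  qed
  have "J \<subseteq> ?I"
  proof (rule J_induct)
    have "point_family x \<zero>\<^bsub>mero V x\<^esub> = family_zero"
      unfolding point_family_def family_zero_def by (rule restrict_ext) simp
    moreover have "average family_zero = family_zero"
      by (rule average_invariant) (simp_all add: finite_families_families family_zero_finite gam_zero)
    ultimately have "?av \<zero>\<^bsub>mero1\<^esub> \<in> sent_to_kernel"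
      using tau_zero[OF xV, of "\<one>\<^bsub>V\<^esub>"] xV sent_to_kernel_zero by simp
    then show "\<zero>\<^bsub>mero1\<^esub> \<in> ?I" by (simp add: hol_closed hm)
  next
    fix b c assume "b \<in> ?I" "c \<in> ?I"
    then show "b \<oplus>\<^bsub>mero1\<^esub> c \<in> ?I"
      by (simp add: hol_closed hm M.r_distr add sent_to_kernel_add)
  next
    fix b r assume b: "b \<in> ?I" and r: "r \<in> carrier hol1"
    have "?av (s \<otimes>\<^bsub>mero1\<^esub> (r \<otimes>\<^bsub>mero1\<^esub> b)) \<in> sent_to_kernel" if s: "s \<in> carrier hol1" for s
    proof -
      have "s \<otimes>\<^bsub>mero1\<^esub> r \<in> carrier hol1" using r s by (simp add: hol_closed)
      then have "?av (s \<otimes>\<^bsub>mero1\<^esub> r \<otimes>\<^bsub>mero1\<^esub> b) \<in> sent_to_kernel" using b by blast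
      then show ?thesis using b r s by (simp add: M.m_assoc hm)
    qed
    then show "r \<otimes>\<^bsub>mero1\<^esub> b \<in> ?I" using b r by (simp add: hol_closed)
  next
    show "J_gens \<subseteq> ?I" using sent_to_kernel_generator_multiple[OF _ _ x] J_gens(1) by blast
  qed blast
  then have "?av (\<one>\<^bsub>mero1\<^esub> \<otimes>\<^bsub>mero1\<^esub> a) \<in> sent_to_kernel"
    using a hol_closed(2)[of "\<one>\<^bsub>V\<^esub>"] by blast
  then show ?thesis using hm[OF J_hol[OF a]] by simp
qed

text \<open>
  An element of the kernel equals its own average, and it is the sum of its germs at the points of
  its support, each of which comes from \<open>J\<close>.
\<close>

theorem op_kernel: "op ` kernel \<O> \<E> quot \<subseteq> kernel \<O> \<E> quot"
proof
  fix E assume "E \<in> op ` kernel \<O> \<E> quot"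
  then obtain F where E: "E = op F" and F: "F \<in> kernel \<O> \<E> quot" by blast
  have FO: "F \<in> carrier \<O>" and FJ: "\<And>x. x \<in> carrier V \<Longrightarrow> pull_back x (F x) \<in> J"
    using F by (auto simp: kernel_quot_iff)
  note Ff = O_finite_families[OF FO]
  \<comment> \<open>the family restricted to \<open>S\<close>; the induction is over finite sets \<open>S\<close> of points\<close>
  define cut where "cut S = (\<lambda>x\<in>carrier V. if x \<in> S then F x else \<zero>\<^bsub>mero V x\<^esub>)" for S
  have cut_families: "cut S \<in> families" for S
    using finite_families_families[OF Ff] hol_closed(1) hol_mero
    by (auto simp: families_def cut_def PiE_iff)
  have cut_sent: "average (cut S) \<in> sent_to_kernel" if "finite S" "S \<subseteq> W" for S
    using that
  proof (induction S rule: finite_induct)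
    case empty
    have "cut {} = family_zero" by (auto simp: cut_def family_zero_def)
    moreover have "average family_zero = family_zero"
      by (rule average_invariant) (simp_all add: finite_families_families family_zero_finite gam_zero)
    ultimately show ?case using sent_to_kernel_zero by simp
  next
    case (insert x S)
    have x: "x \<in> W" "x \<in> carrier V" using insert.prems W_subset by auto
    have Fx: "F x \<in> carrier (mero V x)"
      using finite_families_families[OF Ff] x by (simp add: families_closed)
    then have tp: "tau x \<one>\<^bsub>V\<^esub> (pull_back x (F x)) = F x" by (rule tau_pull_back[OF x(2)])
    have z: "a \<oplus>\<^bsub>mero V y\<^esub> \<zero>\<^bsub>mero V y\<^esub> = a" "\<zero>\<^bsub>mero V y\<^esub> \<oplus>\<^bsub>mero V y\<^esub> a = a"
      if "y \<in> carrier V" "a \<in> carrier (mero V y)" for a y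
      using cring.cring_simprules(8,16)[OF cring_mero[OF that(1)] that(2)] by simp_all
    have Fy: "F y \<in> carrier (mero V y)" if "y \<in> carrier V" for y
      using finite_families_families[OF Ff] that by (simp add: families_closed)
    have zc: "\<zero>\<^bsub>mero V y\<^esub> \<in> carrier (mero V y)" if "y \<in> carrier V" for y
      using cring.cring_simprules(2)[OF cring_mero[OF that]] .
    have "cut (insert x S) = point_family x (F x) \<boxplus> cut S"
      unfolding family_add_def cut_def
      using insert.hyps(2) x by (intro restrict_ext) (auto simp: point_family_def z Fy zc)
    moreover have "point_family x (F x) \<in> families"
      by (rule finite_families_families[OF point_family_finite[OF x(1) finite_families_hol[OF Ff x(2)]]])
    ultimately have "average (cut (insert x S)) = average (point_family x (F x)) \<boxplus> average (cut S)"
      using average_add cut_families by simp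
    moreover have "average (point_family x (F x)) \<in> sent_to_kernel"
      using sent_to_kernel_point_family[OF x(1) FJ[OF x(2)]] by (simp add: tp)
    ultimately show ?case using insert sent_to_kernel_add by simp
  qed
  let ?S = "{x \<in> carrier V. F x \<noteq> \<zero>\<^bsub>mero V x\<^esub>}"
  have "cut ?S = F"
    by (intro ext) (use Ff in \<open>auto simp: cut_def finite_families_def PiE_iff extensional_def\<close>)
  moreover have "average F = F"
    by (rule average_invariant[OF finite_families_families[OF Ff] O_equivariant[OF FO]])
  moreover have "finite ?S" "?S \<subseteq> W" using Ff by (auto simp: finite_families_def)
  ultimately have "F \<in> sent_to_kernel" using cut_sent[of ?S] by simp
  then show "E \<in> kernel \<O> \<E> quot" by (simp add: E sent_to_kernel_def)
qed

text \<open>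
  The operator is additive, maps the kernel to itself, and invariant families map onto the
  quotient.
\<close>

theorem op_descends: "\<exists>B\<in>hom \<E> \<E>. \<forall>F\<in>carrier \<O>. B (quot F) = quot (op F)"
proof (rule hom_factors_through_surjection[OF O_group quot_hom quot_surj quot_one _ op_kernel])
  show "op \<in> hom \<O> \<O>"
    by (rule homI) (use A_preserves in \<open>auto simp: O_mult op_add finite_families_families O_finite_families\<close>)
qed

end

section \<open>The induced action on the quotient\<close>

theorem theorem4:
  fixes V :: "'a space_group" and G :: "'g monoid" and act :: "'g \<Rightarrow> 'a \<Rightarrow> 'a"
    and L :: "'a set" and v :: 'a and A :: "'a \<Rightarrow> 'a \<Rightarrow> 'a mgerm" and W :: "'a set"
  assumes "complex_lie_group V \<or> linear_algebraic_group V"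
    and "group G" and "finite (carrier G)"
    and "acts_by_automorphisms V G act"
    and "subgroup L V" and "\<forall>g\<in>carrier G. act g ` L \<subseteq> L"
    and "v \<in> carrier V"
  defines "W \<equiv> semidirect_orbit V G act L v"
  assumes "A \<in> carrier (skew_group_ring V L)"
    and "skew_act V L A ` carrier (O_sum V G act W) \<subseteq> carrier (O_sum V G act W)"
  shows "(\<exists>B \<in> hom (E_sum V G act W) (E_sum V G act W).
            \<forall>F \<in> carrier (O_sum V G act W).
              B (O_to_E V G act F) = O_to_E V G act (skew_act V L A F)) \<and>
         skew_act V L A ` kernel (O_sum V G act W) (E_sum V G act W) (O_to_E V G act)
           \<subseteq> kernel (O_sum V G act W) (E_sum V G act W) (O_to_E V G act)"
proof -
  have "space_with_functions V \<and> group V \<and>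
    (\<forall>\<xi>\<in>carrier V. space_morphism (topo V) (reg V) (topo V) (reg V) (\<lambda>y. \<xi> \<otimes>\<^bsub>V\<^esub> y))"
    using assms(1)
  proof
    assume V: "complex_lie_group V"
    then have "group V" by (simp add: complex_lie_group_def)
    then show ?thesis
      using lie_group_space_with_functions[OF V] lie_group_translation[OF V] by blast
  next
    assume "linear_algebraic_group V"
    then obtain n \<rho> where "embedded_algebraic_group V n \<rho>" by (rule algebraic_group_embedding)
    then interpret V: embedded_algebraic_group V n \<rho> .
    show ?thesis
      using V.space_with_functions V.translation V.V.group_axioms by blast
  qed
  then interpret group_with_finite_action V G act
    using assms(2-4)
    by (intro group_with_finite_action.intro group_with_finite_action_axioms.intro) simp_all
  have L_sub: "L \<subseteq> carrier V" using assms(5) by (rule subgroup.subset)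
  interpret skew_operator V G act W L A
  proof (intro skew_operator.intro skew_operator_axioms.intro invariant_subset.intro
      invariant_subset_axioms.intro)
    show "group_with_finite_action V G act" by unfold_locales
    show "W \<subseteq> carrier V"
      using L_sub assms(7) by (auto simp: W_def semidirect_orbit_def)
    fix h x assume h: "h \<in> carrier G" and "x \<in> W"
    then obtain g \<xi> where x: "g \<in> carrier G" "\<xi> \<in> L" "x = act g (\<xi> \<otimes>\<^bsub>V\<^esub> v)"
      by (auto simp: W_def semidirect_orbit_def)
    then have "act h x = act (h \<otimes>\<^bsub>G\<^esub> g) (\<xi> \<otimes>\<^bsub>V\<^esub> v)"
      using h L_sub assms(7) by (auto simp: act_comp)
    then show "act h x \<in> W"
      using h x(1,2) unfolding W_def semidirect_orbit_def by blast
  qed (fact assms)+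
  show ?thesis
    using op_descends op_kernel by (rule conjI)
qed

end
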